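(* Assume the Continuum Hypothesis. For each ideal $\mathcal{I}$ (on a countably infinite set) and each $\rho\in\{\mathrm{FS},r,\Delta\}$ the following conditions are equivalent: (1) $\rho_{\mathcal{I}}\not\leq_K\rho$. (2) There exists a Hindman space (if $\rho=\mathrm{FS}$), respectively a Ramsey space (if $\rho=r$), respectively a differentially compact space (if $\rho=\Delta$), that is not in $\mathrm{FinBW}(\mathcal{I})$. Moreover, when these conditions hold, an example as in (2) can be found that is separable and has unique limits of sequences. If $\mathcal{I}$ is $P^-$, then an example can be found of the form $\Phi(\mathcal{A})$ with $\mathcal{A}$ almost disjoint of cardinality $\mathfrak{c}$ (in particular, it is Hausdorff, compact, separable and of cardinality $\mathfrak{c}$).
   Context: Topological spaces are not assumed Hausdorff. $\omega=\{0,1,2,\dots\}$; $[A]^\omega$ is the family of infinite countable subsets of $A$, $[A]^{<\omega}$ the family of finite subsets. An ideal on a countably infinite set $\Lambda$ is a nonempty family $\mathcal{I}\subseteq\mathcal{P}(\Lambda)$ closed under subsets and finite unions, containing all finite subsets of $\Lambda$, with $\Lambda\notin\mathcal{I}$; $\mathcal{I}^+=\mathcal{P}(\Lambda)\setminus\mathcal{I}$. An ideal $\mathcal{I}$ is $P^-$ if for every $\subseteq$-decreasing sequence $A_n\in\mathcal{I}^+$ with $A_n\setminus A_{n+1}\in\mathcal{I}$ for all $n$ there is $B\in\mathcal{I}^+$ with $B\setminus A_n$ finite for all $n$. Functions: $\mathrm{FS}:[\omega]^\omega\to[\omega]^\omega$, where $\mathrm{FS}(D)$ is the set of all sums of nonempty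 finite sets of distinct elements of $D$; $r:[\omega]^\omega\to[[\omega]^2]^\omega$, $r(D)=[D]^2$, the set of unordered pairs of distinct elements of $D$; $\Delta:[\omega]^\omega\to[\omega]^\omega$, $\Delta(D)=\{a-b:a,b\in D,\ a>b\}$; and for an ideal $\mathcal{I}$ on $\Lambda$, $\rho_{\mathcal{I}}:\mathcal{I}^+\to[\Lambda]^\omega$, $\rho_{\mathcal{I}}(A)=A$. For functions $\rho_i:\mathcal{F}_i\to[\Lambda_i]^\omega$ with $\mathcal{F}_i\subseteq[\Omega_i]^\omega$ ($i=1,2$), each of which is one of $\mathrm{FS}$, $r$, $\Delta$ or $\rho_{\mathcal{I}}$ for an ideal $\mathcal{I}$, $\rho_2\leq_K\rho_1$ means: there is $\phi:\Lambda_1\to\Lambda_2$ such that $\forall F_1\in\mathcal{F}_1\,\exists F_2\in\mathcal{F}_2\,\forall K_1\in[\Omega_1]^{<\omega}\,\exists K_2\in[\Omega_2]^{<\omega}\ \rho_2(F_2\setminus K_2)\subseteq\phi[\rho_1(F_1\setminus K_1)]$. (For $\mathrm{FS}$ and $\Delta$: $\Omega=\Lambda=\omega$; for $r$: $\Omega=\omega$, $\Lambda=[\omega]^2$; for $\rho_{\mathcal{I}}$: $\Omega=\Lambda$.) A topological space $X$ is a Hindman space (respectively Ramsey space, differentially compact space) if, with $\rho=\mathrm{FS}$, $\Lambda=\omega$ (respectively $\rho=r$, $\Lambda=[\omega]^2$; $\rho=\Delta$, $\Lambda=\omega$), for every $f:\Lambda\to X$ there are an infinite $D\subseteq\omega$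 and $x\in X$ such that for every neighbourhood $U$ of $x$ there is a finite $K\subseteq\omega$ with $f[\rho(D\setminus K)]\subseteq U$. For an ideal $\mathcal{I}$ on $\Lambda$, $\mathrm{FinBW}(\mathcal{I})$ is the class of all topological spaces $X$ such that for every $f:\Lambda\to X$ there is $A\in\mathcal{I}^+$ such that $f\restriction A$ converges (to some $x\in X$: every neighbourhood of $x$ contains $f(a)$ for all but finitely many $a\in A$). An almost disjoint family on a countably infinite set $\Lambda$ is a family $\mathcal{A}$ of infinite subsets of $\Lambda$ with $A\cap B$ finite for distinct $A,B\in\mathcal{A}$. For an infinite almost disjoint family $\mathcal{A}$ on $\Lambda$, $\Psi(\mathcal{A})=\Lambda\cup\mathcal{A}$ is the space in which points of $\Lambda$ are isolated and basic neighbourhoods of $A\in\mathcal{A}$ are $\{A\}\cup(A\setminus F)$ with $F$ finite; $\Phi(\mathcal{A})=\Psi(\mathcal{A})\cup\{\infty\}$ is the Alexandroff one-point compactification of $\Psi(\mathcal{A})$. *)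

theory Defs
  imports "HOL-Analysis.Analysis" "HOL-Library.Ramsey" "HOL-Library.Equipollence"
begin

definition Continuum_Hypothesis :: bool where
  "Continuum_Hypothesis \<longleftrightarrow>
     (\<forall>S :: real set. uncountable S \<longrightarrow> S \<approx> (UNIV :: real set))"


definition ideal_on :: "'l set \<Rightarrow> 'l set set \<Rightarrow> bool" where
  "ideal_on \<Lambda> \<I> \<longleftrightarrow>
     countable \<Lambda> \<and> infinite \<Lambda> \<and>
     \<I> \<noteq> {} \<and> \<I> \<subseteq> Pow \<Lambda> \<and>
     (\<forall>A\<in>\<I>. \<forall>B. B \<subseteq> A \<longrightarrow> B \<in> \<I>) \<and>
     (\<forall>A\<in>\<I>. \<forall>B\<in>\<I>. A \<union> B \<in> \<I>) \<and>
     (\<forall>F. F \<subseteq> \<Lambda> \<and> finite F \<longrightarrow> F \<in> \<I>) \<and>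
     \<Lambda> \<notin> \<I>"

definition positive_sets :: "'l set \<Rightarrow> 'l set set \<Rightarrow> 'l set set" where
  "positive_sets \<Lambda> \<I> = Pow \<Lambda> - \<I>"

definition P_minus :: "'l set \<Rightarrow> 'l set set \<Rightarrow> bool" where
  "P_minus \<Lambda> \<I> \<longleftrightarrow>
     (\<forall>A :: nat \<Rightarrow> 'l set.
        (\<forall>n. A n \<in> positive_sets \<Lambda> \<I>) \<and>
        (\<forall>n. A (Suc n) \<subseteq> A n) \<and>
        (\<forall>n. A n - A (Suc n) \<in> \<I>) \<longrightarrow>
        (\<exists>B\<in>positive_sets \<Lambda> \<I>. \<forall>n. finite (B - A n)))"


text \<open>
  A function \<open>\<rho> : \<F> \<rightarrow> [\<Lambda>]\<^sup>\<omega>\<close> with \<open>\<F> \<subseteq> [\<Omega>]\<^sup>\<omega>\<close>, given by its ground set \<open>\<Omega>\<close>, its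
  target set \<open>\<Lambda>\<close>, its domain \<open>\<F>\<close> and its values; the values outside \<open>\<F>\<close> play no role.
\<close>

record ('o, 'l) set_fun =
  ground :: "'o set"
  target :: "'l set"
  family :: "'o set set"
  val :: "'o set \<Rightarrow> 'l set"

definition FS :: "(nat, nat) set_fun" where
  "FS = \<lparr>ground = UNIV, target = UNIV, family = {D. infinite D},
         val = (\<lambda>D. {(\<Sum>a\<in>S. a) | S. S \<subseteq> D \<and> finite S \<and> S \<noteq> {}})\<rparr>"

definition pairs_fun :: "(nat, nat set) set_fun" where
  "pairs_fun = \<lparr>ground = UNIV, target = nsets UNIV 2, family = {D. infinite D},
                val = (\<lambda>D. nsets D 2)\<rparr>"

definition Diff_fun :: "(nat, nat) set_fun" where
  "Diff_fun = \<lparr>ground = UNIV, target = UNIV, family = {D. infinite D},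
               val = (\<lambda>D. {a - b | a b. a \<in> D \<and> b \<in> D \<and> a > b})\<rparr>"

definition rho_ideal :: "'l set \<Rightarrow> 'l set set \<Rightarrow> ('l, 'l) set_fun" where
  "rho_ideal \<Lambda> \<I> = \<lparr>ground = \<Lambda>, target = \<Lambda>, family = positive_sets \<Lambda> \<I>, val = (\<lambda>A. A)\<rparr>"

definition katetov_le :: "('o2, 'l2) set_fun \<Rightarrow> ('o1, 'l1) set_fun \<Rightarrow> bool"
    (infix \<open>\<le>\<^sub>K\<close> 50) where
  "\<rho>2 \<le>\<^sub>K \<rho>1 \<longleftrightarrow>
     (\<exists>\<phi>. \<phi> \<in> target \<rho>1 \<rightarrow> target \<rho>2 \<and>
       (\<forall>F1\<in>family \<rho>1. \<exists>F2\<in>family \<rho>2.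
          \<forall>K1. K1 \<subseteq> ground \<rho>1 \<and> finite K1 \<longrightarrow>
            (\<exists>K2. K2 \<subseteq> ground \<rho>2 \<and> finite K2 \<and>
               val \<rho>2 (F2 - K2) \<subseteq> \<phi> ` val \<rho>1 (F1 - K1))))"


definition rho_space :: "(nat, 'l) set_fun \<Rightarrow> 'x topology \<Rightarrow> bool" where
  "rho_space \<rho> X \<longleftrightarrow>
     (\<forall>f. f \<in> target \<rho> \<rightarrow> topspace X \<longrightarrow>
       (\<exists>D x. infinite D \<and> x \<in> topspace X \<and>
          (\<forall>U. openin X U \<and> x \<in> U \<longrightarrow>
             (\<exists>K. finite K \<and> f ` val \<rho> (D - K) \<subseteq> U))))"

definition Hindman_space :: "'x topology \<Rightarrow> bool" where
  "Hindman_space X \<longleftrightarrow> rho_space FS X"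

definition Ramsey_space :: "'x topology \<Rightarrow> bool" where
  "Ramsey_space X \<longleftrightarrow> rho_space pairs_fun X"

definition differentially_compact_space :: "'x topology \<Rightarrow> bool" where
  "differentially_compact_space X \<longleftrightarrow> rho_space Diff_fun X"

definition FinBW :: "'l set \<Rightarrow> 'l set set \<Rightarrow> 'x topology set" where
  "FinBW \<Lambda> \<I> =
     {X. \<forall>f. f \<in> \<Lambda> \<rightarrow> topspace X \<longrightarrow>
        (\<exists>A\<in>positive_sets \<Lambda> \<I>. \<exists>x\<in>topspace X.
           \<forall>U. openin X U \<and> x \<in> U \<longrightarrow> finite {a\<in>A. f a \<notin> U})}"

definition unique_sequential_limits :: "'x topology \<Rightarrow> bool" where
  "unique_sequential_limits X \<longleftrightarrow>
     (\<forall>\<sigma> x y. range \<sigma> \<subseteq> topspace X \<and>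
        limitin X \<sigma> x sequentially \<and> limitin X \<sigma> y sequentially \<longrightarrow> x = y)"


definition almost_disjoint_family :: "'l set \<Rightarrow> 'l set set \<Rightarrow> bool" where
  "almost_disjoint_family \<Lambda> \<A> \<longleftrightarrow>
     (\<forall>A\<in>\<A>. A \<subseteq> \<Lambda> \<and> infinite A) \<and>
     (\<forall>A\<in>\<A>. \<forall>B\<in>\<A>. A \<noteq> B \<longrightarrow> finite (A \<inter> B))"

text \<open>The points of \<open>\<Lambda>\<close> are tagged by \<open>Inl\<close>, the members of \<open>\<A>\<close> by \<open>Inr\<close>.\<close>

definition Psi_space :: "'l set \<Rightarrow> 'l set set \<Rightarrow> ('l + 'l set) topology" where
  "Psi_space \<Lambda> \<A> = topology_generated_by
     ({{Inl n} | n. n \<in> \<Lambda>} \<union> {insert (Inr A) (Inl ` (A - F)) | A F. A \<in> \<A> \<and> finite F})"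

definition Phi_space :: "'l set \<Rightarrow> 'l set set \<Rightarrow> ('l + 'l set) option topology" where
  "Phi_space \<Lambda> \<A> = Alexandroff_compactification (Psi_space \<Lambda> \<A>)"

end

theory Submission
  imports Defs
begin

text \<open>
  If \<open>\<rho>\<^sub>\<I> \<le>\<^sub>K \<rho>\<close> via \<open>\<phi>\<close>, composing with \<open>\<phi>\<close> turns any \<open>f : \<Lambda> \<rightarrow> X\<close> into a function on the target of \<open>\<rho>\<close>,
  so every \<open>\<rho>\<close>-space is in \<open>FinBW(\<I>)\<close>.

  Conversely, suppose \<open>\<rho>\<^sub>\<I> \<le>\<^sub>K \<rho>\<close> fails. Each of the three functions is partition regular (by the theorems of
  Hindman and Ramsey) and \<open>\<sigma>\<close>-closed under a suitable refinement order. Call a decreasing sequence \<open>V\<close>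
  of subsets of \<open>\<Lambda>\<close> with empty intersection \<^emph>\<open>null\<close> if no \<open>\<I>\<close>-positive set is almost contained in all
  \<open>V n\<close>. The failure of \<open>\<le>\<^sub>K\<close> says that every \<open>f\<close> into \<open>\<Lambda>\<close> has a \<open>D\<close> for which the sequence
  \<open>f[\<rho>(D - n)]\<close> has this last property, and it also implies that every infinite set contains an infinite
  member of \<open>\<I>\<close>. Using CH, a recursion of length \<open>\<omega>\<^sub>1\<close> produces a family \<open>\<V>\<close> of pairwise separated null
  sequences such that every \<open>f\<close> into \<open>\<Lambda>\<close> is constant on some \<open>\<rho>(D)\<close> or converges along \<open>\<rho>\<close> to some
  \<open>V \<in> \<V>\<close>, and every infinite subset of \<open>\<Lambda>\<close> has an infinite subset converging to some \<open>V \<in> \<V>\<close>. The points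
  of the example are \<open>\<Lambda>\<close>, the sequences in \<open>\<V>\<close> (with neighbourhoods \<open>V n\<close>) and one point at infinity, to
  which every sufficiently injective \<open>f\<close> into \<open>\<V>\<close> converges. Since the sequences are null, the inclusion
  of \<open>\<Lambda>\<close> does not converge on any \<open>\<I>\<close>-positive set.

  If \<open>\<I>\<close> is \<open>P\<^sup>-\<close>, a positive set stays positive after removing a suitable term of any null sequence, so the
  recursion can make every positive set meet infinitely some \<open>A \<in> \<I>\<close> whose tails form a member of \<open>\<V>\<close>. These
  \<open>A\<close> form the family \<open>\<A>\<close>; functions converging to any other member of \<open>\<V>\<close> converge to infinity in
  \<open>\<Phi>(\<A>)\<close>.
\<close>

section \<open>Hindman's theorem\<close>

definition FIN :: "nat set set" where
  "FIN = {S. finite S \<and> S \<noteq> {}}"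

definition blocks :: "(nat \<Rightarrow> nat set) \<Rightarrow> bool" where
  "blocks b \<longleftrightarrow> (\<forall>n. b n \<in> FIN) \<and> (\<forall>n. \<forall>i\<in>b n. \<forall>j\<in>b (Suc n). i < j)"

lemma blocksI:
  "(\<And>n. b n \<in> FIN) \<Longrightarrow> (\<And>n i j. i \<in> b n \<Longrightarrow> j \<in> b (Suc n) \<Longrightarrow> i < j) \<Longrightarrow> blocks b"
  by (auto simp: blocks_def)

lemma blocks_FIN: "blocks b \<Longrightarrow> b n \<in> FIN"
  by (auto simp: blocks_def)

lemma blocks_less:
  assumes "blocks b" "m < n" "i \<in> b m" "j \<in> b n"
  shows "i < j"
  using assms(2,4)
proof (induction n arbitrary: j)
  case (Suc n)
  show ?case
  proof (cases "m = n")
    case True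
    then show ?thesis using assms Suc by (auto simp: blocks_def)
  next
    case False
    obtain k where k: "k \<in> b n" using blocks_FIN[OF assms(1), of n] by (auto simp: FIN_def)
    then have "i < k" using Suc False by auto
    also have "k < j" using assms(1) k Suc by (auto simp: blocks_def)
    finally show ?thesis .
  qed
qed simp

lemma blocks_ge:
  assumes "blocks b" "i \<in> b n"
  shows "n \<le> i"
  using assms(2)
proof (induction n arbitrary: i)
  case (Suc n)
  obtain k where k: "k \<in> b n" using blocks_FIN[OF assms(1), of n] by (auto simp: FIN_def)
  then have "n \<le> k" "k < i" using Suc assms(1) by (auto simp: blocks_def)
  then show ?case by simp
qed simp

lemma blocks_index_less:
  assumes "blocks b" "x \<in> b i" "y \<in> b j" "x < y"
  shows "i \<le> j"
  using blocks_less[OF assms(1), of j i y x] assms by force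

lemma blocks_UN_FIN: "blocks b \<Longrightarrow> S \<in> FIN \<Longrightarrow> (\<Union>i\<in>S. b i) \<in> FIN"
  by (auto simp: FIN_def blocks_def)

lemma blocks_comp:
  assumes "blocks b" "blocks c"
  shows "blocks (\<lambda>n. \<Union>i\<in>c n. b i)"
proof (rule blocksI)
  show "(\<Union>i\<in>c n. b i) \<in> FIN" for n
    using assms blocks_FIN blocks_UN_FIN by blast
  show "x < y" if "x \<in> (\<Union>i\<in>c n. b i)" "y \<in> (\<Union>i\<in>c (Suc n). b i)" for n x y
  proof -
    obtain i j where ij: "i \<in> c n" "x \<in> b i" "j \<in> c (Suc n)" "y \<in> b j" using \<open>x \<in> _\<close> \<open>y \<in> _\<close> by blast
    then have "i < j" using assms(2) by (auto simp: blocks_def)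
    then show ?thesis using blocks_less[OF assms(1)] ij by blast
  qed
qed

lemma blocks_shift: "blocks (\<lambda>n. {N + n})"
  by (auto simp: blocks_def FIN_def)

lemma blocks_id: "blocks (\<lambda>n. {n})"
  by (auto simp: blocks_def FIN_def)

section \<open>Largeness and the finite unions theorem\<close>

text \<open>Largeness is the notion of Baumgartner's proof of Hindman's theorem.\<close>

definition large :: "nat set set \<Rightarrow> bool" where
  "large X \<longleftrightarrow> (\<forall>c. blocks c \<longrightarrow> (\<exists>S\<in>FIN. (\<Union>i\<in>S. c i) \<in> X))"

lemma largeD: "large X \<Longrightarrow> blocks c \<Longrightarrow> \<exists>S\<in>FIN. (\<Union>i\<in>S. c i) \<in> X"
  by (auto simp: large_def)

lemma large_mono:
  assumes "large X" "\<And>S. S \<in> FIN \<Longrightarrow> S \<in> X \<Longrightarrow> S \<in> Y"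
  shows "large Y"
  unfolding large_def
proof (intro allI impI)
  fix c assume c: "blocks c"
  then obtain S where "S \<in> FIN" "(\<Union>i\<in>S. c i) \<in> X" using assms(1) largeD by blast
  then show "\<exists>S\<in>FIN. (\<Union>i\<in>S. c i) \<in> Y" using assms(2) blocks_UN_FIN[OF c] by blast
qed

text \<open>A block sequence \<open>c\<close> taken in the coordinates of \<open>b\<close> is again
  a block sequence of natural numbers, namely the composition, and largeness of \<open>X\<close>
  applies to it.\<close>

lemma large_pullback:
  assumes "large X" "blocks b"
  shows "large {S. (\<Union>i\<in>S. b i) \<in> X}"
  unfolding large_def
proof (intro allI impI)
  fix c assume c: "blocks c"
  obtain S where "S \<in> FIN" "(\<Union>n\<in>S. \<Union>i\<in>c n. b i) \<in> X"
    using largeD[OF assms(1) blocks_comp[OF assms(2) c]] by blast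
  then show "\<exists>S\<in>FIN. (\<Union>i\<in>S. c i) \<in> {S. (\<Union>i\<in>S. b i) \<in> X}"
    by (auto intro!: bexI[of _ S])
qed

text \<open>If \<open>X\<close> is not large, some block sequence \<open>c\<close> has no union of
  its blocks in \<open>X\<close>. In the coordinates of \<open>c\<close> the family \<open>X\<close>
  disappears, so the pullback of \<open>X \<union> Y\<close> is large on account of \<open>Y\<close>
  alone.\<close>

lemma large_Un:
  assumes "large (X \<union> Y)" "\<not> large X"
  shows "\<exists>c. blocks c \<and> large {S. (\<Union>i\<in>S. c i) \<in> Y}"
proof -
  obtain c where c: "blocks c" "\<And>S. S \<in> FIN \<Longrightarrow> (\<Union>i\<in>S. c i) \<notin> X"
    using assms(2) by (auto simp: large_def)
  have "large {S. (\<Union>i\<in>S. c i) \<in> Y}"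
    by (rule large_mono[OF large_pullback[OF assms(1) c(1)]]) (use c(2) in auto)
  with c show ?thesis by blast
qed

text \<open>Each application of \<open>large_Un\<close> discards one non-large \<open>X t\<close> at
  the price of a coarser block sequence; the block sequences met on the way are composed.\<close>

lemma large_UN:
  assumes "finite T" "large (\<Union>t\<in>T. X t)"
  shows "\<exists>t\<in>T. \<exists>c. blocks c \<and> large {S. (\<Union>i\<in>S. c i) \<in> X t}"
  using assms
proof (induction T arbitrary: X rule: finite_induct)
  case empty
  then show ?case using largeD[OF _ blocks_id] by auto
next
  case (insert t T)
  show ?case
  proof (cases "large (X t)")
    case True
    then show ?thesis using large_pullback[OF True blocks_id] blocks_id by blast
  next
    case False
    have "large (X t \<union> (\<Union>t\<in>T. X t))" using insert.prems by simp
    from large_Un[OF this False] obtain c where c: "blocks c"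
      and "large {S. (\<Union>i\<in>S. c i) \<in> (\<Union>t\<in>T. X t)}" by blast
    then have "large (\<Union>t\<in>T. {S. (\<Union>i\<in>S. c i) \<in> X t})" by (rule_tac large_mono) auto
    from insert.IH[OF this] obtain s d where s: "s \<in> T" "blocks d"
      "large {S. (\<Union>i\<in>S. d i) \<in> {S. (\<Union>i\<in>S. c i) \<in> X s}}" by blast
    then have "large {S. (\<Union>n\<in>S. \<Union>i\<in>d n. c i) \<in> X s}" by simp
    then show ?thesis using blocks_comp[OF c s(2)] s(1) by blast
  qed
qed

text \<open>Greedy choice: each new set is sought beyond the maximum of the previous one.
  \<open>N k\<close> is the threshold at which \<open>s k\<close> was chosen, so \<open>P\<close>
  may refer to it.\<close>

lemma successive_choice:
  assumes "\<And>N. \<exists>S\<in>FIN. S \<subseteq> {N..} \<and> P N S"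
  obtains N s where "\<And>k::nat. s k \<in> FIN" "\<And>k. s k \<subseteq> {N k..<N (Suc k)}" "\<And>k. P (N k) (s k)"
    "mono N"
proof -
  obtain S where S: "\<And>N. S N \<in> FIN" "\<And>N. S N \<subseteq> {N..}" "\<And>N. P N (S N)" using assms by metis
  define N where "N = rec_nat 0 (\<lambda>_ n. Suc (Max (S n)))"
  have N: "N (Suc k) = Suc (Max (S (N k)))" for k by (simp add: N_def)
  have sub: "S (N k) \<subseteq> {N k..<N (Suc k)}" for k
    using S(1,2)[of "N k"] by (auto simp: N less_Suc_eq_le FIN_def)
  have "N k \<le> N (Suc k)" for k
    using S(1)[of "N k"] sub[of k] by (force simp: FIN_def)
  then have "mono N" by (simp add: mono_iff_le_Suc)
  then show ?thesis using that[of "\<lambda>k. S (N k)" N] S sub by blast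
qed

lemma successive_blocks:
  assumes "\<And>k. s k \<in> FIN" "\<And>k. s k \<subseteq> {N k..<N (Suc k)}"
  shows "blocks s"
proof (rule blocksI)
  show "s n \<in> FIN" for n by (rule assms)
  show "i < j" if "i \<in> s n" "j \<in> s (Suc n)" for n i j
    using subsetD[OF assms(2) that(1)] subsetD[OF assms(2) that(2)] by simp
qed

text \<open>Otherwise one could choose successive blocks all of whose unions of at least two avoid \<open>X\<close>.\<close>

lemma large_finite_cover:
  assumes "large X"
  shows "\<exists>N. \<forall>S\<in>FIN. S \<subseteq> {N..} \<longrightarrow> (\<exists>t\<in>FIN. t \<subseteq> {..<N} \<and> t \<union> S \<in> X)"
proof (rule ccontr)
  assume "\<not> ?thesis"
  then have "\<exists>S\<in>FIN. S \<subseteq> {N..} \<and> (\<forall>t\<in>FIN. t \<subseteq> {..<N} \<longrightarrow> t \<union> S \<notin> X)" for N by simp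
  then obtain N s where s: "\<And>k::nat. s k \<in> FIN" "\<And>k. s k \<subseteq> {N k..<N (Suc k)}"
    and P: "\<And>k. \<forall>t\<in>FIN. t \<subseteq> {..<N k} \<longrightarrow> t \<union> s k \<notin> X" and mono: "mono N"
    by (rule successive_choice) blast
  have bs: "blocks s" by (rule successive_blocks[where N = N, OF s])
  define c where "c k = s (2 * k) \<union> s (2 * k + 1)" for k
  have bc: "blocks c"
  proof (rule blocksI)
    show "c n \<in> FIN" for n using s(1) by (auto simp: c_def FIN_def)
    show "i < j" if ij: "i \<in> c n" "j \<in> c (Suc n)" for n i j
    proof -
      obtain k l where "i \<in> s k" "k \<le> 2 * n + 1" "j \<in> s l" "2 * n + 2 \<le> l"
        using ij by (fastforce simp: c_def)
      then show ?thesis using blocks_less[OF bs, of k l i j] by simp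
    qed
  qed
  obtain S where S: "S \<in> FIN" "(\<Union>i\<in>S. c i) \<in> X" using largeD[OF assms bc] by blast
  define m where "m = Max S"
  have m: "m \<in> S" "\<And>i. i \<in> S \<Longrightarrow> i \<le> m" using S(1) by (auto simp: m_def FIN_def)
  define t where "t = (\<Union>i\<in>S-{m}. c i) \<union> s (2 * m)"
  have "t \<in> FIN" using S(1) s(1) bc by (auto simp: t_def FIN_def blocks_def)
  moreover have "t \<subseteq> {..<N (2 * m + 1)}"
  proof
    fix x assume "x \<in> t"
    then obtain k where k: "x \<in> s k" "k \<le> 2 * m"
    proof -
      have "\<exists>k. x \<in> s k \<and> k \<le> 2 * m"
      proof (cases "x \<in> s (2 * m)")
        case False
        then obtain i where i: "i \<in> S" "i \<noteq> m" "x \<in> c i" using \<open>x \<in> t\<close> by (auto simp: t_def)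
        then have "i < m" using m(2) by force
        then have "2 * i \<le> 2 * m" "2 * i + 1 \<le> 2 * m" by simp_all
        then show ?thesis using i(3) unfolding c_def by blast
      qed blast
      with that show ?thesis by blast
    qed
    then have "x < N (Suc k)" using s(2) by force
    also have "\<dots> \<le> N (2 * m + 1)" using k(2) mono by (simp add: mono_def)
    finally show "x \<in> {..<N (2 * m + 1)}" by simp
  qed
  ultimately have "t \<union> s (2 * m + 1) \<notin> X" using P by blast
  moreover have "t \<union> s (2 * m + 1) = (\<Union>i\<in>S. c i)"
    using m(1) by (auto simp: t_def c_def)
  ultimately show False using S(2) by simp
qed

text \<open>Every finite set beyond \<open>N\<close> is joined into \<open>X\<close> by one of the
  finitely many nonempty \<open>t\<close> below \<open>N\<close>. By \<open>large_UN\<close> the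
  sets served by one single \<open>t\<close> remain large along a coarser block sequence; this
  \<open>t\<close> becomes \<open>d\<close>. Starting the blocks at \<open>N\<close> puts them all
  beyond \<open>d\<close>.\<close>

lemma large_step:
  assumes "large X"
  shows "\<exists>d c. d \<in> FIN \<and> blocks c \<and> (\<forall>i\<in>d. \<forall>n. \<forall>j\<in>c n. i < j) \<and>
           large {S. (\<Union>i\<in>S. c i) \<in> X \<and> d \<union> (\<Union>i\<in>S. c i) \<in> X}"
proof -
  obtain N where N: "\<And>S. S \<in> FIN \<Longrightarrow> S \<subseteq> {N..} \<Longrightarrow> \<exists>t\<in>FIN. t \<subseteq> {..<N} \<and> t \<union> S \<in> X"
    using large_finite_cover[OF assms] by blast
  define T where "T = {t\<in>FIN. t \<subseteq> {..<N}}"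
  have "finite T" unfolding T_def by (rule finite_subset[of _ "Pow {..<N}"]) auto
  define b where "b n = {N + n}" for n
  have b: "blocks b" unfolding b_def by (rule blocks_shift)
  have "large (\<Union>t\<in>T. {S. (\<Union>i\<in>S. b i) \<in> X \<and> t \<union> (\<Union>i\<in>S. b i) \<in> X})"
  proof (rule large_mono[OF large_pullback[OF assms b]])
    fix S assume S: "S \<in> FIN" "S \<in> {S. (\<Union>i\<in>S. b i) \<in> X}"
    have "\<exists>t\<in>FIN. t \<subseteq> {..<N} \<and> t \<union> (\<Union>i\<in>S. b i) \<in> X"
      by (rule N) (use blocks_UN_FIN[OF b S(1)] in \<open>auto simp: b_def\<close>)
    with S show "S \<in> (\<Union>t\<in>T. {S. (\<Union>i\<in>S. b i) \<in> X \<and> t \<union> (\<Union>i\<in>S. b i) \<in> X})"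
      by (auto simp: T_def)
  qed
  from large_UN[OF \<open>finite T\<close> this] obtain t c where t: "t \<in> T" "blocks c"
    and l: "large {S. (\<Union>i\<in>S. c i) \<in> {S. (\<Union>i\<in>S. b i) \<in> X \<and> t \<union> (\<Union>i\<in>S. b i) \<in> X}}" by blast
  let ?c = "\<lambda>n. \<Union>i\<in>c n. b i"
  have "large {S. (\<Union>i\<in>S. ?c i) \<in> X \<and> t \<union> (\<Union>i\<in>S. ?c i) \<in> X}" using l by simp
  moreover have "\<forall>i\<in>t. \<forall>n. \<forall>j\<in>?c n. i < j" using t(1) by (auto simp: T_def b_def)
  moreover have "t \<in> FIN" using t(1) by (simp add: T_def)
  ultimately show ?thesis using blocks_comp[OF b t(2)] by blast
qed

text \<open>Iterating \<open>large_step\<close> yields sets \<open>g n\<close> and shrinking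
  families \<open>Y n\<close> inside \<open>X\<close> such that members of \<open>Y (Suc n)\<close>
  can be joined with \<open>g n\<close> without leaving \<open>Y n\<close>. Hence a member of
  \<open>Y n\<close> absorbs every union of sets \<open>g i\<close> with \<open>i < n\<close>. Late
  finite unions of the \<open>g i\<close> that fall into \<open>Y n\<close> are picked successively
  as the homogeneous blocks.\<close>

lemma large_imp_homogeneous:
  assumes "large X"
  shows "\<exists>c. blocks c \<and> (\<forall>S\<in>FIN. (\<Union>i\<in>S. c i) \<in> X)"
proof -
  \<comment> \<open>A state of the iteration is a block sequence \<open>b\<close> with a family
    \<open>Y\<close> that is large when read in the coordinates of \<open>b\<close>. The sets
    \<open>d\<close> and \<open>c\<close> in \<open>R\<close> are given in these coordinates
    too.\<close>
  define lg where "lg b Y \<longleftrightarrow> blocks b \<and> large {S. (\<Union>i\<in>S. b i) \<in> Y}" for b Y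
  define R where "R d c b Y b' Y' \<longleftrightarrow> d \<in> FIN \<and> blocks c \<and> (\<forall>i\<in>d. \<forall>n. \<forall>j\<in>c n. i < j) \<and>
      b' = (\<lambda>n. \<Union>i\<in>c n. b i) \<and> Y' = {s\<in>Y. (\<Union>i\<in>d. b i) \<union> s \<in> Y}"
    for d c and b b' :: "nat \<Rightarrow> nat set" and Y Y'
  have step: "\<exists>b' Y'. lg b' Y' \<and> (\<exists>d c. R d c b Y b' Y')" if "lg b Y" for b Y
  proof -
    have b: "blocks b" "large {S. (\<Union>i\<in>S. b i) \<in> Y}" using that by (auto simp: lg_def)
    from large_step[OF this(2)] obtain d c where d: "d \<in> FIN" "blocks c" "\<forall>i\<in>d. \<forall>n. \<forall>j\<in>c n. i < j"
      and l: "large {S. (\<Union>i\<in>S. c i) \<in> {S. (\<Union>i\<in>S. b i) \<in> Y} \<and> d \<union> (\<Union>i\<in>S. c i) \<in> {S. (\<Union>i\<in>S. b i) \<in> Y}}"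
      by blast
    have "lg (\<lambda>n. \<Union>i\<in>c n. b i) {s\<in>Y. (\<Union>i\<in>d. b i) \<union> s \<in> Y}"
      unfolding lg_def using l blocks_comp[OF b(1) d(2)] by (simp add: UN_Un)
    then show ?thesis unfolding R_def using d by blast
  qed
  have "\<exists>f. \<forall>n. lg (fst (f n)) (snd (f n)) \<and> (n = 0 \<longrightarrow> f n = (\<lambda>n. {n}, X)) \<and>
        (\<exists>d c. R d c (fst (f n)) (snd (f n)) (fst (f (Suc n))) (snd (f (Suc n))))"
  proof -
    have "\<exists>f. \<forall>n. (lg (fst (f n)) (snd (f n)) \<and> (n = 0 \<longrightarrow> f n = (\<lambda>n. {n}, X))) \<and>
        (\<exists>d c. R d c (fst (f n)) (snd (f n)) (fst (f (Suc n))) (snd (f (Suc n))))"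
    proof (rule dependent_nat_choice)
      show "\<exists>x. lg (fst x) (snd x) \<and> ((0::nat) = 0 \<longrightarrow> x = (\<lambda>n. {n}, X))"
        using assms blocks_id by (auto simp: lg_def)
      show "\<exists>y. (lg (fst y) (snd y) \<and> (Suc n = 0 \<longrightarrow> y = (\<lambda>n. {n}, X))) \<and>
               (\<exists>d c. R d c (fst x) (snd x) (fst y) (snd y))"
        if "lg (fst x) (snd x) \<and> (n = 0 \<longrightarrow> x = (\<lambda>n. {n}, X))" for x and n :: nat
        using step that by fastforce
    qed
    then show ?thesis by blast
  qed
  then obtain f where f: "\<And>n. lg (fst (f n)) (snd (f n))" "f 0 = (\<lambda>n. {n}, X)"
    "\<And>n. \<exists>d c. R d c (fst (f n)) (snd (f n)) (fst (f (Suc n))) (snd (f (Suc n)))" by blast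
  define b where "b n = fst (f n)" for n
  define Y where "Y n = snd (f n)" for n
  obtain d c where R: "\<And>n. R (d n) (c n) (b n) (Y n) (b (Suc n)) (Y (Suc n))"
    using f(3) unfolding b_def Y_def by metis
  have bb: "blocks (b n)" and lY: "large {S. (\<Union>i\<in>S. b n i) \<in> Y n}" for n
    using f(1)[of n] by (auto simp: lg_def b_def Y_def)
  have Y0: "Y 0 = X" by (simp add: Y_def f(2))
  have dF: "d n \<in> FIN" and cb: "blocks (c n)" and dc: "i \<in> d n \<Longrightarrow> j \<in> c n k \<Longrightarrow> i < j"
    and bS: "b (Suc n) = (\<lambda>k. \<Union>i\<in>c n k. b n i)"
    and YS: "Y (Suc n) = {s\<in>Y n. (\<Union>i\<in>d n. b n i) \<union> s \<in> Y n}" for n i j k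
    using R[of n] unfolding R_def by blast+
  define g where "g n = (\<Union>i\<in>d n. b n i)" for n
  have gb: "blocks g"
  proof (rule blocksI)
    show "g n \<in> FIN" for n unfolding g_def by (rule blocks_UN_FIN[OF bb dF])
    show "x < y" if xy: "x \<in> g n" "y \<in> g (Suc n)" for n x y
    proof -
      obtain i where i: "i \<in> d n" "x \<in> b n i" using xy(1) by (auto simp: g_def)
      obtain k j where k: "k \<in> d (Suc n)" "j \<in> c n k" "y \<in> b n j" using xy(2) by (auto simp: g_def bS)
      have "i < j" using dc i k by blast
      then show ?thesis using blocks_less[OF bb] i k by blast
    qed
  qed
  \<comment> \<open>Each later \<open>b (n + k)\<close> consists of unions of blocks of
    \<open>b n\<close>, and so does \<open>g (n + k)\<close>. Largeness of \<open>Y n\<close> in the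
    coordinates of \<open>b n\<close> thus applies to the tail of \<open>g\<close>.\<close>
  have refine: "\<exists>h. blocks h \<and> b (n + k) = (\<lambda>m. \<Union>i\<in>h m. b n i)" for n k
  proof (induction k)
    case 0
    then show ?case using blocks_id by (intro exI[of _ "\<lambda>n. {n}"]) auto
  next
    case (Suc k)
    then obtain h where h: "blocks h" "b (n + k) = (\<lambda>m. \<Union>i\<in>h m. b n i)" by blast
    show ?case
      by (rule exI[of _ "\<lambda>m. \<Union>i\<in>c (n + k) m. h i"]) (use blocks_comp[OF h(1) cb] bS h(2) in auto)
  qed
  have tail: "\<exists>S\<in>FIN. S \<subseteq> {n..} \<and> (\<Union>i\<in>S. g i) \<in> Y n" for n
  proof -
    have "\<exists>e\<in>FIN. g (n + k) = (\<Union>i\<in>e. b n i)" for k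
    proof -
      obtain h where h: "blocks h" "b (n + k) = (\<lambda>m. \<Union>i\<in>h m. b n i)" using refine by blast
      show ?thesis
        by (rule bexI[of _ "\<Union>i\<in>d (n + k). h i"]) (use blocks_UN_FIN[OF h(1) dF] h(2) in \<open>auto simp: g_def\<close>)
    qed
    then obtain e where e: "\<And>k. e k \<in> FIN" "\<And>k. g (n + k) = (\<Union>i\<in>e k. b n i)" by metis
    \<comment> \<open>The order of the index sets is read off from \<open>g\<close>: a common index
      of \<open>e k\<close> and \<open>e (Suc k)\<close> would put a point into two different blocks
      of \<open>g\<close>.\<close>
    have "blocks e"
    proof (rule blocksI)
      show "e k \<in> FIN" for k by (rule e)
      show "i < j" if "i \<in> e k" "j \<in> e (Suc k)" for k i j
      proof -
        obtain x y where xy: "x \<in> b n i" "y \<in> b n j" using blocks_FIN[OF bb] by (fastforce simp: FIN_def)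
        then have "x \<in> g (n + k)" "y \<in> g (n + Suc k)" using e(2)[of k] e(2)[of "Suc k"] that by blast+
        then have "x < y" using blocks_less[OF gb, of "n + k" "n + Suc k"] by simp
        then have "i \<le> j" using blocks_index_less[OF bb] xy by blast
        moreover have "i \<noteq> j"
        proof
          assume "i = j"
          then have "x \<in> g (n + Suc k)" using e(2)[of "Suc k"] that(2) xy(1) by blast
          then show False using blocks_less[OF gb, of "n + k" "n + Suc k" x x] \<open>x \<in> g (n + k)\<close> by simp
        qed
        ultimately show ?thesis by simp
      qed
    qed
    from largeD[OF lY this, of n] obtain S where S: "S \<in> FIN" "(\<Union>k\<in>S. \<Union>i\<in>e k. b n i) \<in> Y n"
      by auto
    then have "(\<Union>k\<in>S. g (n + k)) \<in> Y n" using e(2) by simp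
    then show ?thesis using S(1) by (intro bexI[of _ "(+) n ` S"]) (auto simp: FIN_def)
  qed
  obtain N s where s: "\<And>k::nat. s k \<in> FIN" "\<And>k. s k \<subseteq> {N k..<N (Suc k)}"
    and sY: "\<And>k. (\<Union>i\<in>s k. g i) \<in> Y (N k)" and mono: "mono N"
    by (rule successive_choice[OF tail]) blast
  have absorb: "(\<Union>i\<in>A. g i) \<union> t \<in> X" if "A \<subseteq> {..<n}" "t \<in> Y n" for A t n
    using that
  proof (induction n arbitrary: A t)
    case 0
    then show ?case by (simp add: Y0)
  next
    case (Suc n)
    have "t \<in> Y n" "g n \<union> t \<in> Y n" using Suc.prems(2) YS[of n] by (auto simp: g_def)
    moreover have "A - {n} \<subseteq> {..<n}" using Suc.prems(1) by (auto simp: less_Suc_eq)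
    ultimately have "(\<Union>i\<in>A-{n}. g i) \<union> t \<in> X" "(\<Union>i\<in>A-{n}. g i) \<union> (g n \<union> t) \<in> X" using Suc.IH by blast+
    moreover have "(\<Union>i\<in>A-{n}. g i) \<union> (g n \<union> t) = (\<Union>i\<in>A. g i) \<union> t" if "n \<in> A" using that by blast
    moreover have "A - {n} = A" if "n \<notin> A" using that by blast
    ultimately show ?case by metis
  qed
  have bs: "blocks s" by (rule successive_blocks[where N = N, OF s])
  have "(\<Union>k\<in>S. \<Union>i\<in>s k. g i) \<in> X" if S: "S \<in> FIN" for S
  proof -
    \<comment> \<open>The last block \<open>s m\<close> contributes a member of
      \<open>Y (N m)\<close>; the earlier blocks use indices below \<open>N m\<close> and are
      absorbed.\<close>
    define m where "m = Max S"
    have m: "m \<in> S" "\<And>i. i \<in> S \<Longrightarrow> i \<le> m" using S(1) by (auto simp: m_def FIN_def)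
    have "(\<Union>k\<in>S-{m}. s k) \<subseteq> {..<N m}"
    proof
      fix x assume "x \<in> (\<Union>k\<in>S-{m}. s k)"
      then obtain k where k: "k \<in> S" "k \<noteq> m" "x \<in> s k" by blast
      then have "k < m" using m(2) by force
      have "x < N (Suc k)" using k s(2) by force
      also have "\<dots> \<le> N m" using mono \<open>k < m\<close> by (simp add: mono_def)
      finally show "x \<in> {..<N m}" by simp
    qed
    from absorb[OF this sY] have "(\<Union>i\<in>(\<Union>k\<in>S-{m}. s k). g i) \<union> (\<Union>i\<in>s m. g i) \<in> X" .
    moreover have "(\<Union>i\<in>(\<Union>k\<in>S-{m}. s k). g i) \<union> (\<Union>i\<in>s m. g i) = (\<Union>k\<in>S. \<Union>i\<in>s k. g i)"
      using m(1) by blast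
    ultimately show ?thesis by simp
  qed
  then show ?thesis using blocks_comp[OF gb bs] by blast
qed

text \<open>Non-largeness of \<open>X\<close> is by definition the existence of a block sequence all
  of whose unions avoid \<open>X\<close>; the iteration covers the large case.\<close>

theorem Hindman_finite_unions:
  "\<exists>c. blocks c \<and> ((\<forall>S\<in>FIN. (\<Union>i\<in>S. c i) \<in> X) \<or> (\<forall>S\<in>FIN. (\<Union>i\<in>S. c i) \<notin> X))"
proof (cases "large X")
  case True
  then show ?thesis using large_imp_homogeneous by blast
next
  case False
  then show ?thesis unfolding large_def by blast
qed

section \<open>Refinable set functions\<close>

text \<open>The sets \<open>Z n\<close> are only almost decreasing, so they are replaced by the
  finite intersections \<open>W n\<close>, which lose finitely many points. A new point of each
  \<open>W n\<close> in turn then gives \<open>Y\<close>; \<open>S n\<close> consists of the first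
  \<open>n\<close> of these points.\<close>

lemma pseudo_intersection:
  fixes Z :: "nat \<Rightarrow> 'a set"
  assumes "\<And>n. infinite (Z n)" "\<And>n. finite (Z (Suc n) - Z n)"
  shows "\<exists>Y. infinite Y \<and> Y \<subseteq> Z 0 \<and> (\<forall>n. finite (Y - Z n))"
proof -
  define W where "W n = (\<Inter>k\<le>n. Z k)" for n
  have Wdec: "W n \<subseteq> W m" if "m \<le> n" for m n using that by (auto simp: W_def)
  have fin: "finite (Z n - W n)" for n
  proof (induction n)
    case (Suc n)
    have "Z (Suc n) - W (Suc n) \<subseteq> (Z (Suc n) - Z n) \<union> (Z n - W n)" by (auto simp: W_def le_Suc_eq)
    then show ?case using Suc assms(2) finite_subset by blast
  qed (simp add: W_def)
  have W: "infinite (W n)" for n using fin[of n] assms(1)[of n] finite_Diff2 by blast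
  define S where "S = rec_nat {} (\<lambda>n T. insert (SOME x. x \<in> W n - T) T)"
  have S0: "S 0 = {}" by (simp add: S_def)
  have SS: "S (Suc n) = insert (SOME x. x \<in> W n - S n) (S n)" for n by (simp add: S_def)
  have fS: "finite (S n)" for n by (induction n) (auto simp: S0 SS)
  have new: "(SOME x. x \<in> W n - S n) \<in> W n - S n" for n
  proof (rule someI_ex)
    have "infinite (W n - S n)" using W fS by (simp add: Diff_infinite_finite)
    then show "\<exists>x. x \<in> W n - S n" using infinite_imp_nonempty by blast
  qed
  have cS: "card (S n) = n" for n
    by (induction n) (use new fS in \<open>auto simp: S0 SS\<close>)
  have mono: "S m \<subseteq> S n" if "m \<le> n" for m n
    by (rule lift_Suc_mono_le[of S, OF _ that]) (auto simp: SS)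
  have tail: "S m - S n \<subseteq> W n" for m n
  proof (induction m)
    case (Suc m)
    show ?case
    proof (cases "m < n")
      case True
      then have "S (Suc m) \<subseteq> S n" by (intro mono) simp
      then show ?thesis by blast
    next
      case False
      then show ?thesis using Suc new[of m] Wdec[of n m] by (auto simp: SS)
    qed
  qed (simp add: S0)
  let ?Y = "\<Union>m. S m"
  have "infinite ?Y"
  proof
    assume "finite ?Y"
    then have "card (S (Suc (card ?Y))) \<le> card ?Y" by (intro card_mono) auto
    then show False by (simp add: cS)
  qed
  moreover have Yn: "?Y - S n \<subseteq> W n" for n using tail by blast
  moreover have "?Y \<subseteq> Z 0" using Yn[of 0] by (simp add: S0 W_def)
  moreover have "finite (?Y - Z n)" for n
    by (rule finite_subset[OF _ fS[of n]]) (use Yn[of n] in \<open>auto simp: W_def\<close>)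
  ultimately show ?thesis by blast
qed

text \<open>Convergence along \<open>D\<close> depends only on the values at tails
  \<open>D - K\<close>, and \<open>le_tail\<close> makes it pass to refinements. Partition
  regularity and sigma-closure then allow countably many requirements on tails to be met by a single
  refinement.\<close>

locale refinable_set_fun =
  fixes \<rho> :: "(nat, 't) set_fun" and le :: "nat set \<Rightarrow> nat set \<Rightarrow> bool" (infix \<open>\<preceq>\<close> 50)
  assumes ground_eq: "ground \<rho> = UNIV"
    and family_eq: "family \<rho> = {D. infinite D}"
    and countable_target: "countable (target \<rho>)"
    and val_subset: "val \<rho> D \<subseteq> target \<rho>"
    and val_mono: "E \<subseteq> D \<Longrightarrow> val \<rho> E \<subseteq> val \<rho> D"
    and infinite_val: "infinite D \<Longrightarrow> infinite (val \<rho> D)"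
    and le_refl: "D \<preceq> D"
    and le_trans: "C \<preceq> D \<Longrightarrow> D \<preceq> E \<Longrightarrow> C \<preceq> E"
    and le_tail: "E \<preceq> D \<Longrightarrow> finite K \<Longrightarrow> \<exists>L. finite L \<and> val \<rho> (E - L) \<subseteq> val \<rho> (D - K)"
    and partition_regular:
      "infinite D \<Longrightarrow> \<exists>E. infinite E \<and> E \<preceq> D \<and> (val \<rho> E \<subseteq> P \<or> val \<rho> E \<inter> P = {})"
    and sigma_closed:
      "(\<And>n. infinite (S n)) \<Longrightarrow> (\<And>n. S (Suc n) \<preceq> S n) \<Longrightarrow> \<exists>E. infinite E \<and> (\<forall>n. E \<preceq> S n)"

section \<open>Verification for pairs, differences and finite sums\<close>

lemma infinite_nsets_2:
  assumes "infinite (D :: nat set)"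
  shows "infinite (nsets D 2)"
proof
  assume "finite (nsets D 2)"
  then have "finite (\<Union>(nsets D 2))" by (rule finite_Union) (auto simp: nsets_def)
  moreover have "D \<subseteq> \<Union>(nsets D 2)"
  proof
    fix x assume "x \<in> D"
    obtain y where "y \<in> D" "y \<noteq> x"
      using assms by (metis finite.emptyI finite_insert finite_subset insertI1 subsetI)
    then show "x \<in> \<Union>(nsets D 2)" using \<open>x \<in> D\<close> by (auto intro!: UnionI[of "{x, y}"])
  qed
  ultimately show False using assms finite_subset by blast
qed

lemma almost_subset_sigma_closed:
  fixes S :: "nat \<Rightarrow> nat set"
  assumes "\<And>n. infinite (S n)" "\<And>n. finite (S (Suc n) - S n)"
  shows "\<exists>E. infinite E \<and> (\<forall>n. finite (E - S n))"
  using pseudo_intersection[of S] assms by blast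

lemma almost_subset_trans: "finite (C - D) \<Longrightarrow> finite (D - E) \<Longrightarrow> finite (C - E)"
  by (rule finite_subset[of _ "(C - D) \<union> (D - E)"]) auto

lemma almost_subset_tail:
  assumes "finite (E - D)" "finite K"
  shows "\<exists>L. finite L \<and> E - L \<subseteq> D - K"
  using assms by (intro exI[of _ "(E - D) \<union> K"]) auto

lemma refinable_pairs_fun: "refinable_set_fun pairs_fun (\<lambda>E D. finite (E - D))"
proof unfold_locales
  show "countable (target pairs_fun)"
    unfolding pairs_fun_def using countable_Collect_finite
    by (auto simp: nsets_def intro: countable_subset[OF _ countable_Collect_finite])
  show "val pairs_fun E \<subseteq> val pairs_fun D" if "E \<subseteq> D" for E D
    using nsets_mono[OF that] by (simp add: pairs_fun_def)
  show "infinite (val pairs_fun D)" if "infinite D" for D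
    using infinite_nsets_2[OF that] by (simp add: pairs_fun_def)
  show "\<exists>L. finite L \<and> val pairs_fun (E - L) \<subseteq> val pairs_fun (D - K)"
    if "finite (E - D)" "finite K" for E D K
    using almost_subset_tail[OF that] nsets_mono by (fastforce simp: pairs_fun_def)
  show "\<exists>E. infinite E \<and> finite (E - D) \<and> (val pairs_fun E \<subseteq> P \<or> val pairs_fun E \<inter> P = {})"
    if "infinite D" for D P
  proof -
    obtain Y t where "Y \<subseteq> D" "infinite Y" and Y: "(\<lambda>X. if X \<in> P then 1 else (0::nat)) ` nsets Y 2 \<subseteq> {t}"
      by (rule Ramsey_nsets[OF \<open>infinite D\<close>, of "\<lambda>X. if X \<in> P then 1 else (0::nat)" 2 2]) auto
    moreover have "nsets Y 2 \<subseteq> P \<or> nsets Y 2 \<inter> P = {}"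
    proof (cases "t = 1")
      case True
      then show ?thesis using Y by (auto split: if_splits)
    next
      case False
      then show ?thesis using Y by (auto split: if_splits)
    qed
    moreover have "finite (Y - D)" using \<open>Y \<subseteq> D\<close> by (simp add: Diff_eq_empty_iff[THEN iffD2])
    ultimately show ?thesis by (intro exI[of _ Y]) (simp add: pairs_fun_def)
  qed
qed (use almost_subset_trans almost_subset_sigma_closed in \<open>auto simp: pairs_fun_def nsets_def\<close>)

lemma refinable_Diff_fun: "refinable_set_fun Diff_fun (\<lambda>E D. finite (E - D))"
proof unfold_locales
  show mono: "val Diff_fun E \<subseteq> val Diff_fun D" if "E \<subseteq> D" for E D
    using that by (auto simp: Diff_fun_def)
  show "infinite (val Diff_fun D)" if "infinite D" for D
  proof -
    obtain b where b: "b \<in> D" using \<open>infinite D\<close> by (metis finite.emptyI ex_in_conv)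
    have "infinite (D - {..b})" using \<open>infinite D\<close> by simp
    moreover have "inj_on (\<lambda>a. a - b) (D - {..b})" by (auto simp: inj_on_def)
    ultimately have "infinite ((\<lambda>a. a - b) ` (D - {..b}))" using finite_imageD by blast
    moreover have "(\<lambda>a. a - b) ` (D - {..b}) \<subseteq> val Diff_fun D"
      using b unfolding Diff_fun_def by (force simp: not_le)
    ultimately show ?thesis using finite_subset by blast
  qed
  show "\<exists>L. finite L \<and> val Diff_fun (E - L) \<subseteq> val Diff_fun (D - K)"
    if "finite (E - D)" "finite K" for E D K
    using almost_subset_tail[OF that] mono by blast
  show "\<exists>E. infinite E \<and> finite (E - D) \<and> (val Diff_fun E \<subseteq> P \<or> val Diff_fun E \<inter> P = {})"
    if "infinite D" for D P
  proof -
    \<comment> \<open>A difference is a function of the pair: colouring a pair by whether its larger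
      minus its smaller element lies in \<open>P\<close> reduces the claim to Ramsey's
      theorem.\<close>
    let ?f = "\<lambda>X. if Max X - Min X \<in> P then 1 else (0::nat)"
    have "\<forall>x\<in>D. \<forall>y\<in>D. x \<noteq> y \<longrightarrow> ?f {x, y} < 2" by simp
    from Ramsey2[OF \<open>infinite D\<close> this] obtain Y t where "Y \<subseteq> D" "infinite Y"
      and Y: "\<forall>x\<in>Y. \<forall>y\<in>Y. x \<noteq> y \<longrightarrow> ?f {x, y} = t" by blast
    have "(a - b \<in> P) = (t = 1)" if "a \<in> Y" "b \<in> Y" "a > b" for a b
      using Y[rule_format, of a b] that by (auto split: if_splits)
    then have "val Diff_fun Y \<subseteq> P \<or> val Diff_fun Y \<inter> P = {}"
      by (cases "t = 1") (auto simp: Diff_fun_def)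
    moreover have "finite (Y - D)" using \<open>Y \<subseteq> D\<close> by (simp add: Diff_eq_empty_iff[THEN iffD2])
    ultimately show ?thesis using \<open>infinite Y\<close> by (intro exI[of _ Y]) simp
  qed
qed (use almost_subset_trans almost_subset_sigma_closed in \<open>auto simp: Diff_fun_def\<close>)

text \<open>Almost inclusion does not suit sums: Hindman's theorem yields a set \<open>E\<close> of
  sums of elements of \<open>D\<close>, in general not of elements of \<open>D\<close>. The order is
  therefore defined by exactly what \<open>le_tail\<close> asks.\<close>

definition FS_le :: "nat set \<Rightarrow> nat set \<Rightarrow> bool" where
  "FS_le E D \<longleftrightarrow> (\<forall>K. finite K \<longrightarrow> (\<exists>L. finite L \<and> val FS (E - L) \<subseteq> val FS (D - K)))"

lemma val_FS: "x \<in> val FS D \<longleftrightarrow> (\<exists>S. S \<in> FIN \<and> S \<subseteq> D \<and> x = \<Sum>S)"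
  by (auto simp: FS_def FIN_def)

lemma val_FS_mono: "E \<subseteq> D \<Longrightarrow> val FS E \<subseteq> val FS D"
  unfolding subset_iff val_FS by blast

lemma val_FS_range:
  fixes e :: "nat \<Rightarrow> nat"
  assumes "inj e"
  shows "x \<in> val FS (e ` A) \<longleftrightarrow> (\<exists>S. S \<in> FIN \<and> S \<subseteq> A \<and> x = (\<Sum>i\<in>S. e i))"
proof
  assume "x \<in> val FS (e ` A)"
  then obtain T where T: "T \<in> FIN" "T \<subseteq> e ` A" "x = \<Sum>T" by (auto simp: val_FS)
  then obtain S where S: "S \<subseteq> A" "T = e ` S" by (meson subset_imageE)
  then have "x = (\<Sum>i\<in>S. e i)" using T(3) sum.reindex[of e S "\<lambda>x. x"] inj_on_subset[OF assms]
    by auto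
  moreover have "S \<in> FIN" using S T(1) finite_imageD inj_on_subset[OF assms] by (auto simp: FIN_def)
  ultimately show "\<exists>S. S \<in> FIN \<and> S \<subseteq> A \<and> x = (\<Sum>i\<in>S. e i)" using S by blast
next
  assume "\<exists>S. S \<in> FIN \<and> S \<subseteq> A \<and> x = (\<Sum>i\<in>S. e i)"
  then obtain S where S: "S \<in> FIN" "S \<subseteq> A" "x = (\<Sum>i\<in>S. e i)" by blast
  then show "x \<in> val FS (e ` A)"
    unfolding val_FS using sum.reindex[of e S "\<lambda>x. x"] inj_on_subset[OF assms]
    by (intro exI[of _ "e ` S"]) (auto simp: FIN_def)
qed

text \<open>Finite unions are translated into sums. \<open>D\<close> is thinned to a sequence
  \<open>d\<close>, finite index sets are coloured by whether their \<open>d\<close>-sum lies in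
  \<open>P\<close>, and a homogeneous block sequence \<open>c\<close> gives \<open>e n\<close> as
  the \<open>d\<close>-sum over \<open>c n\<close>. As blocks are disjoint, sums of terms of
  \<open>e\<close> are \<open>d\<close>-sums over unions of blocks.\<close>

lemma FS_partition_regular:
  assumes "infinite D"
  shows "\<exists>E. infinite E \<and> FS_le E D \<and> (val FS E \<subseteq> P \<or> val FS E \<inter> P = {})"
proof -
  \<comment> \<open>Growth by more than a factor 2 makes each \<open>d n\<close> exceed the sum of
    all earlier terms, so the block sums \<open>e n\<close> strictly increase and are
    distinct.\<close>
  have "\<exists>d. \<forall>n. (d n \<in> D \<and> d n > 0) \<and> d (Suc n) > 2 * d n"
  proof (rule dependent_nat_choice)
    have "\<exists>y>x. y \<in> D" for x using assms by (simp add: infinite_nat_iff_unbounded)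
    then show "\<exists>x. x \<in> D \<and> x > 0" "\<And>x n::nat. \<exists>y. (y \<in> D \<and> y > 0) \<and> y > 2 * x"
      by (blast, metis gr_zeroI not_less_zero)
  qed
  then obtain d where dD: "\<And>n. d n \<in> D" and d0: "\<And>n. d n > 0" and d2: "\<And>n. d (Suc n) > 2 * d n" by blast
  have "d n < d (Suc n)" for n using d2[of n] by simp
  then have ds: "strict_mono d" by (simp add: strict_mono_Suc_iff)
  then have di: "inj d" by (rule strict_mono_imp_inj_on)
  have dsum: "(\<Sum>i<n. d i) < d n" for n
  proof (induction n)
    case (Suc n)
    then show ?case using d2[of n] by simp
  qed (simp add: d0)
  obtain c where c: "blocks c" and hom: "(\<forall>S\<in>FIN. (\<Union>i\<in>S. c i) \<in> {S. (\<Sum>i\<in>S. d i) \<in> P}) \<or>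
      (\<forall>S\<in>FIN. (\<Union>i\<in>S. c i) \<notin> {S. (\<Sum>i\<in>S. d i) \<in> P})"
    using Hindman_finite_unions[of "{S. (\<Sum>i\<in>S. d i) \<in> P}"] by auto
  have fc: "finite (c n)" "c n \<noteq> {}" for n using blocks_FIN[OF c] by (auto simp: FIN_def)
  define e where "e n = (\<Sum>i\<in>c n. d i)" for n
  have "e n < e (Suc n)" for n
  proof -
    obtain m where m: "m \<in> c (Suc n)" using fc by blast
    have "c n \<subseteq> {..<m}" using c m by (auto simp: blocks_def)
    then have "e n \<le> (\<Sum>i<m. d i)" unfolding e_def by (intro sum_mono2) auto
    also have "\<dots> < d m" by (rule dsum)
    also have "\<dots> \<le> e (Suc n)" unfolding e_def by (rule member_le_sum) (use m fc in auto)
    finally show ?thesis .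
  qed
  then have "strict_mono e" by (simp add: strict_mono_Suc_iff)
  then have ei: "inj e" by (rule strict_mono_imp_inj_on)
  have esum: "(\<Sum>n\<in>S. e n) = (\<Sum>i\<in>(\<Union>n\<in>S. c n). d i)" if "S \<in> FIN" for S
  proof -
    have "c m \<inter> c n = {}" if "m \<noteq> n" for m n
      using blocks_less[OF c, of m n] blocks_less[OF c, of n m] that by (metis disjoint_iff linorder_neqE_nat less_irrefl)
    then show ?thesis unfolding e_def using fc \<open>S \<in> FIN\<close>
      by (subst sum.UNION_disjoint) (auto simp: FIN_def)
  qed
  have "val FS (range e) \<subseteq> P \<or> val FS (range e) \<inter> P = {}"
    using hom esum unfolding disjoint_iff subset_iff val_FS_range[OF ei] by fastforce
  moreover have "infinite (range e)" using ei by (simp add: finite_image_iff)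
  moreover have "FS_le (range e) D"
    unfolding FS_le_def
  proof (intro allI impI)
    fix K :: "nat set" assume "finite K"
    then have "finite (d -` K)" by (rule finite_vimageI[OF _ di])
    then obtain N where N: "\<And>n. d n \<in> K \<Longrightarrow> n < N" by (auto simp: finite_nat_iff_bounded)
    \<comment> \<open>Since \<open>c n\<close> lies at or beyond \<open>n\<close>, dropping the
      first \<open>N\<close> terms of \<open>e\<close> leaves only summands \<open>d i\<close> with
      \<open>i \<ge> N\<close>, and these avoid \<open>K\<close>.\<close>
    have "val FS (range e - e ` {..<N}) \<subseteq> val FS (D - K)"
    proof
      fix x assume "x \<in> val FS (range e - e ` {..<N})"
      moreover have "range e - e ` {..<N} \<subseteq> e ` {N..}" by force
      ultimately have "x \<in> val FS (e ` {N..})" using val_FS_mono by blast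
      then obtain S where S: "S \<in> FIN" "S \<subseteq> {N..}" "x = (\<Sum>i\<in>S. e i)" by (auto simp: val_FS_range[OF ei])
      let ?U = "\<Union>n\<in>S. c n"
      have "?U \<in> FIN" by (rule blocks_UN_FIN[OF c S(1)])
      moreover have "?U \<subseteq> {N..}" using S(2) blocks_ge[OF c] by fastforce
      ultimately have "x \<in> val FS (d ` {N..})" unfolding val_FS_range[OF di] using esum[OF S(1)] S(3) by metis
      moreover have "d ` {N..} \<subseteq> D - K" using dD N by fastforce
      ultimately show "x \<in> val FS (D - K)" using val_FS_mono by blast
    qed
    then show "\<exists>L. finite L \<and> val FS (range e - L) \<subseteq> val FS (D - K)" by blast
  qed
  ultimately show ?thesis by blast
qed

lemma FS_le_trans: "FS_le C D \<Longrightarrow> FS_le D E \<Longrightarrow> FS_le C E"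
  unfolding FS_le_def by (meson subset_trans)

text \<open>A diagonal sequence \<open>e n\<close> in \<open>S n - L n\<close> is chosen so that all
  sums from \<open>S (Suc n) - L (Suc n)\<close> are also sums from each \<open>S k\<close> with
  \<open>k \<le> n\<close>, with summands outside \<open>L n\<close> and greater than
  \<open>e n\<close>. A finite sum of terms of \<open>e\<close> is then rebuilt from its last term
  backwards, each step rewriting the later part as a sum to which the preceding term can be
  added.\<close>

lemma FS_sigma_closed:
  assumes inf: "\<And>n. infinite (S n)" and le: "\<And>n. FS_le (S (Suc n)) (S n)"
  shows "\<exists>E. infinite E \<and> (\<forall>n. FS_le E (S n))"
proof -
  have le': "FS_le (S n) (S k)" if "k \<le> n" for k n
    using that
  proof (induction n rule: dec_induct)
    case base
    then show ?case by (auto simp: FS_le_def)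
  next
    case (step n)
    then show ?case using FS_le_trans le by blast
  qed
  have "\<exists>f. \<forall>n. (finite (fst (f n)) \<and> snd (f n) \<in> S n - fst (f n)) \<and>
      (snd (f n) < snd (f (Suc n)) \<and>
       (\<forall>k\<le>n. val FS (S (Suc n) - fst (f (Suc n))) \<subseteq> val FS (S k - (fst (f n) \<union> {..snd (f n)}))))"
  proof (rule dependent_nat_choice)
    have "\<exists>x. x \<in> S 0" using inf[of 0] by (metis ex_in_conv finite.emptyI)
    then show "\<exists>x. finite (fst x) \<and> snd x \<in> S 0 - fst x" by auto
  next
    fix x :: "nat set \<times> nat" and n
    assume x: "finite (fst x) \<and> snd x \<in> S n - fst x"
    let ?K = "fst x \<union> {..snd x}"
    \<comment> \<open>All earlier \<open>S k\<close> are treated at once; the union \<open>M\<close>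
      of the finitely many sets \<open>L k\<close> serves each of them.\<close>
    have "\<forall>k\<in>{..n}. \<exists>L. finite L \<and> val FS (S (Suc n) - L) \<subseteq> val FS (S k - ?K)"
      using le' x by (auto simp: FS_le_def)
    then obtain L where L: "\<And>k. k \<le> n \<Longrightarrow> finite (L k)"
        "\<And>k. k \<le> n \<Longrightarrow> val FS (S (Suc n) - L k) \<subseteq> val FS (S k - ?K)" by (metis atMost_iff)
    define M where "M = (\<Union>k\<le>n. L k)"
    have fM: "finite M" using L(1) by (auto simp: M_def)
    have M: "val FS (S (Suc n) - M) \<subseteq> val FS (S k - ?K)" if "k \<le> n" for k
    proof -
      have "S (Suc n) - M \<subseteq> S (Suc n) - L k" using that by (auto simp: M_def)
      then show ?thesis using L(2)[OF that] val_FS_mono by blast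
    qed
    have "infinite (S (Suc n) - (M \<union> {..snd x}))" using inf fM by (simp add: Diff_infinite_finite)
    then obtain y where "y \<in> S (Suc n) - (M \<union> {..snd x})" by (metis ex_in_conv finite.emptyI)
    then show "\<exists>y. (finite (fst y) \<and> snd y \<in> S (Suc n) - fst y) \<and> (snd x < snd y \<and>
        (\<forall>k\<le>n. val FS (S (Suc n) - fst y) \<subseteq> val FS (S k - (fst x \<union> {..snd x}))))"
      using fM M by (intro exI[of _ "(M, y)"]) auto
  qed
  then obtain f where f: "\<And>n. snd (f n) \<in> S n - fst (f n)" "\<And>n. snd (f n) < snd (f (Suc n))"
    "\<And>k n. k \<le> n \<Longrightarrow> val FS (S (Suc n) - fst (f (Suc n))) \<subseteq> val FS (S k - (fst (f n) \<union> {..snd (f n)}))"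
    by blast
  define e where "e n = snd (f n)" for n
  define L where "L n = fst (f n)" for n
  have eS: "e n \<in> S n - L n" and eSuc: "e n < e (Suc n)" for n using f(1,2)[of n] by (auto simp: e_def L_def)
  have step: "val FS (S (Suc n) - L (Suc n)) \<subseteq> val FS (S k - (L n \<union> {..e n}))" if "k \<le> n" for k n
    using f(3)[OF that] by (simp add: e_def L_def)
  have es: "strict_mono e" using eSuc by (simp add: strict_mono_Suc_iff)
  then have ei: "inj e" by (rule strict_mono_imp_inj_on)
  note tl_step = step
  have dec: "val FS (S n - L n) \<subseteq> val FS (S m - L m)" if "m \<le> n" for m n
    using that
  proof (induction n rule: dec_induct)
    case (step n)
    have "val FS (S (Suc n) - L (Suc n)) \<subseteq> val FS (S n - (L n \<union> {..e n}))" using tl_step by simp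
    also have "\<dots> \<subseteq> val FS (S n - L n)" by (rule val_FS_mono) auto
    finally show ?case using step.IH by blast
  qed simp
  have sums: "(\<Sum>i\<in>T. e i) \<in> val FS (S n - L n)" if "T \<in> FIN" "T \<subseteq> {n..}" for T n
    using that
  proof (induction "card T" arbitrary: T n rule: less_induct)
    case less
    define m where "m = Min T"
    have fT: "finite T" and m: "m \<in> T" "\<And>i. i \<in> T \<Longrightarrow> m \<le> i" using less.prems by (auto simp: m_def FIN_def)
    have "(\<Sum>i\<in>T. e i) \<in> val FS (S m - L m)"
    proof (cases "T = {m}")
      case True
      then show ?thesis unfolding val_FS using eS[of m] by (intro exI[of _ "{e m}"]) (auto simp: FIN_def)
    next
      case False
      let ?T = "T - {m}"
      have "?T \<in> FIN" using False fT m by (auto simp: FIN_def)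
      moreover have "?T \<subseteq> {Suc m..}" using m(2) by (force simp: Suc_le_eq)
      moreover have "card ?T < card T" using fT m(1) by (rule card_Diff1_less)
      ultimately have "(\<Sum>i\<in>?T. e i) \<in> val FS (S (Suc m) - L (Suc m))" using less.hyps by blast
      \<comment> \<open>The summands obtained here exceed \<open>e m\<close>, so \<open>e m\<close>
        is not among them and can be inserted.\<close>
      then have "(\<Sum>i\<in>?T. e i) \<in> val FS (S m - (L m \<union> {..e m}))" using step by blast
      then obtain U where U: "U \<in> FIN" "U \<subseteq> S m - (L m \<union> {..e m})" "(\<Sum>i\<in>?T. e i) = \<Sum>U"
        by (auto simp: val_FS)
      have "(\<Sum>i\<in>T. e i) = e m + (\<Sum>i\<in>?T. e i)" using fT m(1) by (simp add: sum.remove)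
      also have "\<dots> = \<Sum>(insert (e m) U)" using U by (subst sum.insert) (auto simp: FIN_def)
      finally show ?thesis unfolding val_FS using U eS[of m]
        by (intro exI[of _ "insert (e m) U"]) (auto simp: FIN_def)
    qed
    moreover have "n \<le> m" using m(1) less.prems(2) by auto
    ultimately show ?case using dec by blast
  qed
  have "FS_le (range e) (S n)" for n
    unfolding FS_le_def
  proof (intro allI impI)
    fix K :: "nat set" assume "finite K"
    then obtain N where "\<And>x. x \<in> K \<Longrightarrow> x < N" by (auto simp: finite_nat_iff_bounded)
    then have K: "x \<le> e (max n N)" if "x \<in> K" for x
      using that strict_mono_imp_increasing[OF es, of "max n N"] by fastforce
    let ?m = "max n N"
    have "val FS (range e - e ` {..?m}) \<subseteq> val FS (S n - K)"
    proof
      fix x assume "x \<in> val FS (range e - e ` {..?m})"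
      moreover have "range e - e ` {..?m} \<subseteq> e ` {Suc ?m..}" by (force simp: not_less_eq_eq)
      ultimately have "x \<in> val FS (e ` {Suc ?m..})" using val_FS_mono by blast
      then have "x \<in> val FS (S (Suc ?m) - L (Suc ?m))" using sums by (auto simp: val_FS_range[OF ei])
      then have "x \<in> val FS (S n - (L ?m \<union> {..e ?m}))" using step[of n ?m] by auto
      moreover have "S n - (L ?m \<union> {..e ?m}) \<subseteq> S n - K" using K by auto
      ultimately show "x \<in> val FS (S n - K)" using val_FS_mono by blast
    qed
    then show "\<exists>L. finite L \<and> val FS (range e - L) \<subseteq> val FS (S n - K)" by blast
  qed
  moreover have "infinite (range e)" using ei by (simp add: finite_image_iff)
  ultimately show ?thesis by blast
qed

lemma refinable_FS: "refinable_set_fun FS FS_le"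
proof unfold_locales
  show "infinite (val FS D)" if "infinite D" for D
  proof -
    have "D \<subseteq> val FS D"
    proof
      fix x assume "x \<in> D"
      then show "x \<in> val FS D" unfolding val_FS by (intro exI[of _ "{x}"]) (auto simp: FIN_def)
    qed
    then show ?thesis using that finite_subset by blast
  qed
  show "val FS E \<subseteq> val FS D" if "E \<subseteq> D" for E D by (rule val_FS_mono[OF that])
  show "FS_le C E" if "FS_le C D" "FS_le D E" for C D E using that by (rule FS_le_trans)
  show "\<exists>E. infinite E \<and> FS_le E D \<and> (val FS E \<subseteq> P \<or> val FS E \<inter> P = {})" if "infinite D" for D P
    by (rule FS_partition_regular[OF that])
  show "\<exists>E. infinite E \<and> (\<forall>n. FS_le E (S n))"
    if "\<And>n. infinite (S n)" "\<And>n. FS_le (S (Suc n)) (S n)" for S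
    using FS_sigma_closed[of S] that by blast
  show "\<exists>L. finite L \<and> val FS (E - L) \<subseteq> val FS (D - K)" if "FS_le E D" "finite K" for E D K
    using that by (auto simp: FS_le_def)
  show "FS_le D D" for D by (auto simp: FS_le_def)
qed (auto simp: FS_def)

section \<open>Null sequences\<close>

definition null_seq :: "'l set \<Rightarrow> 'l set set \<Rightarrow> (nat \<Rightarrow> 'l set) \<Rightarrow> bool" where
  "null_seq \<Lambda> \<I> V \<longleftrightarrow> (\<forall>n. V n \<subseteq> \<Lambda> \<and> V n \<noteq> {}) \<and> decseq V \<and> (\<Inter>n. V n) = {} \<and>
     (\<forall>B\<in>positive_sets \<Lambda> \<I>. \<exists>n. infinite (B - V n))"

definition separated :: "(nat \<Rightarrow> 'l set) \<Rightarrow> (nat \<Rightarrow> 'l set) \<Rightarrow> bool" where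
  "separated U V \<longleftrightarrow> (\<exists>n. U n \<inter> V n = {})"

text \<open>Here and in \<open>fun_conv\<close>, \<open>V\<close> stands for a point with basic
  neighbourhoods \<open>V n\<close>, and convergence to it is expressed before any topology
  exists.\<close>

definition set_conv :: "'l set \<Rightarrow> (nat \<Rightarrow> 'l set) \<Rightarrow> bool" where
  "set_conv Z V \<longleftrightarrow> (\<forall>n. finite (Z - V n))"

definition fun_conv :: "(nat, 't) set_fun \<Rightarrow> ('t \<Rightarrow> 'l) \<Rightarrow> nat set \<Rightarrow> (nat \<Rightarrow> 'l set) \<Rightarrow> bool" where
  "fun_conv \<rho> f D V \<longleftrightarrow> (\<forall>n. \<exists>K. finite K \<and> f ` val \<rho> (D - K) \<subseteq> V n)"

lemma finite_escapes:
  assumes "decseq V" "(\<Inter>n. V n) = {}" "finite F"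
  shows "\<exists>n. F \<inter> V n = {}"
proof -
  have "\<exists>n. x \<notin> V n" for x using assms(2) by blast
  then obtain m where m: "\<And>x. x \<notin> V (m x)" by metis
  define n where "n = Max (insert 0 (m ` F))"
  have "x \<notin> V n" if "x \<in> F" for x
  proof -
    have "m x \<le> n" unfolding n_def using that assms(3) by (intro Max_ge) auto
    then show ?thesis using m[of x] decseqD[OF assms(1)] by blast
  qed
  then show ?thesis by blast
qed

section \<open>Fusion arguments in the refinement order\<close>

context refinable_set_fun
begin

text \<open>Countably many requirements are met one after another along a descending chain;
  \<open>sigma_closed\<close> provides a lower bound, which inherits all of them by
  \<open>her\<close>.\<close>

lemma diagonal:
  fixes Q :: "'i \<Rightarrow> nat set \<Rightarrow> bool"
  assumes "countable J" "infinite D"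
    and her: "\<And>i E A. i \<in> J \<Longrightarrow> Q i A \<Longrightarrow> infinite E \<Longrightarrow> E \<preceq> A \<Longrightarrow> Q i E"
    and dense: "\<And>i E. i \<in> J \<Longrightarrow> infinite E \<Longrightarrow> E \<preceq> D \<Longrightarrow> \<exists>A. infinite A \<and> A \<preceq> E \<and> Q i A"
  shows "\<exists>E. infinite E \<and> E \<preceq> D \<and> (\<forall>i\<in>J. Q i E)"
proof (cases "J = {}")
  case True
  then show ?thesis using assms(2) le_refl by blast
next
  case False
  define j where "j = from_nat_into J"
  have j: "j n \<in> J" for n unfolding j_def by (rule from_nat_into[OF False])
  have "\<exists>f. \<forall>n. (infinite (f n) \<and> f n \<preceq> D \<and> Q (j n) (f n)) \<and> f (Suc n) \<preceq> f n"
  proof (rule dependent_nat_choice)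
    show "\<exists>x. infinite x \<and> x \<preceq> D \<and> Q (j 0) x" using dense[OF j assms(2) le_refl] by blast
    show "\<exists>y. (infinite y \<and> y \<preceq> D \<and> Q (j (Suc n)) y) \<and> y \<preceq> x"
      if "infinite x \<and> x \<preceq> D \<and> Q (j n) x" for x n
      using dense[OF j[of "Suc n"], of x] that le_trans by blast
  qed
  then obtain f where f: "\<And>n. infinite (f n)" "\<And>n. f n \<preceq> D" "\<And>n. Q (j n) (f n)" "\<And>n. f (Suc n) \<preceq> f n"
    by blast
  obtain E where E: "infinite E" "\<And>n. E \<preceq> f n" using sigma_closed[of f] f by blast
  have "Q i E" if i: "i \<in> J" for i
  proof -
    obtain n where "i = j n" unfolding j_def using from_nat_into_surj[OF assms(1) i] by metis
    then show ?thesis using her[OF i] f(3)[of n] E by blast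
  qed
  then show ?thesis using E le_trans f(2) by blast
qed

text \<open>If \<open>f\<close> is constant on no refinement, partition regularity applied to the
  fibre of \<open>c\<close> gives a refinement on which \<open>f\<close> omits \<open>c\<close>. As
  \<open>f\<close> takes only countably many values on the target, \<open>diagonal\<close> treats
  all of them together.\<close>

lemma dichotomy:
  assumes "infinite D"
  shows "\<exists>E. infinite E \<and> E \<preceq> D \<and>
    ((\<exists>c. \<forall>x\<in>val \<rho> E. f x = c) \<or> (\<forall>c. \<exists>K. finite K \<and> c \<notin> f ` val \<rho> (E - K)))"
proof (cases "\<exists>E. infinite E \<and> E \<preceq> D \<and> (\<exists>c. \<forall>x\<in>val \<rho> E. f x = c)")
  case True
  then show ?thesis by blast
next
  case False
  have "\<exists>E. infinite E \<and> E \<preceq> D \<and> (\<forall>c\<in>f ` target \<rho>. \<exists>K. finite K \<and> c \<notin> f ` val \<rho> (E - K))"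
  proof (rule diagonal)
    show "countable (f ` target \<rho>)" by (rule countable_image[OF countable_target])
    show "\<exists>K. finite K \<and> c \<notin> f ` val \<rho> (E - K)"
      if "\<exists>K. finite K \<and> c \<notin> f ` val \<rho> (A - K)" "E \<preceq> A" for c E A
      using that le_tail by (meson image_mono subsetD)
    show "\<exists>A. infinite A \<and> A \<preceq> E \<and> (\<exists>K. finite K \<and> c \<notin> f ` val \<rho> (A - K))"
      if E: "infinite E" "E \<preceq> D" for c E
    proof -
      obtain A where A: "infinite A" "A \<preceq> E" "val \<rho> A \<subseteq> f -` {c} \<or> val \<rho> A \<inter> f -` {c} = {}"
        using partition_regular[OF E(1)] by blast
      then have "c \<notin> f ` val \<rho> (A - {})" using False le_trans[OF A(2) E(2)] by auto
      then show ?thesis using A by blast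
    qed
  qed (rule assms)
  then obtain E where E: "infinite E" "E \<preceq> D"
    "\<And>c. c \<in> f ` target \<rho> \<Longrightarrow> \<exists>K. finite K \<and> c \<notin> f ` val \<rho> (E - K)" by blast
  have "\<exists>K. finite K \<and> c \<notin> f ` val \<rho> (E - K)" for c
  proof (cases "c \<in> f ` target \<rho>")
    case False
    then have "c \<notin> f ` val \<rho> (E - {})" using val_subset by blast
    then show ?thesis by blast
  qed (rule E(3))
  then show ?thesis using E by blast
qed

end

section \<open>Consequences of the failure of the Katetov order\<close>

locale non_katetov = refinable_set_fun \<rho> le
  for \<rho> :: "(nat, 't) set_fun" and le (infix \<open>\<preceq>\<close> 50) +
  fixes \<Lambda> :: "'l set" and \<I> :: "'l set set"
  assumes ideal: "ideal_on \<Lambda> \<I>"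
    and not_katetov: "\<not> rho_ideal \<Lambda> \<I> \<le>\<^sub>K \<rho>"
begin

lemma countable_ground: "countable \<Lambda>" and infinite_ground: "infinite \<Lambda>"
  and ideal_subset: "A \<in> \<I> \<Longrightarrow> B \<subseteq> A \<Longrightarrow> B \<in> \<I>"
  and ideal_Un: "A \<in> \<I> \<Longrightarrow> B \<in> \<I> \<Longrightarrow> A \<union> B \<in> \<I>"
  and ideal_finite: "F \<subseteq> \<Lambda> \<Longrightarrow> finite F \<Longrightarrow> F \<in> \<I>"
  and ideal_ground: "A \<in> \<I> \<Longrightarrow> A \<subseteq> \<Lambda>" "\<Lambda> \<notin> \<I>"
  using ideal unfolding ideal_on_def by blast+

lemma positive_iff: "B \<in> positive_sets \<Lambda> \<I> \<longleftrightarrow> B \<subseteq> \<Lambda> \<and> B \<notin> \<I>"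
  by (auto simp: positive_sets_def)

lemma positive_infinite: "B \<in> positive_sets \<Lambda> \<I> \<Longrightarrow> infinite B"
  using ideal_finite by (auto simp: positive_iff)

lemma positive_Diff: "B \<in> positive_sets \<Lambda> \<I> \<Longrightarrow> A \<in> \<I> \<Longrightarrow> B - A \<in> positive_sets \<Lambda> \<I>"
  using ideal_Un[of A "B - A"] ideal_subset[of "A \<union> (B - A)" B] by (auto simp: positive_iff)

text \<open>The failure of \<open>\<le>\<^sub>K\<close> is instantiated with \<open>f\<close> as the
  Katetov map. If \<open>B\<close> minus the image were finite, that difference would itself be an
  admissible finite set \<open>L\<close>.\<close>

lemma not_katetov_witness:
  assumes "f \<in> target \<rho> \<rightarrow> \<Lambda>"
  shows "\<exists>D. infinite D \<and> (\<forall>B\<in>positive_sets \<Lambda> \<I>. \<exists>K. finite K \<and> infinite (B - f ` val \<rho> (D - K)))"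
proof -
  have "\<exists>D. infinite D \<and> (\<forall>B\<in>positive_sets \<Lambda> \<I>. \<exists>K. finite K \<and>
      (\<forall>L. L \<subseteq> \<Lambda> \<and> finite L \<longrightarrow> \<not> B - L \<subseteq> f ` val \<rho> (D - K)))"
    using not_katetov assms unfolding katetov_le_def family_eq ground_eq
    by (simp add: rho_ideal_def) meson
  then obtain D where D: "infinite D" "\<forall>B\<in>positive_sets \<Lambda> \<I>. \<exists>K. finite K \<and>
      (\<forall>L. L \<subseteq> \<Lambda> \<and> finite L \<longrightarrow> \<not> B - L \<subseteq> f ` val \<rho> (D - K))" by (elim exE conjE)
  have "\<exists>K. finite K \<and> infinite (B - f ` val \<rho> (D - K))" if B: "B \<in> positive_sets \<Lambda> \<I>" for B
  proof -
    obtain K where K: "finite K" "\<And>L. L \<subseteq> \<Lambda> \<Longrightarrow> finite L \<Longrightarrow> \<not> B - L \<subseteq> f ` val \<rho> (D - K)"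
      using bspec[OF D(2) B] by blast
    have "B - f ` val \<rho> (D - K) \<subseteq> \<Lambda>" using B by (auto simp: positive_iff)
    then show ?thesis using K(1) K(2)[of "B - f ` val \<rho> (D - K)"] by blast
  qed
  then show ?thesis using D(1) by blast
qed

text \<open>Otherwise every infinite subset of \<open>Z\<close> is positive. For an injection
  \<open>g\<close> of the target of \<open>\<rho>\<close> into \<open>Z\<close>, take the
  \<open>D\<close> of \<open>not_katetov_witness\<close>: the images of its tails are infinite, and
  a pseudo-intersection of them is a positive set almost contained in each, a contradiction.\<close>

lemma infinite_subset_in_ideal:
  assumes "Z \<subseteq> \<Lambda>" "infinite Z"
  shows "\<exists>A\<subseteq>Z. infinite A \<and> A \<in> \<I>"
proof (rule ccontr)
  assume no: "\<not> ?thesis"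
  have cZ: "countable Z" using assms(1) countable_ground countable_subset by blast
  define g where "g t = from_nat_into Z (to_nat_on (target \<rho>) t)" for t
  have "inj_on (from_nat_into Z) UNIV"
    using bij_betw_from_nat_into[OF cZ assms(2)] by (auto simp: bij_betw_def)
  then have gi: "inj_on g (target \<rho>)"
    using inj_on_to_nat_on[OF countable_target] by (auto simp: inj_on_def g_def)
  have "Z \<noteq> {}" using assms(2) by auto
  then have gZ: "g t \<in> Z" for t unfolding g_def by (rule from_nat_into)
  then have "g \<in> target \<rho> \<rightarrow> \<Lambda>" using assms(1) by auto
  from not_katetov_witness[OF this] obtain D where D: "infinite D"
    "\<forall>B\<in>positive_sets \<Lambda> \<I>. \<exists>K. finite K \<and> infinite (B - g ` val \<rho> (D - K))"
    by (elim exE conjE)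
  define Y where "Y n = g ` val \<rho> (D - {..<n})" for n
  have "infinite (Y n)" for n
  proof -
    have "infinite (val \<rho> (D - {..<n}))" using D(1) by (intro infinite_val) simp
    then show ?thesis unfolding Y_def using inj_on_subset[OF gi val_subset] finite_imageD by blast
  qed
  moreover have "Y (Suc n) - Y n = {}" for n
  proof -
    have "val \<rho> (D - {..<Suc n}) \<subseteq> val \<rho> (D - {..<n})" by (rule val_mono) auto
    then show ?thesis unfolding Y_def by blast
  qed
  ultimately obtain B where B: "infinite B" "B \<subseteq> Y 0" "\<And>n. finite (B - Y n)"
    using pseudo_intersection[of Y] by (metis finite.emptyI)
  have "B \<subseteq> Z" using B(2) gZ by (auto simp: Y_def)
  then have "B \<in> positive_sets \<Lambda> \<I>" using no B(1) assms(1) by (auto simp: positive_iff)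
  then obtain K where K: "finite K" "infinite (B - g ` val \<rho> (D - K))" using bspec[OF D(2)] by blast
  obtain n where "K \<subseteq> {..<n}" using K(1) finite_nat_iff_bounded by blast
  then have "Y n \<subseteq> g ` val \<rho> (D - K)" unfolding Y_def by (intro image_mono val_mono) auto
  then have "B - g ` val \<rho> (D - K) \<subseteq> B - Y n" by blast
  then show False using K(2) B(3) finite_subset by blast
qed

text \<open>Removing the first \<open>n\<close> points of a fixed enumeration of
  \<open>\<Lambda>\<close> turns a subset of \<open>\<Lambda>\<close> into a decreasing sequence
  with empty intersection, like the basic neighbourhoods of a point \<open>A\<close> in
  \<open>Psi_space\<close>. Term \<open>0\<close> is \<open>A\<close>, so the set is recovered from
  its sequence.\<close>

definition set_seq :: "'l set \<Rightarrow> nat \<Rightarrow> 'l set" where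
  "set_seq A n = A - from_nat_into \<Lambda> ` {..<n}"

lemma set_seq_0 [simp]: "set_seq A 0 = A"
  by (simp add: set_seq_def)

lemma finite_Diff_set_seq: "finite (A - set_seq A n)"
  by (rule finite_subset[of _ "from_nat_into \<Lambda> ` {..<n}"]) (auto simp: set_seq_def)

lemma decseq_set_seq: "decseq (set_seq A)"
  by (auto simp: decseq_def set_seq_def)

lemma set_seq_escapes: "A \<subseteq> \<Lambda> \<Longrightarrow> (\<Inter>n. set_seq A n) = {}"
proof -
  assume A: "A \<subseteq> \<Lambda>"
  have False if "x \<in> (\<Inter>n. set_seq A n)" for x
  proof -
    have "x \<in> \<Lambda>" using that A by (auto simp: set_seq_def)
    then obtain k where "from_nat_into \<Lambda> k = x" using from_nat_into_surj[OF countable_ground] by blast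
    then have "x \<notin> set_seq A (Suc k)" by (auto simp: set_seq_def)
    then show False using that by blast
  qed
  then show ?thesis by blast
qed

lemma null_seq_set_seq:
  assumes "infinite A" "A \<in> \<I>"
  shows "null_seq \<Lambda> \<I> (set_seq A)"
  unfolding null_seq_def
proof (intro conjI allI ballI)
  have A: "A \<subseteq> \<Lambda>" using assms(2) ideal_ground by blast
  show "set_seq A n \<subseteq> \<Lambda>" for n using A by (auto simp: set_seq_def)
  show "set_seq A n \<noteq> {}" for n using finite_Diff_set_seq[of A n] assms(1) by auto
  show "(\<Inter>n. set_seq A n) = {}" by (rule set_seq_escapes[OF A])
  \<comment> \<open>\<open>B - A\<close> is still positive, hence infinite, so term \<open>0\<close>
    is a witness.\<close>
  show "\<exists>n. infinite (B - set_seq A n)" if B: "B \<in> positive_sets \<Lambda> \<I>" for B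
    using positive_infinite[OF positive_Diff[OF B assms(2)]] by (intro exI[of _ 0]) simp
qed (rule decseq_set_seq)

lemma separated_set_seq:
  assumes "A \<subseteq> \<Lambda>" "decseq V" "finite (A \<inter> V n)"
  shows "separated V (set_seq A)"
proof -
  obtain m where m: "(A \<inter> V n) \<inter> set_seq A m = {}"
    using finite_escapes[OF decseq_set_seq set_seq_escapes assms(3)] assms(1) by blast
  have "V (max n m) \<subseteq> V n" "set_seq A (max n m) \<subseteq> set_seq A m"
    using decseqD[OF assms(2)] decseqD[OF decseq_set_seq] by auto
  moreover have "set_seq A m \<subseteq> A" by (auto simp: set_seq_def)
  ultimately have "V (max n m) \<inter> set_seq A (max n m) = {}" using m by blast
  then show ?thesis unfolding separated_def by blast
qed

text \<open>\<open>Pos\<close> is a notion of size, instantiated below by infinity and by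
  positivity. Some term of each \<open>V\<close> in turn is removed from \<open>Z\<close> while
  keeping \<open>Pos\<close>; a pseudo-intersection of the results meets a term of each
  \<open>V\<close> finitely, and is finally shrunk to an infinite member of
  \<open>\<I>\<close>.\<close>

lemma thin_set:
  assumes "countable \<V>" "Z \<subseteq> \<Lambda>" "Pos Z" and inf: "\<And>S. Pos S \<Longrightarrow> infinite S"
    and step: "\<And>V S. V \<in> \<V> \<Longrightarrow> S \<subseteq> Z \<Longrightarrow> Pos S \<Longrightarrow> \<exists>n. Pos (S - V n)"
  shows "\<exists>A\<subseteq>Z. infinite A \<and> A \<in> \<I> \<and> (\<forall>V\<in>\<V>. \<exists>n::nat. finite (A \<inter> V n))"
proof (cases "\<V> = {}")
  case True
  then show ?thesis using infinite_subset_in_ideal[OF assms(2) inf[OF assms(3)]] by blast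
next
  case False
  define v where "v = from_nat_into \<V>"
  have v: "v k \<in> \<V>" for k unfolding v_def by (rule from_nat_into[OF False])
  have "\<exists>S. \<forall>k. (S k \<subseteq> Z \<and> Pos (S k)) \<and> (\<exists>n. S (Suc k) = S k - v k n)"
  proof (rule dependent_nat_choice)
    show "\<exists>x. x \<subseteq> Z \<and> Pos x" using assms(3) by blast
    show "\<exists>y. (y \<subseteq> Z \<and> Pos y) \<and> (\<exists>n. y = x - v k n)" if "x \<subseteq> Z \<and> Pos x" for x k
      using step[OF v[of k], of x] that by blast
  qed
  then obtain S where S: "\<And>k. S k \<subseteq> Z" "\<And>k. Pos (S k)" "\<And>k. \<exists>n. S (Suc k) = S k - v k n" by blast
  have "finite (S (Suc k) - S k)" for k
  proof -
    have "S (Suc k) \<subseteq> S k" using S(3)[of k] by blast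
    then show ?thesis using Diff_eq_empty_iff finite.emptyI by metis
  qed
  then obtain Y where Y: "infinite Y" "Y \<subseteq> S 0" "\<And>k. finite (Y - S k)"
    using pseudo_intersection[of S] inf[OF S(2)] by blast
  have "Y \<subseteq> \<Lambda>" using Y(2) S(1) assms(2) by blast
  then obtain A where A: "A \<subseteq> Y" "infinite A" "A \<in> \<I>" using infinite_subset_in_ideal Y(1) by blast
  have "\<exists>n. finite (A \<inter> V n)" if V: "V \<in> \<V>" for V
  proof -
    obtain k where k: "V = v k" unfolding v_def using from_nat_into_surj[OF assms(1) V] by metis
    obtain n where "S (Suc k) = S k - v k n" using S(3) by blast
    then have "A \<inter> V n \<subseteq> Y - S (Suc k)" using A(1) k by blast
    then show ?thesis using Y(3) finite_subset by blast
  qed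
  then show ?thesis using A Y(2) S(1) by blast
qed

text \<open>
  If all \<open>S - V n\<close> were in the ideal, \<open>P\<^sup>-\<close> applied to \<open>S \<inter> V n\<close> would give a positive set
  converging to \<open>V\<close>.
\<close>

lemma P_minus_positive_Diff:
  assumes "P_minus \<Lambda> \<I>" "null_seq \<Lambda> \<I> V" "S \<in> positive_sets \<Lambda> \<I>"
  shows "\<exists>n. S - V n \<in> positive_sets \<Lambda> \<I>"
proof (rule ccontr)
  assume no: "\<not> ?thesis"
  have S: "S \<subseteq> \<Lambda>" using assms(3) by (simp add: positive_iff)
  have in_ideal: "S - V n \<in> \<I>" for n using no S by (auto simp: positive_iff)
  have dec: "decseq V" using assms(2) by (simp add: null_seq_def)
  have "S \<inter> V n \<in> positive_sets \<Lambda> \<I>" for n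
    using positive_Diff[OF assms(3) in_ideal[of n]] by (simp add: Diff_Diff_Int)
  moreover have "S \<inter> V (Suc n) \<subseteq> S \<inter> V n" for n using decseqD[OF dec, of n "Suc n"] by auto
  moreover have "S \<inter> V n - S \<inter> V (Suc n) \<in> \<I>" for n by (rule ideal_subset[OF in_ideal[of "Suc n"]]) auto
  ultimately obtain B where B: "B \<in> positive_sets \<Lambda> \<I>" "\<And>n. finite (B - S \<inter> V n)"
    using assms(1)[unfolded P_minus_def, rule_format, of "\<lambda>n. S \<inter> V n"] by blast
  obtain n where "infinite (B - V n)" using assms(2) B(1) by (auto simp: null_seq_def)
  moreover have "B - V n \<subseteq> B - S \<inter> V n" by blast
  ultimately show False using B(2) finite_subset by blast
qed

text \<open>Both instances of \<open>thin_set\<close> occur. Positive sets survive the removal of a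
  term by \<open>P_minus_positive_Diff\<close>; if no infinite subset of \<open>Z\<close> converges
  to \<open>V\<close>, every infinite \<open>S \<subseteq> Z\<close> keeps infinitely many points
  outside some \<open>V n\<close>.\<close>

lemma set_stage:
  assumes "countable \<V>" "\<And>V. V \<in> \<V> \<Longrightarrow> null_seq \<Lambda> \<I> V" "Z \<subseteq> \<Lambda>" "infinite Z"
    and none: "P_minus \<Lambda> \<I> \<and> Z \<in> positive_sets \<Lambda> \<I> \<or>
      \<not> (\<exists>V\<in>\<V>. \<exists>Y\<subseteq>Z. infinite Y \<and> set_conv Y V)"
  shows "\<exists>A\<subseteq>Z. infinite A \<and> A \<in> \<I> \<and> (\<forall>V\<in>\<V>. separated V (set_seq A))"
proof -
  have "\<exists>A\<subseteq>Z. infinite A \<and> A \<in> \<I> \<and> (\<forall>V\<in>\<V>. \<exists>n. finite (A \<inter> V n))"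
  proof (cases "P_minus \<Lambda> \<I> \<and> Z \<in> positive_sets \<Lambda> \<I>")
    case True
    then show ?thesis
      using P_minus_positive_Diff assms(2) positive_infinite
      by (intro thin_set[where Pos = "\<lambda>S. S \<in> positive_sets \<Lambda> \<I>", OF assms(1,3)]) auto
  next
    case False
    then have "\<exists>n. infinite (S - V n)" if "V \<in> \<V>" "S \<subseteq> Z" "infinite S" for V S
      using none that by (auto simp: set_conv_def)
    then show ?thesis by (intro thin_set[where Pos = infinite, OF assms(1,3,4)]) auto
  qed
  then obtain A where A: "A \<subseteq> Z" "infinite A" "A \<in> \<I>" "\<And>V. V \<in> \<V> \<Longrightarrow> \<exists>n. finite (A \<inter> V n)" by blast
  have "separated V (set_seq A)" if "V \<in> \<V>" for V
    using separated_set_seq[of A V] A(4)[OF that] assms(2)[OF that] A(3) ideal_ground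
    by (auto simp: null_seq_def)
  with A show ?thesis by blast
qed

text \<open>If \<open>f\<close> is not constant along \<open>D\<close> and converges to no old
  \<open>V\<close>, the images of the tails of a suitable \<open>E\<close> form the new sequence. It
  is null by the choice of \<open>D0\<close>, has empty intersection because \<open>f\<close>
  escapes every value along \<open>D\<close>, and is separated from \<open>\<V>\<close> by a
  diagonal choice of \<open>E\<close>.\<close>

lemma fun_stage:
  assumes "countable \<V>" "\<And>V. V \<in> \<V> \<Longrightarrow> null_seq \<Lambda> \<I> V" "f \<in> target \<rho> \<rightarrow> \<Lambda>"
  shows "\<exists>D. infinite D \<and> ((\<exists>c. \<forall>x\<in>val \<rho> D. f x = c) \<or> (\<exists>V\<in>\<V>. fun_conv \<rho> f D V) \<or>
    (\<exists>V. null_seq \<Lambda> \<I> V \<and> (\<forall>U\<in>\<V>. separated U V) \<and> fun_conv \<rho> f D V))"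
proof -
  obtain D0 where D0: "infinite D0"
    "\<forall>B\<in>positive_sets \<Lambda> \<I>. \<exists>K. finite K \<and> infinite (B - f ` val \<rho> (D0 - K))"
    using not_katetov_witness[OF assms(3)] by (elim exE conjE)
  obtain D where D: "infinite D" "D \<preceq> D0"
    "(\<exists>c. \<forall>x\<in>val \<rho> D. f x = c) \<or> (\<forall>c. \<exists>K. finite K \<and> c \<notin> f ` val \<rho> (D - K))"
    using dichotomy[OF D0(1), of f] by (elim exE conjE)
  show ?thesis
  proof (cases "(\<exists>c. \<forall>x\<in>val \<rho> D. f x = c) \<or> (\<exists>V\<in>\<V>. \<exists>E. infinite E \<and> fun_conv \<rho> f E V)")
    case True
    then show ?thesis using D(1) by blast
  next
    case False
    then have esc: "\<exists>K. finite K \<and> c \<notin> f ` val \<rho> (D - K)" for c using D(3) by blast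
    have "\<exists>E. infinite E \<and> E \<preceq> D \<and> (\<forall>V\<in>\<V>. \<exists>n K. finite K \<and> f ` val \<rho> (E - K) \<inter> V n = {})"
    proof (rule diagonal[OF assms(1) D(1)])
      fix V E A
      assume "\<exists>n K. finite K \<and> f ` val \<rho> (A - K) \<inter> V n = {}" "E \<preceq> A"
      then obtain n K where K: "finite K" "f ` val \<rho> (A - K) \<inter> V n = {}" by blast
      obtain L where "finite L" "val \<rho> (E - L) \<subseteq> val \<rho> (A - K)" using le_tail[OF \<open>E \<preceq> A\<close> K(1)] by blast
      then show "\<exists>n K. finite K \<and> f ` val \<rho> (E - K) \<inter> V n = {}" using K(2) by blast
    next
      fix V E
      assume V: "V \<in> \<V>" and E: "infinite E" "E \<preceq> D"
      show "\<exists>A. infinite A \<and> A \<preceq> E \<and> (\<exists>n K. finite K \<and> f ` val \<rho> (A - K) \<inter> V n = {})"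
      \<comment> \<open>If no refinement avoids a term of \<open>V\<close>, partition regularity
        sends \<open>f\<close> into each \<open>V n\<close> on a further refinement, and
        diagonalizing over \<open>n\<close> gives convergence to \<open>V\<close>, which is
        excluded.\<close>
      proof (rule ccontr)
        assume no: "\<not> ?thesis"
        have "\<exists>A. infinite A \<and> A \<preceq> E \<and> (\<forall>n\<in>UNIV. \<exists>K. finite K \<and> f ` val \<rho> (A - K) \<subseteq> V n)"
        proof (rule diagonal[OF _ E(1)])
          show "\<exists>K. finite K \<and> f ` val \<rho> (B - K) \<subseteq> V n"
            if "\<exists>K. finite K \<and> f ` val \<rho> (A - K) \<subseteq> V n" "B \<preceq> A" for n A B
            using that le_tail by (meson image_mono subset_trans)
          show "\<exists>A. infinite A \<and> A \<preceq> C \<and> (\<exists>K. finite K \<and> f ` val \<rho> (A - K) \<subseteq> V n)"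
            if C: "infinite C" "C \<preceq> E" for n C
          proof -
            obtain A where A: "infinite A" "A \<preceq> C" "val \<rho> A \<subseteq> f -` V n \<or> val \<rho> A \<inter> f -` V n = {}"
              using partition_regular[OF C(1)] by blast
            have "\<not> f ` val \<rho> (A - {}) \<inter> V n = {}" using no A le_trans[OF A(2) C(2)] by blast
            then have "f ` val \<rho> (A - {}) \<subseteq> V n" using A(3) by auto
            then show ?thesis using A by blast
          qed
        qed simp
        then show False using False V unfolding fun_conv_def by blast
      qed
    qed
    then obtain E where E: "infinite E" "E \<preceq> D"
      "\<forall>V\<in>\<V>. \<exists>n K. finite K \<and> f ` val \<rho> (E - K) \<inter> V n = {}" by (elim exE conjE)
    define W where "W n = f ` val \<rho> (E - {..<n})" for n
    have tail: "\<exists>n. W n \<subseteq> f ` val \<rho> (E - K)" if K: "finite K" for K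
    proof -
      obtain n where "K \<subseteq> {..<n}" using K finite_nat_iff_bounded by blast
      then have "W n \<subseteq> f ` val \<rho> (E - K)" unfolding W_def by (intro image_mono val_mono) auto
      then show ?thesis by blast
    qed
    have decW: "decseq W" unfolding decseq_def W_def by (auto intro!: image_mono val_mono)
    have "null_seq \<Lambda> \<I> W"
      unfolding null_seq_def
    proof (intro conjI allI ballI decW)
      show "W n \<subseteq> \<Lambda>" for n unfolding W_def using assms(3) val_subset by blast
      show "W n \<noteq> {}" for n
      proof -
        have "infinite (val \<rho> (E - {..<n}))" using E(1) by (intro infinite_val) simp
        then show ?thesis by (auto simp: W_def)
      qed
      have "\<exists>n. c \<notin> W n" for c
      proof -
        obtain K where K: "finite K" "c \<notin> f ` val \<rho> (D - K)" using esc by blast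
        then obtain L where "finite L" "val \<rho> (E - L) \<subseteq> val \<rho> (D - K)" using le_tail[OF E(2)] by blast
        then show ?thesis using tail[of L] K(2) by blast
      qed
      then show "(\<Inter>n. W n) = {}" by blast
      show "\<exists>n. infinite (B - W n)" if B: "B \<in> positive_sets \<Lambda> \<I>" for B
      proof -
        obtain K where K: "finite K" "infinite (B - f ` val \<rho> (D0 - K))" using bspec[OF D0(2) B] by blast
        obtain L where L: "finite L" "val \<rho> (E - L) \<subseteq> val \<rho> (D0 - K)"
          using le_tail[OF le_trans[OF E(2) D(2)] K(1)] by blast
        obtain n where "W n \<subseteq> f ` val \<rho> (E - L)" using tail[OF L(1)] by blast
        then have "B - f ` val \<rho> (D0 - K) \<subseteq> B - W n" using L(2) by blast
        then show ?thesis using K(2) finite_subset by blast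
      qed
    qed
    moreover have "separated U W" if U: "U \<in> \<V>" for U
    proof -
      obtain n K where K: "finite K" "f ` val \<rho> (E - K) \<inter> U n = {}" using bspec[OF E(3) U] by blast
      obtain m where m: "W m \<subseteq> f ` val \<rho> (E - K)" using tail[OF K(1)] by blast
      have "W (max m n) \<subseteq> W m" using decseqD[OF decW] by auto
      moreover have "decseq U" using assms(2)[OF U] by (simp add: null_seq_def)
      then have "U (max m n) \<subseteq> U n" by (rule decseqD) simp
      ultimately have "U (max m n) \<inter> W (max m n) = {}" using m K(2) by blast
      then show ?thesis by (auto simp: separated_def)
    qed
    moreover have "fun_conv \<rho> f E W" unfolding fun_conv_def W_def by blast
    ultimately show ?thesis using E(1) by blast
  qed
qed

end

section \<open>Recursion under the Continuum Hypothesis\<close>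

text \<open>A well-order of the reals of least possible type has initial segments of smaller
  cardinality, which CH forces to be countable.\<close>

lemma CH_wellorder:
  assumes "Continuum_Hypothesis"
  shows "\<exists>W :: real rel. wf W \<and> (\<forall>x y. x \<noteq> y \<longrightarrow> (x, y) \<in> W \<or> (y, x) \<in> W) \<and>
    (\<forall>x. countable {y. (y, x) \<in> W})"
proof -
  define r where "r = card_of (UNIV :: real set)"
  have wo: "well_order_on UNIV r" unfolding r_def by (rule card_of_well_order_on)
  have "wf (r - Id)" using wo by (simp add: well_order_on_def)
  moreover have "x \<noteq> y \<longrightarrow> (x, y) \<in> r - Id \<or> (y, x) \<in> r - Id" for x y
    using wo by (auto simp: well_order_on_def linear_order_on_def total_on_def)
  moreover have "countable {y. (y, x) \<in> r - Id}" for x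
  proof (rule ccontr)
    assume unc: "uncountable {y. (y, x) \<in> r - Id}"
    have "{y. (y, x) \<in> r - Id} = underS r x" by (auto simp: underS_def)
    moreover have "ordLess2 (card_of (underS r x)) r"
      unfolding r_def by (rule card_of_underS[OF card_of_Card_order]) (simp add: Field_card_of)
    ultimately have "ordLess2 (card_of {y. (y, x) \<in> r - Id}) (card_of (UNIV :: real set))"
      by (simp add: r_def)
    moreover have "{y. (y, x) \<in> r - Id} \<approx> (UNIV :: real set)"
      using assms unc by (auto simp: Continuum_Hypothesis_def)
    ultimately show False using not_ordLess_ordIso eqpoll_iff_card_of_ordIso by blast
  qed
  ultimately show ?thesis by blast
qed

section \<open>Counting the tasks of the recursion\<close>

lemma countable_Pow_lepoll_real:
  assumes "countable C"
  shows "Pow C \<lesssim> (UNIV :: real set)"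
proof -
  have "inj_on (image (to_nat_on C)) (Pow C)"
    using assms by (intro inj_on_image_Pow inj_on_to_nat_on)
  then have "Pow C \<lesssim> (UNIV :: nat set set)" by (auto simp: lepoll_def)
  then show ?thesis using nat_sets_eqpoll_reals lepoll_trans2 by blast
qed

lemma Pow_Plus_Pow_lepoll_real:
  assumes "countable A" "countable B"
  shows "Pow A <+> Pow B \<lesssim> (UNIV :: real set)"
proof -
  \<comment> \<open>The element \<open>None\<close> marks subsets of the second summand and so keeps
    the two copies of the empty set apart.\<close>
  let ?h = "case_sum (\<lambda>S. Some ` Inl ` S) (\<lambda>S. insert None (Some ` Inr ` S))"
  let ?C = "insert None (Some ` (A <+> B))"
  have "inj_on ?h (Pow A <+> Pow B)"
    by (rule inj_onI) (auto simp: image_iff set_eq_iff split: sum.splits; blast)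
  moreover have "?h ` (Pow A <+> Pow B) \<subseteq> Pow ?C" by (auto intro!: imageI InlI InrI)
  ultimately have "Pow A <+> Pow B \<lesssim> Pow ?C" unfolding lepoll_def by blast
  moreover have "Pow ?C \<lesssim> (UNIV :: real set)"
    using assms by (intro countable_Pow_lepoll_real) auto
  ultimately show ?thesis by (rule lepoll_trans)
qed

lemma PiE_lepoll_Pow: "(A \<rightarrow>\<^sub>E B) \<lesssim> Pow (A \<times> B)"
proof -
  let ?h = "\<lambda>f. (\<lambda>x. (x, f x)) ` A"
  have "inj_on ?h (A \<rightarrow>\<^sub>E B)"
  proof (rule inj_onI)
    fix f g assume fg: "f \<in> A \<rightarrow>\<^sub>E B" "g \<in> A \<rightarrow>\<^sub>E B" and eq: "?h f = ?h g"
    have "f x = g x" if "x \<in> A" for x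
    proof -
      have "(x, f x) \<in> ?h g" using that eq[symmetric] by blast
      then show ?thesis by blast
    qed
    then show "f = g" using fg by (intro PiE_ext)
  qed
  moreover have "?h ` (A \<rightarrow>\<^sub>E B) \<subseteq> Pow (A \<times> B)" by (auto simp: PiE_def)
  ultimately show ?thesis unfolding lepoll_def by blast
qed

section \<open>Tasks and the transfinite recursion\<close>

context non_katetov
begin

text \<open>The first clause excludes convergence to the point at infinity in the general example.
  The second, for \<open>P_minus\<close> ideals, makes positive sets meet the almost disjoint family
  read off from \<open>\<V>\<close>.\<close>

definition set_solved :: "(nat \<Rightarrow> 'l set) set \<Rightarrow> 'l set \<Rightarrow> bool" where
  "set_solved \<V> Z \<longleftrightarrow> (Z \<subseteq> \<Lambda> \<and> infinite Z \<longrightarrow>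
     (\<exists>V\<in>\<V>. \<exists>Y\<subseteq>Z. infinite Y \<and> set_conv Y V) \<and>
     (P_minus \<Lambda> \<I> \<and> Z \<in> positive_sets \<Lambda> \<I> \<longrightarrow>
        (\<exists>A\<in>\<I>. infinite A \<and> set_seq A \<in> \<V> \<and> infinite (Z \<inter> A))))"

definition fun_solved :: "(nat \<Rightarrow> 'l set) set \<Rightarrow> ('t \<Rightarrow> 'l) \<Rightarrow> bool" where
  "fun_solved \<V> f \<longleftrightarrow> (f \<in> target \<rho> \<rightarrow> \<Lambda> \<longrightarrow>
     (\<exists>D. infinite D \<and> ((\<exists>c. \<forall>x\<in>val \<rho> D. f x = c) \<or> (\<exists>V\<in>\<V>. fun_conv \<rho> f D V))))"

lemma solved_mono:
  assumes "\<U> \<subseteq> \<V>"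
  shows "set_solved \<U> Z \<Longrightarrow> set_solved \<V> Z" "fun_solved \<U> f \<Longrightarrow> fun_solved \<V> f"
  using assms unfolding set_solved_def fun_solved_def by (meson subsetD)+

text \<open>At most one sequence is added per task, and \<open>None\<close> records that there is
  none. A positive \<open>Z\<close> under \<open>P_minus\<close> receives a new set inside
  \<open>Z\<close> in any case.\<close>

lemma set_solved_stage:
  assumes "countable \<V>" "\<And>V. V \<in> \<V> \<Longrightarrow> null_seq \<Lambda> \<I> V"
  shows "\<exists>r. (\<forall>V\<in>set_option r. null_seq \<Lambda> \<I> V \<and> (\<forall>U\<in>\<V>. separated U V)) \<and>
    set_solved (\<V> \<union> set_option r) Z"
proof (cases "Z \<subseteq> \<Lambda> \<and> infinite Z \<and> (P_minus \<Lambda> \<I> \<and> Z \<in> positive_sets \<Lambda> \<I> \<or>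
      \<not> (\<exists>V\<in>\<V>. \<exists>Y\<subseteq>Z. infinite Y \<and> set_conv Y V))")
  case True
  then have "Z \<subseteq> \<Lambda>" "infinite Z" and none: "P_minus \<Lambda> \<I> \<and> Z \<in> positive_sets \<Lambda> \<I> \<or>
      \<not> (\<exists>V\<in>\<V>. \<exists>Y\<subseteq>Z. infinite Y \<and> set_conv Y V)" by simp_all
  have "\<exists>A\<subseteq>Z. infinite A \<and> A \<in> \<I> \<and> (\<forall>V\<in>\<V>. separated V (set_seq A))"
    using assms(2) by (rule set_stage[OF assms(1) _ \<open>Z \<subseteq> \<Lambda>\<close> \<open>infinite Z\<close> none])
  then obtain A where A: "A \<subseteq> Z" "infinite A" "A \<in> \<I>" "\<forall>V\<in>\<V>. separated V (set_seq A)"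
    by (elim exE conjE)
  have "set_conv A (set_seq A)" using finite_Diff_set_seq by (simp add: set_conv_def)
  moreover have "infinite (Z \<inter> A)" using A by (simp add: Int_absorb1)
  ultimately have "set_solved (\<V> \<union> set_option (Some (set_seq A))) Z"
    unfolding set_solved_def using A(1-3) by auto
  then show ?thesis using null_seq_set_seq A(2-4) by (intro exI[of _ "Some (set_seq A)"]) auto
next
  case False
  then have "set_solved (\<V> \<union> set_option None) Z" by (auto simp: set_solved_def)
  then show ?thesis by (intro exI[of _ None]) auto
qed

lemma fun_solved_stage:
  assumes "countable \<V>" "\<And>V. V \<in> \<V> \<Longrightarrow> null_seq \<Lambda> \<I> V"
  shows "\<exists>r. (\<forall>V\<in>set_option r. null_seq \<Lambda> \<I> V \<and> (\<forall>U\<in>\<V>. separated U V)) \<and>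
    fun_solved (\<V> \<union> set_option r) f"
proof (cases "fun_solved \<V> f")
  case True
  then show ?thesis by (intro exI[of _ None]) auto
next
  case False
  then have "f \<in> target \<rho> \<rightarrow> \<Lambda>" by (auto simp: fun_solved_def)
  from fun_stage[OF assms this] obtain D where D: "infinite D"
    "(\<exists>c. \<forall>x\<in>val \<rho> D. f x = c) \<or> (\<exists>V\<in>\<V>. fun_conv \<rho> f D V) \<or>
    (\<exists>V. null_seq \<Lambda> \<I> V \<and> (\<forall>U\<in>\<V>. separated U V) \<and> fun_conv \<rho> f D V)" by blast
  then obtain V where V: "null_seq \<Lambda> \<I> V" "\<forall>U\<in>\<V>. separated U V" "fun_conv \<rho> f D V"
    using False by (auto simp: fun_solved_def)
  have "fun_solved (\<V> \<union> set_option (Some V)) f" unfolding fun_solved_def using D(1) V(3) by auto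
  then show ?thesis using V by (intro exI[of _ "Some V"]) auto
qed

lemma separated_sym: "separated U V \<longleftrightarrow> separated V U"
  by (auto simp: separated_def Int_commute)

text \<open>At stage \<open>x\<close> of the recursion along the well-order only countably many
  sequences precede, so the stage lemmas solve the task of \<open>x\<close> with at most one
  sequence, separated from the old ones. Two sequences of the final family were separated at the
  later of their stages, and a solved task stays solved by \<open>solved_mono\<close>.\<close>

lemma solving_family:
  assumes CH: "Continuum_Hypothesis"
  shows "\<exists>\<V>. (\<forall>V\<in>\<V>. null_seq \<Lambda> \<I> V) \<and> (\<forall>U\<in>\<V>. \<forall>V\<in>\<V>. U \<noteq> V \<longrightarrow> separated U V) \<and>
    (\<forall>Z. set_solved \<V> Z) \<and> (\<forall>f. fun_solved \<V> f) \<and> \<V> \<lesssim> (UNIV :: real set)"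
proof -
  obtain W :: "real rel" where W: "wf W" "\<And>x y. x \<noteq> y \<Longrightarrow> (x, y) \<in> W \<or> (y, x) \<in> W"
    "\<And>x. countable {y. (y, x) \<in> W}" using CH_wellorder[OF CH] by blast
  let ?T = "Pow \<Lambda> <+> (target \<rho> \<rightarrow>\<^sub>E \<Lambda>)"
  have "?T \<lesssim> Pow \<Lambda> <+> Pow (target \<rho> \<times> \<Lambda>)"
    by (rule sum_lepoll_mono[OF lepoll_refl PiE_lepoll_Pow])
  also have "\<dots> \<lesssim> (UNIV :: real set)"
    using countable_ground countable_target by (intro Pow_Plus_Pow_lepoll_real) auto
  \<comment> \<open>Functions count only through their values on the countable target, so there are
    at most continuum many tasks and the reals can enumerate them.\<close>
  finally obtain task :: "real \<Rightarrow> 'l set + ('t \<Rightarrow> 'l)" where task: "?T \<subseteq> range task"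
    by (auto simp: lepoll_iff)
  define solved where "solved \<V> = case_sum (set_solved \<V>) (fun_solved \<V>)" for \<V>
  define old where "old F x = {V. \<exists>y. (y, x) \<in> W \<and> F y = Some V}"
    for F :: "real \<Rightarrow> (nat \<Rightarrow> 'l set) option" and x
  define P where "P F x r \<longleftrightarrow> (\<forall>V\<in>set_option r. null_seq \<Lambda> \<I> V \<and> (\<forall>U\<in>old F x. separated U V)) \<and>
      solved (old F x \<union> set_option r) (task x)" for F x r
  have "\<exists>F. \<forall>x. P F x (F x)"
  proof (rule dependent_wf_choice[OF W(1)])
    show "P F x r = P G x r" if "\<And>z. (z, x) \<in> W \<Longrightarrow> F z = G z" for F G x r
    proof -
      have "old F x = old G x" unfolding old_def using that by auto
      then show ?thesis by (simp add: P_def)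
    qed
    show "\<exists>r. P F x r" if F: "\<And>y. (y, x) \<in> W \<Longrightarrow> P F y (F y)" for x F
    proof -
      have "old F x \<subseteq> (\<lambda>y. the (F y)) ` {y. (y, x) \<in> W}" by (force simp: old_def)
      then have "countable (old F x)" by (rule countable_subset[OF _ countable_image[OF W(3)]])
      moreover have "null_seq \<Lambda> \<I> V" if "V \<in> old F x" for V
        using that F by (auto simp: old_def P_def)
      ultimately show ?thesis
        unfolding P_def solved_def
        using set_solved_stage[of "old F x"] fun_solved_stage[of "old F x"] by (cases "task x") simp_all
    qed
  qed
  then obtain F where F: "\<And>x. P F x (F x)" by blast
  define \<V> where "\<V> = {V. \<exists>x. F x = Some V}"
  have null: "null_seq \<Lambda> \<I> V" if "V \<in> \<V>" for V using that F by (auto simp: \<V>_def P_def)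
  have "separated U V" if UV: "U \<in> \<V>" "V \<in> \<V>" "U \<noteq> V" for U V
  proof -
    obtain x y where xy: "F x = Some U" "F y = Some V" using UV by (auto simp: \<V>_def)
    then have "x \<noteq> y" using UV(3) by auto
    then consider "(x, y) \<in> W" | "(y, x) \<in> W" using W(2) by blast
    then show ?thesis
    proof cases
      case 1
      then have "U \<in> old F y" using xy by (auto simp: old_def)
      then show ?thesis using F[of y] xy by (simp add: P_def)
    next
      case 2
      then have "V \<in> old F x" using xy by (auto simp: old_def)
      then show ?thesis using F[of x] xy separated_sym by (auto simp: P_def)
    qed
  qed
  moreover have solved: "solved \<V> (task x)" for x
  proof -
    have sub: "old F x \<union> set_option (F x) \<subseteq> \<V>" by (auto simp: old_def \<V>_def)
    have "solved (old F x \<union> set_option (F x)) (task x)" using F[of x] by (simp add: P_def)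
    then show ?thesis unfolding solved_def using solved_mono[OF sub] by (cases "task x") simp_all
  qed
  moreover have "set_solved \<V> Z" for Z
  proof (cases "Z \<subseteq> \<Lambda>")
    case True
    then have "Inl Z \<in> range task" by (intro subsetD[OF task] InlI PowI)
    then obtain x where "task x = Inl Z" by (metis rangeE)
    then show ?thesis using solved[of x] by (simp add: solved_def)
  qed (simp add: set_solved_def)
  moreover have "fun_solved \<V> f" for f
  proof (cases "f \<in> target \<rho> \<rightarrow> \<Lambda>")
    case True
    \<comment> \<open>Only restricted functions are tasks; \<open>f\<close> and \<open>g\<close>
      agree on all values of \<open>\<rho>\<close>, so a solution for \<open>g\<close> solves
      \<open>f\<close>.\<close>
    define g where "g = restrict f (target \<rho>)"
    have "g \<in> target \<rho> \<rightarrow>\<^sub>E \<Lambda>" using True by (auto simp: g_def)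
    then have "Inr g \<in> range task" by (intro subsetD[OF task] InrI)
    then obtain x where "task x = Inr g" by (metis rangeE)
    then have "fun_solved \<V> g" using solved[of x] by (simp add: solved_def)
    moreover have "g \<in> target \<rho> \<rightarrow> \<Lambda>" using True by (auto simp: g_def)
    ultimately obtain D where D: "infinite D" "(\<exists>c. \<forall>x\<in>val \<rho> D. g x = c) \<or> (\<exists>V\<in>\<V>. fun_conv \<rho> g D V)"
      by (auto simp: fun_solved_def)
    have gf: "g x = f x" if "x \<in> val \<rho> E" for x E using that val_subset by (auto simp: g_def)
    then have "g ` val \<rho> E = f ` val \<rho> E" for E by (intro image_cong) auto
    then have "(\<exists>c. \<forall>x\<in>val \<rho> D. f x = c) \<or> (\<exists>V\<in>\<V>. fun_conv \<rho> f D V)"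
      using D(2) gf by (auto simp: fun_conv_def)
    then show ?thesis using D(1) by (auto simp: fun_solved_def)
  qed (simp add: fun_solved_def)
  moreover have "\<V> \<lesssim> (UNIV :: real set)"
  proof -
    have "\<V> \<subseteq> (\<lambda>x. the (F x)) ` UNIV"
      unfolding \<V>_def by (auto simp: image_iff) (metis option.sel)
    then show ?thesis by (rule subset_image_lepoll)
  qed
  ultimately show ?thesis using null by (intro exI[of _ \<V>]) simp
qed

end

section \<open>The example for arbitrary ideals\<close>

definition converges_along ::
  "(nat, 't) set_fun \<Rightarrow> 'x topology \<Rightarrow> ('t \<Rightarrow> 'x) \<Rightarrow> nat set \<Rightarrow> 'x \<Rightarrow> bool" where
  "converges_along \<rho> X f D x \<longleftrightarrow>
     (\<forall>U. openin X U \<and> x \<in> U \<longrightarrow> (\<exists>K. finite K \<and> f ` val \<rho> (D - K) \<subseteq> U))"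

lemma rho_space_iff:
  "rho_space \<rho> X \<longleftrightarrow> (\<forall>f. f \<in> target \<rho> \<rightarrow> topspace X \<longrightarrow>
     (\<exists>D x. infinite D \<and> x \<in> topspace X \<and> converges_along \<rho> X f D x))"
  by (simp add: rho_space_def converges_along_def)

text \<open>Arbitrary \<open>f\<close> are reduced to functions \<open>g\<close> into
  \<open>\<Lambda>\<close>. If \<open>g\<close> escapes every value, \<open>f\<close> agrees with
  \<open>j\<close> after \<open>g\<close> on a tail and converges with it. If \<open>g\<close> is
  constant on \<open>val \<rho> D\<close>, then \<open>f\<close> takes there at most one value
  outside \<open>R\<close>; by \<open>dichotomy\<close> it is constant on a refinement or escapes
  every value, and in the latter case converges to \<open>p\<close>.\<close>

lemma (in refinable_set_fun) rho_space_criterion: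
  fixes \<Lambda> :: "'l set"
  assumes inj: "inj_on j \<Lambda>" and top: "topspace X = j ` \<Lambda> \<union> R"
    and l0: "l0 \<in> \<Lambda>" and p: "p \<in> R" and cofinite: "\<And>U. openin X U \<Longrightarrow> p \<in> U \<Longrightarrow> finite (R - U)"
    and solve: "\<And>g. g \<in> target \<rho> \<rightarrow> \<Lambda> \<Longrightarrow> \<exists>D. infinite D \<and> ((\<exists>c. \<forall>x\<in>val \<rho> D. g x = c) \<or>
        (\<forall>c. \<exists>K. finite K \<and> c \<notin> g ` val \<rho> (D - K)) \<and>
        (\<exists>x\<in>topspace X. converges_along \<rho> X (\<lambda>t. j (g t)) D x))"
  shows "rho_space \<rho> X"
  unfolding rho_space_iff
proof (intro allI impI)
  fix f assume f: "f \<in> target \<rho> \<rightarrow> topspace X"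
  \<comment> \<open>Values in the remainder \<open>R\<close> are replaced by the dummy
    \<open>l0\<close>; where \<open>g\<close> differs from \<open>l0\<close>, \<open>f\<close> must
    lie in the image of \<open>j\<close>.\<close>
  define g where "g t = (if f t \<in> j ` \<Lambda> then inv_into \<Lambda> j (f t) else l0)" for t
  have "g \<in> target \<rho> \<rightarrow> \<Lambda>" using l0 by (auto simp: g_def inv_into_into)
  from solve[OF this] obtain D where D: "infinite D" "(\<exists>c. \<forall>x\<in>val \<rho> D. g x = c) \<or>
        (\<forall>c. \<exists>K. finite K \<and> c \<notin> g ` val \<rho> (D - K)) \<and>
        (\<exists>x\<in>topspace X. converges_along \<rho> X (\<lambda>t. j (g t)) D x)" by (elim exE conjE)
  have jg: "f t = j (g t)" if "f t \<in> j ` \<Lambda>" for t using that by (simp add: g_def f_inv_into_f)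
  from D(2) show "\<exists>D x. infinite D \<and> x \<in> topspace X \<and> converges_along \<rho> X f D x"
  proof (elim disjE exE conjE bexE)
    fix x assume esc: "\<forall>c. \<exists>K. finite K \<and> c \<notin> g ` val \<rho> (D - K)" and x: "x \<in> topspace X"
      and conv: "converges_along \<rho> X (\<lambda>t. j (g t)) D x"
    obtain K where K: "finite K" "l0 \<notin> g ` val \<rho> (D - K)" using esc by blast
    have eq: "f t = j (g t)" if "t \<in> val \<rho> (D - K)" for t
    proof -
      have "g t \<noteq> l0" using K(2) that by blast
      then show ?thesis by (intro jg) (auto simp: g_def split: if_splits)
    qed
    have "converges_along \<rho> X f (D - K) x"
      unfolding converges_along_def
    proof (intro allI impI)
      fix U assume "openin X U \<and> x \<in> U"
      then obtain L where L: "finite L" "(\<lambda>t. j (g t)) ` val \<rho> (D - L) \<subseteq> U"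
        using conv by (auto simp: converges_along_def)
      have "val \<rho> (D - K - L) \<subseteq> val \<rho> (D - K)" "val \<rho> (D - K - L) \<subseteq> val \<rho> (D - L)"
        by (rule val_mono, blast)+
      then have "f ` val \<rho> (D - K - L) \<subseteq> U" using L(2) eq by fastforce
      then show "\<exists>L. finite L \<and> f ` val \<rho> (D - K - L) \<subseteq> U" using L(1) by blast
    qed
    moreover have "infinite (D - K)" using D(1) K(1) by (simp add: Diff_infinite_finite)
    ultimately show ?thesis using x by blast
  next
    fix c assume c: "\<forall>x\<in>val \<rho> D. g x = c"
    have fD: "f t \<in> insert (j c) R" if "t \<in> val \<rho> D" for t
    proof (cases "f t \<in> j ` \<Lambda>")
      case True
      then show ?thesis using jg[OF True] bspec[OF c that] by simp
    next
      case False
      then show ?thesis using f top val_subset that by blast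
    qed
    obtain E where E: "infinite E" "E \<preceq> D" "(\<exists>c. \<forall>x\<in>val \<rho> E. f x = c) \<or>
        (\<forall>c. \<exists>K. finite K \<and> c \<notin> f ` val \<rho> (E - K))"
      using dichotomy[OF D(1), of f] by (elim exE conjE)
    from E(3) show ?thesis
    proof (elim disjE exE)
      fix y assume y: "\<forall>x\<in>val \<rho> E. f x = y"
      have "val \<rho> E \<noteq> {}" using infinite_val[OF E(1)] by auto
      then have "y \<in> topspace X" using y f val_subset by fastforce
      moreover have "converges_along \<rho> X f E y"
        unfolding converges_along_def using y by (auto intro!: exI[of _ "{}"])
      ultimately show ?thesis using E(1) by blast
    next
      assume esc: "\<forall>c. \<exists>K. finite K \<and> c \<notin> f ` val \<rho> (E - K)"
      have "converges_along \<rho> X f E p"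
        unfolding converges_along_def
      proof (intro allI impI)
        fix U assume U: "openin X U \<and> p \<in> U"
        obtain L where L: "finite L" "val \<rho> (E - L) \<subseteq> val \<rho> (D - {})"
          using le_tail[OF E(2) finite.emptyI] by blast
        obtain k where k: "\<And>c. finite (k c)" "\<And>c. c \<notin> f ` val \<rho> (E - k c)" using esc by metis
        \<comment> \<open>Inside \<open>D\<close>, all values of \<open>f\<close> outside
          \<open>U\<close> belong to this finite set, and each of its elements can be
          escaped.\<close>
        define S where "S = insert (j c) (R - U)"
        define K where "K = L \<union> (\<Union>y\<in>S. k y)"
        have fK: "finite K" using L(1) k(1) cofinite U by (auto simp: K_def S_def)
        have "f t \<in> U" if t: "t \<in> val \<rho> (E - K)" for t
        proof (rule ccontr)
          assume "f t \<notin> U"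
          have "val \<rho> (E - K) \<subseteq> val \<rho> (E - L)" by (rule val_mono) (auto simp: K_def)
          then have "t \<in> val \<rho> D" using t L(2) by auto
          then have "f t \<in> S" using fD \<open>f t \<notin> U\<close> by (auto simp: S_def)
          then have "val \<rho> (E - K) \<subseteq> val \<rho> (E - k (f t))" by (intro val_mono) (auto simp: K_def)
          then show False using k(2)[of "f t"] t by blast
        qed
        then show "\<exists>K. finite K \<and> f ` val \<rho> (E - K) \<subseteq> U" using fK by blast
      qed
      then show ?thesis using E(1) p top by blast
    qed
  qed
qed

text \<open>Convergence along \<open>D\<close> of \<open>f\<close> after the Katetov map passes to
  the positive set \<open>B\<close> assigned to \<open>D\<close>: for each neighbourhood the
  exceptional points of \<open>B\<close> lie in a finite \<open>L\<close>.\<close>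

lemma (in refinable_set_fun) katetov_le_FinBW:
  assumes "rho_ideal \<Lambda> \<I> \<le>\<^sub>K \<rho>" "rho_space \<rho> X"
  shows "X \<in> FinBW \<Lambda> \<I>"
  unfolding FinBW_def
proof (intro CollectI allI impI)
  fix f assume f: "f \<in> \<Lambda> \<rightarrow> topspace X"
  obtain \<phi> where \<phi>: "\<phi> \<in> target \<rho> \<rightarrow> \<Lambda>" and k: "\<And>D. infinite D \<Longrightarrow> \<exists>B\<in>positive_sets \<Lambda> \<I>.
      \<forall>K. finite K \<longrightarrow> (\<exists>L. L \<subseteq> \<Lambda> \<and> finite L \<and> B - L \<subseteq> \<phi> ` val \<rho> (D - K))"
    using assms(1) unfolding katetov_le_def family_eq ground_eq by (auto simp: rho_ideal_def)
  have "(\<lambda>t. f (\<phi> t)) \<in> target \<rho> \<rightarrow> topspace X" using f \<phi> by blast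
  then obtain D x where D: "infinite D" "x \<in> topspace X" "converges_along \<rho> X (\<lambda>t. f (\<phi> t)) D x"
    using assms(2) unfolding rho_space_iff by blast
  obtain B where B: "B \<in> positive_sets \<Lambda> \<I>"
    "\<And>K. finite K \<Longrightarrow> \<exists>L. L \<subseteq> \<Lambda> \<and> finite L \<and> B - L \<subseteq> \<phi> ` val \<rho> (D - K)" using k[OF D(1)] by blast
  have "finite {a\<in>B. f a \<notin> U}" if U: "openin X U \<and> x \<in> U" for U
  proof -
    obtain K where K: "finite K" "(\<lambda>t. f (\<phi> t)) ` val \<rho> (D - K) \<subseteq> U"
      using D(3) U by (auto simp: converges_along_def)
    obtain L where L: "finite L" "B - L \<subseteq> \<phi> ` val \<rho> (D - K)" using B(2)[OF K(1)] by blast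
    have "{a\<in>B. f a \<notin> U} \<subseteq> L" using L(2) K(2) by auto
    then show ?thesis using L(1) finite_subset by blast
  qed
  then show "\<exists>A\<in>positive_sets \<Lambda> \<I>. \<exists>x\<in>topspace X. \<forall>U. openin X U \<and> x \<in> U \<longrightarrow> finite {a\<in>A. f a \<notin> U}"
    by (intro bexI[OF _ B(1)] bexI[OF _ D(2)]) simp
qed

lemma FinBW_D:
  assumes "X \<in> FinBW \<Lambda> \<I>" "f \<in> \<Lambda> \<rightarrow> topspace X"
  obtains B x where "B \<in> positive_sets \<Lambda> \<I>" "x \<in> topspace X"
    "\<And>U. openin X U \<Longrightarrow> x \<in> U \<Longrightarrow> finite {a\<in>B. f a \<notin> U}"
proof -
  have "\<exists>A\<in>positive_sets \<Lambda> \<I>. \<exists>x\<in>topspace X. \<forall>U. openin X U \<and> x \<in> U \<longrightarrow> finite {a\<in>A. f a \<notin> U}"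
    using assms by (simp add: FinBW_def)
  then obtain B x where "B \<in> positive_sets \<Lambda> \<I>" "x \<in> topspace X"
    "\<forall>U. openin X U \<and> x \<in> U \<longrightarrow> finite {a\<in>B. f a \<notin> U}" by (elim bexE)
  then show thesis using that[of B x] by (metis (no_types, lifting))
qed

lemma separable_spaceI:
  assumes "countable C" "C \<subseteq> topspace X" "\<And>U. openin X U \<Longrightarrow> U \<noteq> {} \<Longrightarrow> C \<inter> U \<noteq> {}"
  shows "separable_space X"
  unfolding separable_space_def dense_intersects_open using assms by (intro exI[of _ C]) simp

text \<open>This is used to let a null sequence leave the part of \<open>Phi_space\<close> that a
  neighbourhood of infinity misses.\<close>

lemma finite_family_escapes:
  assumes "decseq V" "finite \<S>" "\<And>S. S \<in> \<S> \<Longrightarrow> \<exists>n. S \<inter> V n = {}"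
  shows "\<exists>n::nat. \<forall>S\<in>\<S>. S \<inter> V n = {}"
proof -
  obtain m where m: "\<And>S. S \<in> \<S> \<Longrightarrow> S \<inter> V (m S) = {}" using assms(3) by metis
  have "S \<inter> V (Max (insert 0 (m ` \<S>))) = {}" if "S \<in> \<S>" for S
  proof -
    have "m S \<le> Max (insert 0 (m ` \<S>))" using that assms(2) by (intro Max_ge) auto
    then show ?thesis using m[OF that] decseqD[OF assms(1)] by blast
  qed
  then show ?thesis by blast
qed

section \<open>The topology on points, null sequences and infinity\<close>

text \<open>
  The members of \<open>\<V>\<close> become points; \<open>code\<close> only serves to fit them into the type \<open>'l set\<close>.
  Neighbourhoods of the extra point \<open>None\<close> miss finitely many of these points, but otherwise only
  have to be neighbourhoods of the points they contain. So no sequence in \<open>\<Lambda>\<close> converges both to \<open>None\<close>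
  and to another point, although \<open>None\<close> need not be separated from the points of \<open>\<V>\<close> by open sets.
\<close>

locale nbhd_system =
  fixes \<Lambda> :: "'l set" and \<V> :: "(nat \<Rightarrow> 'l set) set" and code :: "(nat \<Rightarrow> 'l set) \<Rightarrow> 'l set"
  assumes nbhd_subset: "V \<in> \<V> \<Longrightarrow> V n \<subseteq> \<Lambda>"
    and nbhd_nonempty: "V \<in> \<V> \<Longrightarrow> V n \<noteq> {}"
    and nbhd_dec: "V \<in> \<V> \<Longrightarrow> decseq V"
    and nbhd_Inter: "V \<in> \<V> \<Longrightarrow> (\<Inter>n. V n) = {}"
    and nbhd_separated: "U \<in> \<V> \<Longrightarrow> V \<in> \<V> \<Longrightarrow> U \<noteq> V \<Longrightarrow> separated U V"
    and inj_code: "inj_on code \<V>"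
begin

definition j :: "'l \<Rightarrow> ('l + 'l set) option" where
  "j a = Some (Inl a)"

definition pt :: "(nat \<Rightarrow> 'l set) \<Rightarrow> ('l + 'l set) option" where
  "pt V = Some (Inr (code V))"

definition carr :: "('l + 'l set) option set" where
  "carr = j ` \<Lambda> \<union> pt ` \<V> \<union> {None}"

definition nbhd_space :: "('l + 'l set) option topology" where
  "nbhd_space = topology (\<lambda>U. U \<subseteq> carr \<and> (\<forall>V\<in>\<V>. pt V \<in> U \<longrightarrow> (\<exists>n. j ` V n \<subseteq> U)) \<and>
     (None \<in> U \<longrightarrow> finite {V\<in>\<V>. pt V \<notin> U}))"

lemma point_simps [simp]: "j a = j b \<longleftrightarrow> a = b" "j a \<noteq> pt V" "pt V \<noteq> j a" "j a \<noteq> None" "pt V \<noteq> None"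
  "None \<noteq> j a" "None \<noteq> pt V"
  by (auto simp: j_def pt_def)

lemma pt_eq [simp]: "U \<in> \<V> \<Longrightarrow> V \<in> \<V> \<Longrightarrow> pt U = pt V \<longleftrightarrow> U = V"
  using inj_code by (auto simp: pt_def inj_on_def)

lemma nbhd_mono: "V \<in> \<V> \<Longrightarrow> m \<le> n \<Longrightarrow> V n \<subseteq> V m"
  using nbhd_dec by (auto dest: decseqD)

lemma openin_nbhd_space:
  "openin nbhd_space U \<longleftrightarrow> U \<subseteq> carr \<and> (\<forall>V\<in>\<V>. pt V \<in> U \<longrightarrow> (\<exists>n. j ` V n \<subseteq> U)) \<and>
     (None \<in> U \<longrightarrow> finite {V\<in>\<V>. pt V \<notin> U})"
proof -
  let ?O = "\<lambda>U. U \<subseteq> carr \<and> (\<forall>V\<in>\<V>. pt V \<in> U \<longrightarrow> (\<exists>n. j ` V n \<subseteq> U)) \<and>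
     (None \<in> U \<longrightarrow> finite {V\<in>\<V>. pt V \<notin> U})"
  have "istopology ?O"
    unfolding istopology_def
  proof (rule conjI; intro allI impI)
    fix S T assume OS: "?O S" and OT: "?O T"
    then have carr: "S \<subseteq> carr" by (elim conjE)
    from OS have S: "\<forall>V\<in>\<V>. pt V \<in> S \<longrightarrow> (\<exists>n. j ` V n \<subseteq> S)" "None \<in> S \<longrightarrow> finite {V\<in>\<V>. pt V \<notin> S}"
      by simp_all
    from OT have T: "\<forall>V\<in>\<V>. pt V \<in> T \<longrightarrow> (\<exists>n. j ` V n \<subseteq> T)" "None \<in> T \<longrightarrow> finite {V\<in>\<V>. pt V \<notin> T}"
      by simp_all
    show "?O (S \<inter> T)"
    proof (intro conjI ballI impI)
      show "S \<inter> T \<subseteq> carr" using carr by blast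
      show "\<exists>n. j ` V n \<subseteq> S \<inter> T" if V: "V \<in> \<V>" "pt V \<in> S \<inter> T" for V
      proof -
        obtain m n where "j ` V m \<subseteq> S" "j ` V n \<subseteq> T" using S(1) T(1) V by blast
        moreover have "V (max m n) \<subseteq> V m" "V (max m n) \<subseteq> V n"
          using nbhd_mono[OF V(1)] by simp_all
        ultimately have "j ` V (max m n) \<subseteq> S \<inter> T" by blast
        then show ?thesis by blast
      qed
      assume "None \<in> S \<inter> T"
      then have "finite ({V\<in>\<V>. pt V \<notin> S} \<union> {V\<in>\<V>. pt V \<notin> T})" using S(2) T(2) by simp
      then show "finite {V\<in>\<V>. pt V \<notin> S \<inter> T}" by (rule rev_finite_subset) blast
    qed
  next
    fix \<K> assume O: "\<forall>K\<in>\<K>. ?O K"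
    have \<K>: "K \<subseteq> carr" "V \<in> \<V> \<Longrightarrow> pt V \<in> K \<Longrightarrow> \<exists>n. j ` V n \<subseteq> K"
      "None \<in> K \<Longrightarrow> finite {V\<in>\<V>. pt V \<notin> K}" if "K \<in> \<K>" for K V
      using bspec[OF O that] by simp_all
    show "?O (\<Union>\<K>)"
    proof (intro conjI ballI impI)
      show "\<Union>\<K> \<subseteq> carr" using \<K>(1) by blast
      show "\<exists>n. j ` V n \<subseteq> \<Union>\<K>" if "V \<in> \<V>" "pt V \<in> \<Union>\<K>" for V
        using \<K>(2) that by (meson Sup_upper Union_iff subset_trans)
      assume "None \<in> \<Union>\<K>"
      then obtain K where "K \<in> \<K>" "finite {V\<in>\<V>. pt V \<notin> K}" using \<K>(3) by blast
      then show "finite {V\<in>\<V>. pt V \<notin> \<Union>\<K>}" by (elim rev_finite_subset) blast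
    qed
  qed
  then show ?thesis by (simp add: nbhd_space_def)
qed

lemma openin_nbhd_space_subset: "openin nbhd_space U \<Longrightarrow> U \<subseteq> carr"
  and openin_nbhd_space_pt: "openin nbhd_space U \<Longrightarrow> V \<in> \<V> \<Longrightarrow> pt V \<in> U \<Longrightarrow> \<exists>n. j ` V n \<subseteq> U"
  and openin_nbhd_space_None: "openin nbhd_space U \<Longrightarrow> None \<in> U \<Longrightarrow> finite {V\<in>\<V>. pt V \<notin> U}"
  by (simp_all add: openin_nbhd_space)

lemma openin_nbhd_spaceI:
  assumes "U \<subseteq> carr" "\<And>V. V \<in> \<V> \<Longrightarrow> pt V \<in> U \<Longrightarrow> \<exists>n. j ` V n \<subseteq> U"
    "None \<in> U \<Longrightarrow> finite {V\<in>\<V>. pt V \<notin> U}"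
  shows "openin nbhd_space U"
  using assms by (simp add: openin_nbhd_space)

lemma topspace_nbhd_space: "topspace nbhd_space = carr"
proof
  show "topspace nbhd_space \<subseteq> carr" by (rule openin_nbhd_space_subset[OF openin_topspace])
  have "\<exists>n. j ` V n \<subseteq> carr" if "V \<in> \<V>" for V
    using nbhd_subset[OF that, of 0] unfolding carr_def by blast
  moreover have "finite {V\<in>\<V>. pt V \<notin> carr}" by (rule finite_subset[of _ "{}"]) (auto simp: carr_def)
  ultimately have "openin nbhd_space carr" by (intro openin_nbhd_spaceI) simp_all
  then show "carr \<subseteq> topspace nbhd_space" by (rule openin_subset)
qed

lemma openin_singleton: "a \<in> \<Lambda> \<Longrightarrow> openin nbhd_space {j a}"
  by (rule openin_nbhd_spaceI) (auto simp: carr_def)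

lemma openin_nbhd: "V \<in> \<V> \<Longrightarrow> openin nbhd_space (insert (pt V) (j ` V n))"
  using nbhd_subset[of V n] by (intro openin_nbhd_spaceI) (auto simp: carr_def)

lemma openin_Diff_finite:
  assumes "finite F"
  shows "openin nbhd_space (carr - j ` F)"
proof -
  have "\<exists>n. j ` V n \<subseteq> carr - j ` F" if V: "V \<in> \<V>" for V
  proof -
    obtain n where "F \<inter> V n = {}" using finite_escapes[OF nbhd_dec nbhd_Inter assms] V by blast
    then have "j ` V n \<subseteq> carr - j ` F" using nbhd_subset[OF V] by (auto simp: carr_def)
    then show ?thesis by blast
  qed
  moreover have "finite {V\<in>\<V>. pt V \<notin> carr - j ` F}"
    by (rule finite_subset[of _ "{}"]) (auto simp: carr_def)
  ultimately show ?thesis by (intro openin_nbhd_spaceI) auto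
qed

text \<open>The set omits only one point of \<open>\<V>\<close>, as openness at \<open>None\<close>
  requires. For any other \<open>U\<close>, some \<open>U m\<close> misses \<open>V m\<close>, and
  the finitely many points of \<open>Z\<close> outside \<open>V m\<close> are missed by a later term
  of \<open>U\<close>.\<close>

lemma openin_Diff_convergent:
  assumes V: "V \<in> \<V>" and Z: "set_conv Z V"
  shows "openin nbhd_space (carr - insert (pt V) (j ` Z))"
proof -
  have "\<exists>n. j ` U n \<subseteq> carr - insert (pt V) (j ` Z)" if U: "U \<in> \<V>" "pt U \<noteq> pt V" for U
  proof -
    have "separated U V" using U V nbhd_separated by auto
    then obtain m where m: "U m \<inter> V m = {}" by (auto simp: separated_def)
    have "finite (Z - V m)" using Z by (simp add: set_conv_def)
    then obtain n where n: "(Z - V m) \<inter> U n = {}"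
      using finite_escapes[OF nbhd_dec nbhd_Inter] U(1) by blast
    have "U (max m n) \<subseteq> U m" "U (max m n) \<subseteq> U n"
      using nbhd_mono[OF U(1)] by simp_all
    then have "Z \<inter> U (max m n) = {}" using m n by blast
    then have "j ` U (max m n) \<subseteq> carr - insert (pt V) (j ` Z)"
      using nbhd_subset[OF U(1)] by (auto simp: carr_def)
    then show ?thesis by blast
  qed
  moreover have "{U\<in>\<V>. pt U \<notin> carr - insert (pt V) (j ` Z)} \<subseteq> {V}" using V by (auto simp: carr_def)
  then have "finite {U\<in>\<V>. pt U \<notin> carr - insert (pt V) (j ` Z)}" by (rule finite_subset) simp
  ultimately show ?thesis by (intro openin_nbhd_spaceI) auto
qed

lemma separable:
  assumes "countable \<Lambda>"
  shows "separable_space nbhd_space"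
proof (rule separable_spaceI)
  \<comment> \<open>With \<open>None\<close> placed in the dense set, only open sets containing some
    \<open>pt V\<close> require an argument.\<close>
  show "countable (insert None (j ` \<Lambda>))" using assms by simp
  show "insert None (j ` \<Lambda>) \<subseteq> topspace nbhd_space" by (auto simp: topspace_nbhd_space carr_def)
  show "insert None (j ` \<Lambda>) \<inter> U \<noteq> {}" if U: "openin nbhd_space U" "U \<noteq> {}" for U
  proof -
    obtain x where x: "x \<in> U" "x \<in> carr" using U openin_nbhd_space_subset by blast
    then consider "x \<in> insert None (j ` \<Lambda>)" | V where "V \<in> \<V>" "x = pt V" by (auto simp: carr_def)
    then show ?thesis
    proof cases
      case (2 V)
      then obtain n where "j ` V n \<subseteq> U" using x openin_nbhd_space_pt[OF U(1)] by blast
      then show ?thesis using nbhd_subset[OF 2(1), of n] nbhd_nonempty[OF 2(1), of n] by blast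
    qed (use x in blast)
  qed
qed

text \<open>The values of a sequence converging to \<open>pt V\<close> form a set \<open>Z\<close>
  converging to \<open>V\<close>, and \<open>openin_Diff_convergent\<close> then gives a
  neighbourhood of \<open>None\<close> which the sequence avoids.\<close>

lemma not_limit_of_both:
  assumes V: "V \<in> \<V>" "limitin nbhd_space \<sigma> (pt V) sequentially" "limitin nbhd_space \<sigma> None sequentially"
  shows False
proof -
  have ev: "\<forall>\<^sub>F k in sequentially. \<sigma> k \<in> insert (pt V) (j ` V n)" for n
    using limitinD[OF V(2) openin_nbhd[OF V(1)]] by blast
  have none: "\<forall>\<^sub>F k in sequentially. \<sigma> k \<in> carr - insert (pt V) (j ` Z)" if "set_conv Z V" for Z
    by (rule limitinD[OF V(3) openin_Diff_convergent[OF V(1) that]]) (auto simp: carr_def)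
  \<comment> \<open>With the empty set in place of \<open>Z\<close>, the sequence is seen to avoid
    \<open>pt V\<close> eventually, so from \<open>N\<close> on its values are images of points of
    \<open>V 0\<close>.\<close>
  have "set_conv {} V" by (simp add: set_conv_def)
  from eventually_conj[OF ev[of 0] none[OF this]] obtain N
    where N: "\<And>k. k \<ge> N \<Longrightarrow> \<sigma> k \<in> j ` V 0" by (auto simp: eventually_sequentially)
  define Z where "Z = {a. \<exists>k\<ge>N. \<sigma> k = j a}"
  have "set_conv Z V"
    unfolding set_conv_def
  proof
    fix n
    obtain M where M: "\<And>k. k \<ge> M \<Longrightarrow> \<sigma> k \<in> insert (pt V) (j ` V n)"
      using ev[of n] by (auto simp: eventually_sequentially)
    have "j ` (Z - V n) \<subseteq> \<sigma> ` {..<M}"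
    proof
      fix y assume "y \<in> j ` (Z - V n)"
      then obtain a k where a: "y = j a" "a \<notin> V n" "\<sigma> k = j a" by (auto simp: Z_def)
      then have "\<not> k \<ge> M" using M[of k] by auto
      then show "y \<in> \<sigma> ` {..<M}" using a by (intro image_eqI[of _ _ k]) auto
    qed
    then have "finite (j ` (Z - V n))" by (rule finite_subset) simp
    then show "finite (Z - V n)" by (rule finite_imageD) (simp add: inj_on_def)
  qed
  from none[OF this] obtain M where M: "\<And>k. k \<ge> M \<Longrightarrow> \<sigma> k \<notin> j ` Z"
    by (auto simp: eventually_sequentially)
  have "\<sigma> (max M N) \<in> j ` V 0" by (rule N) simp
  then obtain a where "\<sigma> (max M N) = j a" by blast
  then have "\<sigma> (max M N) \<in> j ` Z" unfolding Z_def
    by (intro image_eqI[of _ _ a] CollectI exI[of _ "max M N"]) auto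
  then show False using M[of "max M N"] by simp
qed

text \<open>Distinct points have disjoint open neighbourhoods, except possibly \<open>None\<close>
  and a \<open>pt V\<close>, the case of \<open>not_limit_of_both\<close>. Points of
  \<open>\<Lambda>\<close> are isolated and have open complements; two sequences in
  \<open>\<V>\<close> are separated.\<close>

lemma unique_limits: "unique_sequential_limits nbhd_space"
  unfolding unique_sequential_limits_def
proof (intro allI impI, elim conjE, rule ccontr)
  fix \<sigma> x y
  assume lim: "limitin nbhd_space \<sigma> x sequentially" "limitin nbhd_space \<sigma> y sequentially" and "x \<noteq> y"
  have disj: False if "openin nbhd_space S" "openin nbhd_space T" "u \<in> S" "v \<in> T" "S \<inter> T = {}"
    "limitin nbhd_space \<sigma> u sequentially" "limitin nbhd_space \<sigma> v sequentially" for S T u v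
  proof -
    have "\<forall>\<^sub>F k in sequentially. \<sigma> k \<in> S" "\<forall>\<^sub>F k in sequentially. \<sigma> k \<in> T"
      using limitinD[OF that(6,1,3)] limitinD[OF that(7,2,4)] by simp_all
    then have "\<forall>\<^sub>F k in sequentially. \<sigma> k \<in> S \<inter> T" by eventually_elim blast
    then show False using that(5) by simp
  qed
  have isolated: False if a: "a \<in> \<Lambda>" and "v \<noteq> j a"
    "limitin nbhd_space \<sigma> (j a) sequentially" "limitin nbhd_space \<sigma> v sequentially" for a v
  proof (rule disj[OF openin_singleton[OF a] openin_Diff_finite[of "{a}"]])
    show "v \<in> carr - j ` {a}" using that topspace_nbhd_space by (auto simp: limitin_def)
  qed (use that in auto)
  have "x \<in> carr" "y \<in> carr" using lim by (auto simp: limitin_def topspace_nbhd_space)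
  then consider a where "a \<in> \<Lambda>" "x = j a" | a where "a \<in> \<Lambda>" "y = j a" | V where "V \<in> \<V>" "x = pt V" "y = None"
    | V where "V \<in> \<V>" "y = pt V" "x = None" | U V where "U \<in> \<V>" "V \<in> \<V>" "x = pt U" "y = pt V"
    using \<open>x \<noteq> y\<close> unfolding carr_def by blast
  then show False
  proof cases
    case (1 a)
    then show ?thesis using isolated[of a y] lim \<open>x \<noteq> y\<close> by simp
  next
    case (2 a)
    then show ?thesis using isolated[of a x] lim \<open>x \<noteq> y\<close> by simp
  next
    case (3 V)
    then show ?thesis using not_limit_of_both[of V \<sigma>] lim by simp
  next
    case (4 V)
    then show ?thesis using not_limit_of_both[of V \<sigma>] lim by simp
  next
    case UV: (5 U V)
    then have "separated U V" using nbhd_separated \<open>x \<noteq> y\<close> by blast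
    then obtain n where "U n \<inter> V n = {}" by (auto simp: separated_def)
    then have "insert (pt U) (j ` U n) \<inter> insert (pt V) (j ` V n) = {}" using UV \<open>x \<noteq> y\<close> by auto
    from disj[OF openin_nbhd openin_nbhd _ _ this] UV lim show False by auto
  qed
qed

end

text \<open>The map \<open>j\<close> is not convergent on a positive set \<open>B\<close>: an
  isolated point is no limit, \<open>pt V\<close> is none because \<open>V\<close> is null, and
  \<open>None\<close> is none because \<open>B\<close> contains an infinite \<open>Z\<close>
  converging to some \<open>V\<close>, which \<open>openin_Diff_convergent\<close> removes.\<close>

lemma (in non_katetov) nbhd_space_example:
  assumes "Continuum_Hypothesis"
  shows "\<exists>X :: ('l + 'l set) option topology. rho_space \<rho> X \<and> X \<notin> FinBW \<Lambda> \<I> \<and>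
    separable_space X \<and> unique_sequential_limits X"
proof -
  from solving_family[OF assms] obtain \<V> where null: "\<forall>V\<in>\<V>. null_seq \<Lambda> \<I> V"
    and sep: "\<forall>U\<in>\<V>. \<forall>V\<in>\<V>. U \<noteq> V \<longrightarrow> separated U V"
    and sets: "\<forall>Z. set_solved \<V> Z" and funs: "\<forall>f. fun_solved \<V> f"
    and real: "\<V> \<lesssim> (UNIV :: real set)" by (elim exE conjE)
  \<comment> \<open>\<open>\<V>\<close> has at most continuum many members and the type
    \<open>'l\<close> is infinite, so subsets of \<open>'l\<close> suffice as codes.\<close>
  have "\<V> \<lesssim> (UNIV :: nat set set)"
    using real eqpoll_sym[OF nat_sets_eqpoll_reals] by (rule lepoll_trans2)
  moreover have "inj (image (from_nat_into \<Lambda>))"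
    using bij_betw_from_nat_into[OF countable_ground infinite_ground]
      inj_on_image_Pow[of "from_nat_into \<Lambda>" UNIV] by (simp add: bij_betw_def)
  then have "(UNIV :: nat set set) \<lesssim> (UNIV :: 'l set set)" by (auto simp: lepoll_def)
  ultimately have "\<V> \<lesssim> (UNIV :: 'l set set)" by (rule lepoll_trans)
  then obtain code :: "(nat \<Rightarrow> 'l set) \<Rightarrow> 'l set" where "inj_on code \<V>" by (auto simp: lepoll_def)
  then interpret N: nbhd_system \<Lambda> \<V> code
    using null sep by unfold_locales (auto simp: null_seq_def)
  have "rho_space \<rho> N.nbhd_space"
  proof (rule rho_space_criterion[where j = N.j and R = "N.pt ` \<V> \<union> {None}" and p = None])
    show "inj_on N.j \<Lambda>" by (simp add: inj_on_def)
    show "topspace N.nbhd_space = N.j ` \<Lambda> \<union> (N.pt ` \<V> \<union> {None})"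
      by (auto simp: N.topspace_nbhd_space N.carr_def)
    show "from_nat_into \<Lambda> 0 \<in> \<Lambda>" using infinite_ground by (intro from_nat_into) auto
    show "finite (N.pt ` \<V> \<union> {None} - U)" if "openin N.nbhd_space U" "None \<in> U" for U
    proof -
      have "finite {V\<in>\<V>. N.pt V \<notin> U}" by (rule N.openin_nbhd_space_None[OF that])
      moreover have "N.pt ` \<V> \<union> {None} - U \<subseteq> N.pt ` {V\<in>\<V>. N.pt V \<notin> U}" using that by blast
      ultimately show ?thesis using finite_surj by blast
    qed
    fix g assume "g \<in> target \<rho> \<rightarrow> \<Lambda>"
    then have "\<exists>D. infinite D \<and> ((\<exists>c. \<forall>x\<in>val \<rho> D. g x = c) \<or> (\<exists>V\<in>\<V>. fun_conv \<rho> g D V))"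
      using funs by (simp add: fun_solved_def)
    then obtain D where D: "infinite D" "(\<exists>c. \<forall>x\<in>val \<rho> D. g x = c) \<or> (\<exists>V\<in>\<V>. fun_conv \<rho> g D V)"
      by (elim exE conjE)
    have "(\<forall>c. \<exists>K. finite K \<and> c \<notin> g ` val \<rho> (D - K)) \<and>
        (\<exists>x\<in>topspace N.nbhd_space. converges_along \<rho> N.nbhd_space (\<lambda>t. N.j (g t)) D x)"
      if V: "V \<in> \<V>" and conv: "fun_conv \<rho> g D V" for V
    proof (intro conjI allI bexI)
      show "\<exists>K. finite K \<and> c \<notin> g ` val \<rho> (D - K)" for c
      proof -
        obtain n where "c \<notin> V n" using N.nbhd_Inter[OF V] by blast
        then show ?thesis using conv by (meson fun_conv_def subsetD)
      qed
      show "N.pt V \<in> topspace N.nbhd_space" using V by (simp add: N.topspace_nbhd_space N.carr_def)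
      show "converges_along \<rho> N.nbhd_space (\<lambda>t. N.j (g t)) D (N.pt V)"
        unfolding converges_along_def
      proof (intro allI impI, elim conjE)
        fix U assume "openin N.nbhd_space U" "N.pt V \<in> U"
        then obtain n where n: "N.j ` V n \<subseteq> U" using N.openin_nbhd_space_pt[OF _ V] by blast
        obtain K where "finite K" "g ` val \<rho> (D - K) \<subseteq> V n" using conv unfolding fun_conv_def by blast
        then show "\<exists>K. finite K \<and> (\<lambda>t. N.j (g t)) ` val \<rho> (D - K) \<subseteq> U" using n by blast
      qed
    qed
    then show "\<exists>D. infinite D \<and> ((\<exists>c. \<forall>x\<in>val \<rho> D. g x = c) \<or>
        (\<forall>c. \<exists>K. finite K \<and> c \<notin> g ` val \<rho> (D - K)) \<and>
        (\<exists>x\<in>topspace N.nbhd_space. converges_along \<rho> N.nbhd_space (\<lambda>t. N.j (g t)) D x))"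
      using D by meson
  qed simp
  moreover have "N.nbhd_space \<notin> FinBW \<Lambda> \<I>"
  proof
    assume "N.nbhd_space \<in> FinBW \<Lambda> \<I>"
    moreover have "N.j \<in> \<Lambda> \<rightarrow> topspace N.nbhd_space" by (auto simp: N.topspace_nbhd_space N.carr_def)
    ultimately obtain B x where B: "B \<in> positive_sets \<Lambda> \<I>" and x: "x \<in> topspace N.nbhd_space"
      and conv: "\<And>U. openin N.nbhd_space U \<Longrightarrow> x \<in> U \<Longrightarrow> finite {a\<in>B. N.j a \<notin> U}"
      by (rule FinBW_D) blast
    have Binf: "infinite B" by (rule positive_infinite[OF B])
    have BL: "B \<subseteq> \<Lambda>" using B by (simp add: positive_iff)
    consider a where "a \<in> \<Lambda>" "x = N.j a" | V where "V \<in> \<V>" "x = N.pt V" | "x = None"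
      using x by (auto simp: N.topspace_nbhd_space N.carr_def)
    then show False
    proof cases
      case (1 a)
      then have "finite {b\<in>B. N.j b \<notin> {N.j a}}" using conv[OF N.openin_singleton] by blast
      moreover have "B \<subseteq> insert a {b\<in>B. N.j b \<notin> {N.j a}}" by auto
      ultimately show False using Binf finite_subset by blast
    next
      case (2 V)
      have "null_seq \<Lambda> \<I> V" using null 2(1) by blast
      then obtain n where n: "infinite (B - V n)" using B unfolding null_seq_def by blast
      have "finite {b\<in>B. N.j b \<notin> insert (N.pt V) (N.j ` V n)}" using conv[OF N.openin_nbhd] 2 by blast
      moreover have "B - V n \<subseteq> {b\<in>B. N.j b \<notin> insert (N.pt V) (N.j ` V n)}" by auto
      ultimately show False using n finite_subset by blast
    next
      case 3
      obtain V Z where V: "V \<in> \<V>" "Z \<subseteq> B" "infinite Z" "set_conv Z V"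
        using sets BL Binf unfolding set_solved_def by blast
      have "finite {b\<in>B. N.j b \<notin> N.carr - insert (N.pt V) (N.j ` Z)}"
        by (rule conv[OF N.openin_Diff_convergent[OF V(1,4)]]) (use 3 in \<open>auto simp: N.carr_def\<close>)
      moreover have "Z \<subseteq> {b\<in>B. N.j b \<notin> N.carr - insert (N.pt V) (N.j ` Z)}" using V(2) by auto
      ultimately show False using V(3) finite_subset by blast
    qed
  qed
  ultimately show ?thesis using N.separable[OF countable_ground] N.unique_limits by blast
qed

section \<open>The example for ideals with the P-minus property\<close>

locale ad_family =
  fixes \<Lambda> :: "'l set" and \<A> :: "'l set set"
  assumes ad: "almost_disjoint_family \<Lambda> \<A>"
begin

lemma ad_subset: "A \<in> \<A> \<Longrightarrow> A \<subseteq> \<Lambda>"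
  and ad_infinite: "A \<in> \<A> \<Longrightarrow> infinite A"
  and ad_Int: "A \<in> \<A> \<Longrightarrow> B \<in> \<A> \<Longrightarrow> A \<noteq> B \<Longrightarrow> finite (A \<inter> B)"
  using ad by (auto simp: almost_disjoint_family_def)

lemma openin_Psi_basic:
  "a \<in> \<Lambda> \<Longrightarrow> openin (Psi_space \<Lambda> \<A>) {Inl a}"
  "A \<in> \<A> \<Longrightarrow> finite F \<Longrightarrow> openin (Psi_space \<Lambda> \<A>) (insert (Inr A) (Inl ` (A - F)))"
  unfolding Psi_space_def by (intro topology_generated_by_Basis; blast)+

text \<open>Induction over the generation of the topology; together with \<open>openin_PsiI\<close>
  this replaces generation by a direct description of open sets.\<close>

lemma openin_Psi_imp:
  assumes "openin (Psi_space \<Lambda> \<A>) U"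
  shows "U \<subseteq> Inl ` \<Lambda> \<union> Inr ` \<A>" "\<And>A. Inr A \<in> U \<Longrightarrow> \<exists>F. finite F \<and> Inl ` (A - F) \<subseteq> U"
proof -
  let ?\<B> = "{{Inl n} | n. n \<in> \<Lambda>} \<union> {insert (Inr A) (Inl ` (A - F)) | A F. A \<in> \<A> \<and> finite F}"
  have "generate_topology_on ?\<B> U"
    using assms unfolding Psi_space_def by (simp add: openin_topology_generated_by_iff)
  then have "U \<subseteq> Inl ` \<Lambda> \<union> Inr ` \<A> \<and> (\<forall>A. Inr A \<in> U \<longrightarrow> (\<exists>F. finite F \<and> Inl ` (A - F) \<subseteq> U))"
  proof induction
    case (Int S T)
    have "\<exists>F. finite F \<and> Inl ` (A - F) \<subseteq> S \<inter> T" if A: "Inr A \<in> S \<inter> T" for A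
    proof -
      obtain F where "finite F" "Inl ` (A - F) \<subseteq> S"
        using conjunct2[OF Int.IH(1), rule_format, of A] A by blast
      moreover obtain G where "finite G" "Inl ` (A - G) \<subseteq> T"
        using conjunct2[OF Int.IH(2), rule_format, of A] A by blast
      ultimately show ?thesis by (intro exI[of _ "F \<union> G"]) auto
    qed
    moreover have "S \<inter> T \<subseteq> Inl ` \<Lambda> \<union> Inr ` \<A>" using conjunct1[OF Int.IH(1)] by blast
    ultimately show ?case by blast
  next
    case (UN K)
    have "\<exists>F. finite F \<and> Inl ` (A - F) \<subseteq> \<Union>K" if A: "Inr A \<in> \<Union>K" for A
    proof -
      obtain k where k: "k \<in> K" "Inr A \<in> k" using A by blast
      then obtain F where "finite F" "Inl ` (A - F) \<subseteq> k"
        using conjunct2[OF UN.IH[OF k(1)], rule_format, of A] by blast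
      then show ?thesis using k(1) by blast
    qed
    moreover have "\<Union>K \<subseteq> Inl ` \<Lambda> \<union> Inr ` \<A>" using conjunct1[OF UN.IH] by (rule Union_least)
    ultimately show ?case by blast
  next
    case (Basis S)
    then consider n where "n \<in> \<Lambda>" "S = {Inl n}"
      | A F where "A \<in> \<A>" "finite F" "S = insert (Inr A) (Inl ` (A - F))" by blast
    then show ?case
    proof cases
      case (2 A F)
      then show ?thesis using ad_subset by auto
    qed auto
  qed auto
  then show "U \<subseteq> Inl ` \<Lambda> \<union> Inr ` \<A>" "\<And>A. Inr A \<in> U \<Longrightarrow> \<exists>F. finite F \<and> Inl ` (A - F) \<subseteq> U"
    by simp_all
qed

lemma openin_PsiI:
  assumes "U \<subseteq> Inl ` \<Lambda> \<union> Inr ` \<A>" "\<And>A. Inr A \<in> U \<Longrightarrow> \<exists>F. finite F \<and> Inl ` (A - F) \<subseteq> U"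
  shows "openin (Psi_space \<Lambda> \<A>) U"
proof (subst openin_subopen, intro ballI)
  fix x assume x: "x \<in> U"
  then consider a where "a \<in> \<Lambda>" "x = Inl a" | A where "A \<in> \<A>" "x = Inr A" using assms(1) by blast
  then show "\<exists>T. openin (Psi_space \<Lambda> \<A>) T \<and> x \<in> T \<and> T \<subseteq> U"
  proof cases
    case (1 a)
    then show ?thesis using openin_Psi_basic(1) x by (intro exI[of _ "{Inl a}"]) auto
  next
    case (2 A)
    then obtain F where "finite F" "Inl ` (A - F) \<subseteq> U" using assms(2) x by blast
    then show ?thesis using openin_Psi_basic(2) 2 x
      by (intro exI[of _ "insert (Inr A) (Inl ` (A - F))"]) auto
  qed
qed

lemma topspace_Psi: "topspace (Psi_space \<Lambda> \<A>) = Inl ` \<Lambda> \<union> Inr ` \<A>"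
proof
  show "topspace (Psi_space \<Lambda> \<A>) \<subseteq> Inl ` \<Lambda> \<union> Inr ` \<A>" by (rule openin_Psi_imp[OF openin_topspace])
  have "openin (Psi_space \<Lambda> \<A>) (Inl ` \<Lambda> \<union> Inr ` \<A>)"
  proof (rule openin_PsiI)
    fix A assume "Inr A \<in> Inl ` \<Lambda> \<union> Inr ` \<A>"
    then show "\<exists>F. finite F \<and> Inl ` (A - F) \<subseteq> Inl ` \<Lambda> \<union> Inr ` \<A>"
      using ad_subset[of A] by (intro exI[of _ "{}"]) auto
  qed simp
  then show "Inl ` \<Lambda> \<union> Inr ` \<A> \<subseteq> topspace (Psi_space \<Lambda> \<A>)" by (rule openin_subset)
qed

lemma Hausdorff_Psi: "Hausdorff_space (Psi_space \<Lambda> \<A>)"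
  unfolding Hausdorff_space_def
proof (intro allI impI, elim conjE)
  fix x y assume "x \<in> topspace (Psi_space \<Lambda> \<A>)" "y \<in> topspace (Psi_space \<Lambda> \<A>)" and neq: "x \<noteq> y"
  then consider a b where "a \<in> \<Lambda>" "b \<in> \<Lambda>" "x = Inl a" "y = Inl b"
    | a B where "a \<in> \<Lambda>" "B \<in> \<A>" "x = Inl a" "y = Inr B"
    | A b where "A \<in> \<A>" "b \<in> \<Lambda>" "x = Inr A" "y = Inl b"
    | A B where "A \<in> \<A>" "B \<in> \<A>" "x = Inr A" "y = Inr B"
    unfolding topspace_Psi by blast
  then show "\<exists>U V. openin (Psi_space \<Lambda> \<A>) U \<and> openin (Psi_space \<Lambda> \<A>) V \<and> x \<in> U \<and> y \<in> V \<and> disjnt U V"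
  proof cases
    case (1 a b)
    then show ?thesis using openin_Psi_basic(1) neq
      by (intro exI[of _ "{Inl a}"] exI[of _ "{Inl b}"]) (auto simp: disjnt_def)
  next
    case (2 a B)
    then show ?thesis using openin_Psi_basic(1) openin_Psi_basic(2)[of B "{a}"]
      by (intro exI[of _ "{Inl a}"] exI[of _ "insert (Inr B) (Inl ` (B - {a}))"]) (auto simp: disjnt_def)
  next
    case (3 A b)
    then show ?thesis using openin_Psi_basic(1) openin_Psi_basic(2)[of A "{b}"]
      by (intro exI[of _ "insert (Inr A) (Inl ` (A - {b}))"] exI[of _ "{Inl b}"]) (auto simp: disjnt_def)
  next
    case (4 A B)
    then have "finite (A \<inter> B)" using ad_Int neq by blast
    then have "openin (Psi_space \<Lambda> \<A>) (insert (Inr A) (Inl ` (A - A \<inter> B)))"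
      "openin (Psi_space \<Lambda> \<A>) (insert (Inr B) (Inl ` (B - A \<inter> B)))"
      using openin_Psi_basic(2) 4 by blast+
    then show ?thesis using 4 neq
      by (intro exI[of _ "insert (Inr A) (Inl ` (A - A \<inter> B))"]
          exI[of _ "insert (Inr B) (Inl ` (B - A \<inter> B))"]) (auto simp: disjnt_def)
  qed
qed

text \<open>A member of the cover containing \<open>Inr A\<close> contains all but finitely many
  points of \<open>A\<close>, and each remaining point costs one more member.\<close>

lemma compactin_Psi_nbhd:
  assumes A: "A \<in> \<A>"
  shows "compactin (Psi_space \<Lambda> \<A>) (insert (Inr A) (Inl ` A))"
  unfolding compactin_def
proof (intro conjI allI impI)
  show "insert (Inr A) (Inl ` A) \<subseteq> topspace (Psi_space \<Lambda> \<A>)"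
    using A ad_subset by (auto simp: topspace_Psi)
  fix \<U> assume "Ball \<U> (openin (Psi_space \<Lambda> \<A>)) \<and> insert (Inr A) (Inl ` A) \<subseteq> \<Union>\<U>"
  then have op: "\<forall>U\<in>\<U>. openin (Psi_space \<Lambda> \<A>) U" and cov: "insert (Inr A) (Inl ` A) \<subseteq> \<Union>\<U>"
    by simp_all
  obtain U where U: "U \<in> \<U>" "Inr A \<in> U" using cov by blast
  then obtain F where F: "finite F" "Inl ` (A - F) \<subseteq> U"
    using openin_Psi_imp(2)[OF bspec[OF op U(1)] U(2)] by blast
  have "\<forall>a\<in>A \<inter> F. \<exists>W\<in>\<U>. Inl a \<in> W" using cov by blast
  then obtain w where w: "\<And>a. a \<in> A \<inter> F \<Longrightarrow> w a \<in> \<U>" "\<And>a. a \<in> A \<inter> F \<Longrightarrow> Inl a \<in> w a" by metis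
  have "insert (Inr A) (Inl ` A) \<subseteq> \<Union>(insert U (w ` (A \<inter> F)))"
  proof
    fix x :: "'l + 'l set" assume "x \<in> insert (Inr A) (Inl ` A)"
    then consider "x = Inr A" | a where "a \<in> A - F" "x = Inl a" | a where "a \<in> A \<inter> F" "x = Inl a" by blast
    then show "x \<in> \<Union>(insert U (w ` (A \<inter> F)))"
    proof cases
      case (3 a)
      then show ?thesis using w(2)[OF 3(1)] by auto
    qed (use U(2) F(2) in auto)
  qed
  moreover have "insert U (w ` (A \<inter> F)) \<subseteq> \<U>" using U(1) w(1) by blast
  ultimately show "\<exists>\<F>. finite \<F> \<and> \<F> \<subseteq> \<U> \<and> insert (Inr A) (Inl ` A) \<subseteq> \<Union>\<F>"
    using F(1) by (intro exI[of _ "insert U (w ` (A \<inter> F))"]) simp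
qed

lemma locally_compact_Psi: "locally_compact_space (Psi_space \<Lambda> \<A>)"
  unfolding locally_compact_space_def
proof (intro ballI allI impI)
  fix x assume "x \<in> topspace (Psi_space \<Lambda> \<A>)"
  then consider a where "a \<in> \<Lambda>" "x = Inl a" | A where "A \<in> \<A>" "x = Inr A"
    unfolding topspace_Psi by blast
  then show "\<exists>U K. openin (Psi_space \<Lambda> \<A>) U \<and> compactin (Psi_space \<Lambda> \<A>) K \<and> x \<in> U \<and> U \<subseteq> K"
  proof cases
    case (1 a)
    then have "compactin (Psi_space \<Lambda> \<A>) {Inl a}" by (intro finite_imp_compactin) (auto simp: topspace_Psi)
    then show ?thesis using openin_Psi_basic(1) 1 by blast
  next
    case (2 A)
    then have "openin (Psi_space \<Lambda> \<A>) (insert (Inr A) (Inl ` A))"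
      using openin_Psi_basic(2)[of A "{}"] by simp
    then show ?thesis using compactin_Psi_nbhd[OF 2(1)] 2(2) by blast
  qed
qed

text \<open>A finite subcover is taken from the cover by isolated points and full neighbourhoods of
  the points of \<open>\<A>\<close>. It bounds what a neighbourhood of infinity can miss.\<close>

lemma compactin_Psi_cover:
  assumes "compactin (Psi_space \<Lambda> \<A>) C"
  shows "\<exists>F \<B>. finite F \<and> finite \<B> \<and> \<B> \<subseteq> \<A> \<and> C \<subseteq> Inl ` F \<union> (\<Union>A\<in>\<B>. insert (Inr A) (Inl ` A))"
proof -
  let ?N = "\<lambda>A. insert (Inr A) (Inl ` A) :: ('l + 'l set) set"
  let ?\<U> = "(\<lambda>a. {Inl a}) ` \<Lambda> \<union> ?N ` \<A>"
  have "openin (Psi_space \<Lambda> \<A>) U" if "U \<in> ?\<U>" for U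
    using that openin_Psi_basic(1) openin_Psi_basic(2)[of _ "{}"] by auto
  moreover have "C \<subseteq> \<Union>?\<U>"
    by (rule subset_trans[OF compactin_subset_topspace[OF assms]]) (auto simp: topspace_Psi)
  ultimately have "\<exists>\<F>. finite \<F> \<and> \<F> \<subseteq> ?\<U> \<and> C \<subseteq> \<Union>\<F>" by (intro compactinD[OF assms])
  then obtain \<F> where \<F>: "finite \<F>" "\<F> \<subseteq> ?\<U>" "C \<subseteq> \<Union>\<F>" by (elim exE conjE)
  have "finite (\<F> \<inter> (\<lambda>a. {Inl a}) ` \<Lambda>)" "finite (\<F> \<inter> ?N ` \<A>)" using \<F>(1) by auto
  from finite_subset_image[OF this(1) Int_lower2] finite_subset_image[OF this(2) Int_lower2]
  obtain F \<B> where F: "finite F" "\<F> \<inter> (\<lambda>a. {Inl a}) ` \<Lambda> = (\<lambda>a. {Inl a}) ` F"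
    and \<B>: "\<B> \<subseteq> \<A>" "finite \<B>" "\<F> \<inter> ?N ` \<A> = ?N ` \<B>"
    by (elim exE conjE)
  have "\<F> = (\<F> \<inter> (\<lambda>a. {Inl a}) ` \<Lambda>) \<union> (\<F> \<inter> ?N ` \<A>)"
    unfolding Int_Un_distrib[symmetric] using Int_absorb2[OF \<F>(2)] by (rule sym)
  then have "C \<subseteq> \<Union>((\<F> \<inter> (\<lambda>a. {Inl a}) ` \<Lambda>) \<union> (\<F> \<inter> ?N ` \<A>))" using \<F>(3) by (rule subst)
  then have "C \<subseteq> Inl ` F \<union> (\<Union>A\<in>\<B>. ?N A)" unfolding F(2) \<B>(3) by auto
  then show ?thesis using F(1) \<B>(1,2) by blast
qed

lemma topspace_Phi: "topspace (Phi_space \<Lambda> \<A>) = insert None (Some ` (Inl ` \<Lambda> \<union> Inr ` \<A>))"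
  by (simp add: Phi_space_def topspace_Psi)

lemma openin_Phi_None:
  assumes "openin (Phi_space \<Lambda> \<A>) U" "None \<in> U"
  obtains F \<B> where "finite F" "finite \<B>" "\<B> \<subseteq> \<A>" 
    "topspace (Phi_space \<Lambda> \<A>) - U \<subseteq> Some ` (Inl ` F \<union> (\<Union>A\<in>\<B>. insert (Inr A) (Inl ` A)))"
proof -
  obtain C where C: "compactin (Psi_space \<Lambda> \<A>) C"
    "U = insert None (Some ` (topspace (Psi_space \<Lambda> \<A>) - C))"
    using assms unfolding Phi_space_def openin_Alexandroff_compactification by blast
  from compactin_Psi_cover[OF C(1)] obtain F \<B> where "finite F" "finite \<B>" "\<B> \<subseteq> \<A>"
    "C \<subseteq> Inl ` F \<union> (\<Union>A\<in>\<B>. insert (Inr A) (Inl ` A))" by (elim exE conjE)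
  moreover have "topspace (Phi_space \<Lambda> \<A>) - U \<subseteq> Some ` C"
    unfolding C(2) by (auto simp: Phi_space_def)
  ultimately show thesis using that[of F \<B>] by (meson image_mono subset_trans)
qed

lemma openin_Phi_Some:
  "openin (Psi_space \<Lambda> \<A>) U \<Longrightarrow> openin (Phi_space \<Lambda> \<A>) (Some ` U)"
  by (simp add: Phi_space_def)

lemma openin_Phi_Inr:
  assumes "openin (Phi_space \<Lambda> \<A>) U" "Some (Inr A) \<in> U"
  shows "\<exists>F. finite F \<and> (\<lambda>a. Some (Inl a)) ` (A - F) \<subseteq> U"
proof -
  have "openin (Psi_space \<Lambda> \<A>) {x \<in> topspace (Psi_space \<Lambda> \<A>). Some x \<in> U}"
    using continuous_map_Some assms(1) unfolding Phi_space_def by (rule openin_continuous_map_preimage)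
  moreover have "Some (Inr A) \<in> topspace (Phi_space \<Lambda> \<A>)" using openin_subset[OF assms(1)] assms(2) by blast
  then have "Inr A \<in> topspace (Psi_space \<Lambda> \<A>)" by (auto simp: Phi_space_def)
  ultimately obtain F where "finite F" "Inl ` (A - F) \<subseteq> {x \<in> topspace (Psi_space \<Lambda> \<A>). Some x \<in> U}"
    using openin_Psi_imp(2)[of "{x \<in> topspace (Psi_space \<Lambda> \<A>). Some x \<in> U}" A] assms(2) by blast
  then show ?thesis by blast
qed

text \<open>The full neighbourhood of \<open>A\<close> is compact in a Hausdorff space, hence
  closed, and its image stays closed in the compactification. The complement is a neighbourhood of
  infinity that omits all of \<open>A\<close>.\<close>

lemma openin_Phi_Diff:
  assumes A: "A \<in> \<A>"
  shows "openin (Phi_space \<Lambda> \<A>) (topspace (Phi_space \<Lambda> \<A>) - Some ` insert (Inr A) (Inl ` A))"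
proof -
  have "closedin (Psi_space \<Lambda> \<A>) (insert (Inr A) (Inl ` A))"
    by (rule compactin_imp_closedin[OF Hausdorff_Psi compactin_Psi_nbhd[OF A]])
  then have "closedin (Phi_space \<Lambda> \<A>) (Some ` insert (Inr A) (Inl ` A))"
    using compactin_Psi_nbhd[OF A] unfolding Phi_space_def
    by (subst closedin_Alexandroff_compactification_image_Some) blast
  then show ?thesis by (rule openin_diff[OF openin_topspace])
qed

lemma Hausdorff_Phi: "Hausdorff_space (Phi_space \<Lambda> \<A>)"
  unfolding Phi_space_def Hausdorff_space_Alexandroff_compactification
  using Hausdorff_Psi locally_compact_Psi by blast

lemma compact_Phi: "compact_space (Phi_space \<Lambda> \<A>)"
  by (simp add: Phi_space_def)

lemma separable_Phi:
  assumes "countable \<Lambda>"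
  shows "separable_space (Phi_space \<Lambda> \<A>)"
proof (rule separable_spaceI)
  let ?C = "insert None (Some ` Inl ` \<Lambda>) :: ('l + 'l set) option set"
  show "countable ?C" using assms by simp
  show "?C \<subseteq> topspace (Phi_space \<Lambda> \<A>)" by (auto simp: topspace_Phi)
  show "?C \<inter> U \<noteq> {}" if U: "openin (Phi_space \<Lambda> \<A>) U" "U \<noteq> {}" for U
  proof -
    obtain x where x: "x \<in> U" "x \<in> topspace (Phi_space \<Lambda> \<A>)" using U openin_subset by blast
    then consider "x \<in> ?C" | A where "A \<in> \<A>" "x = Some (Inr A)" unfolding topspace_Phi by blast
    then show ?thesis
    proof cases
      case 1
      then show ?thesis using x(1) by (metis IntI emptyE)
    next
      case (2 A)
      then obtain F where F: "finite F" "(\<lambda>a. Some (Inl a)) ` (A - F) \<subseteq> U"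
        using openin_Phi_Inr[OF U(1)] x by blast
      have "infinite (A - F)" using ad_infinite[OF 2(1)] F(1) by (simp add: Diff_infinite_finite)
      then obtain a where "a \<in> A - F" using infinite_imp_nonempty by blast
      then have "Some (Inl a) \<in> ?C" "Some (Inl a) \<in> U" using F(2) ad_subset[OF 2(1)] by auto
      then show ?thesis by (metis IntI emptyE)
    qed
  qed
qed

end

text \<open>CH speaks of sets of reals, so \<open>\<A>\<close> is first moved into the reals by an
  injection.\<close>

lemma CH_uncountable_eqpoll:
  assumes "Continuum_Hypothesis" "uncountable \<A>" "\<A> \<lesssim> (UNIV :: real set)"
  shows "\<A> \<approx> (UNIV :: real set)"
proof -
  obtain f :: "'a \<Rightarrow> real" where f: "inj_on f \<A>" using assms(3) by (auto simp: lepoll_def)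
  have eq: "\<A> \<approx> f ` \<A>" using inj_on_image_eqpoll_self[OF f] by (rule eqpoll_sym)
  then have "uncountable (f ` \<A>)" using assms(2) countable_eqpoll by blast
  then have "f ` \<A> \<approx> (UNIV :: real set)" using assms(1) by (simp add: Continuum_Hypothesis_def)
  with eq show ?thesis by (rule eqpoll_trans)
qed

section \<open>The almost disjoint family read off from the recursion\<close>

context non_katetov
begin

text \<open>Removing the members of an enumeration of \<open>\<A>\<close> one by one from
  \<open>\<Lambda>\<close> gives decreasing positive sets with differences in \<open>\<I>\<close>.
  \<open>P_minus\<close> then yields a positive set that meets every member of \<open>\<A>\<close>
  finitely.\<close>

lemma uncountable_if_meeting_positive_sets:
  assumes P: "P_minus \<Lambda> \<I>" and sub: "\<A> \<subseteq> \<I>"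
    and meet: "\<And>B. B \<in> positive_sets \<Lambda> \<I> \<Longrightarrow> \<exists>A\<in>\<A>. infinite (B \<inter> A)"
  shows "uncountable \<A>"
proof
  assume c: "countable \<A>"
  have pos: "\<Lambda> \<in> positive_sets \<Lambda> \<I>" using ideal_ground by (simp add: positive_iff)
  then have ne: "\<A> \<noteq> {}" using meet by blast
  define a where "a = from_nat_into \<A>"
  have a: "a k \<in> \<I>" for k using from_nat_into[OF ne, of k] sub by (auto simp: a_def)
  define S where "S k = \<Lambda> - (\<Union>i<k. a i)" for k
  have SSuc: "S (Suc k) = S k - a k" for k by (auto simp: S_def lessThan_Suc)
  have "S k \<in> positive_sets \<Lambda> \<I>" for k
  proof (induction k)
    case 0
    then show ?case using pos by (simp add: S_def)
  next
    case (Suc k)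
    then show ?case unfolding SSuc by (rule positive_Diff[OF _ a])
  qed
  moreover have "S (Suc k) \<subseteq> S k" for k by (auto simp: SSuc)
  moreover have "S k - S (Suc k) \<in> \<I>" for k by (rule ideal_subset[OF a[of k]]) (auto simp: SSuc)
  ultimately obtain B where B: "B \<in> positive_sets \<Lambda> \<I>" "\<forall>k. finite (B - S k)"
    using P[unfolded P_minus_def, rule_format, of S] by blast
  then obtain A where A: "A \<in> \<A>" "infinite (B \<inter> A)" using meet by blast
  then obtain k where "A = a k" unfolding a_def using from_nat_into_surj[OF c] by metis
  then have "B \<inter> A \<subseteq> B - S (Suc k)" by (auto simp: SSuc)
  then show False using A(2) B(2) finite_subset by blast
qed

lemma Phi_space_example:
  assumes CH: "Continuum_Hypothesis" and P: "P_minus \<Lambda> \<I>"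
  shows "\<exists>\<A>. almost_disjoint_family \<Lambda> \<A> \<and> \<A> \<approx> (UNIV :: real set) \<and>
    rho_space \<rho> (Phi_space \<Lambda> \<A>) \<and> Phi_space \<Lambda> \<A> \<notin> FinBW \<Lambda> \<I> \<and>
    Hausdorff_space (Phi_space \<Lambda> \<A>) \<and> compact_space (Phi_space \<Lambda> \<A>) \<and>
    separable_space (Phi_space \<Lambda> \<A>) \<and> topspace (Phi_space \<Lambda> \<A>) \<approx> (UNIV :: real set)"
proof -
  from solving_family[OF CH] obtain \<V> where null: "\<forall>V\<in>\<V>. null_seq \<Lambda> \<I> V"
    and sep: "\<forall>U\<in>\<V>. \<forall>V\<in>\<V>. U \<noteq> V \<longrightarrow> separated U V"
    and sets: "\<forall>Z. set_solved \<V> Z" and funs: "\<forall>f. fun_solved \<V> f" by (elim exE conjE)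
  define \<A> where "\<A> = {A\<in>\<I>. infinite A \<and> set_seq A \<in> \<V>}"
  \<comment> \<open>A sequence other than the tails of \<open>A\<close> eventually misses all of
    \<open>A\<close>: separation makes it miss a tail, and it also escapes the finitely many other
    points.\<close>
  have disj: "\<exists>m. A \<inter> V m = {}" if A: "A \<in> \<A>" and V: "V \<in> \<V>" "V \<noteq> set_seq A" for A V
  proof -
    have "separated V (set_seq A)" using sep A V by (auto simp: \<A>_def)
    then obtain n where n: "V n \<inter> set_seq A n = {}" by (auto simp: separated_def)
    have dec: "decseq V" and int: "(\<Inter>n. V n) = {}" using bspec[OF null V(1)] by (simp_all add: null_seq_def)
    obtain k where k: "(A - set_seq A n) \<inter> V k = {}"
      using finite_escapes[OF dec int finite_Diff_set_seq] by blast
    have "V (max n k) \<subseteq> V n" "V (max n k) \<subseteq> V k" using decseqD[OF dec] by simp_all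
    then have "A \<inter> V (max n k) = {}" using n k by blast
    then show ?thesis by blast
  qed
  have "finite (A \<inter> B)" if AB: "A \<in> \<A>" "B \<in> \<A>" "A \<noteq> B" for A B
  proof -
    have "set_seq B \<noteq> set_seq A" using AB(3) set_seq_0 by metis
    moreover have "set_seq B \<in> \<V>" using AB(2) by (simp add: \<A>_def)
    ultimately obtain m where "A \<inter> set_seq B m = {}" using disj[OF AB(1)] by blast
    then have "A \<inter> B \<subseteq> B - set_seq B m" by blast
    then show ?thesis using finite_Diff_set_seq finite_subset by blast
  qed
  then have ad: "almost_disjoint_family \<Lambda> \<A>"
    using ideal_ground(1) by (auto simp: almost_disjoint_family_def \<A>_def)
  interpret ad_family \<Lambda> \<A> by unfold_locales (rule ad)
  have meet: "\<exists>A\<in>\<A>. infinite (B \<inter> A)" if B: "B \<in> positive_sets \<Lambda> \<I>" for B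
  proof -
    have "B \<subseteq> \<Lambda>" using B by (simp add: positive_iff)
    then show ?thesis
      using spec[OF sets, of B] positive_infinite[OF B] P B unfolding set_solved_def \<A>_def by blast
  qed
  have "uncountable \<A>" by (rule uncountable_if_meeting_positive_sets[OF P _ meet]) (auto simp: \<A>_def)
  moreover have subPow: "\<A> \<subseteq> Pow \<Lambda>" using ad_subset by blast
  then have "\<A> \<lesssim> (UNIV :: real set)"
    using subset_imp_lepoll countable_Pow_lepoll_real[OF countable_ground] lepoll_trans by blast
  ultimately have card: "\<A> \<approx> (UNIV :: real set)" by (rule CH_uncountable_eqpoll[OF CH])
  have top: "topspace (Phi_space \<Lambda> \<A>) \<approx> (UNIV :: real set)"
  proof (rule lepoll_antisym)
    let ?S = "Inl ` \<Lambda> \<union> Inr ` \<A>"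
    have "infinite ?S" using infinite_ground by (simp add: finite_image_iff)
    then have "infinite (Some ` ?S)" by (simp add: finite_image_iff)
    then have "topspace (Phi_space \<Lambda> \<A>) \<approx> Some ` ?S" unfolding topspace_Phi by (rule infinite_insert_eqpoll)
    also have "Some ` ?S \<approx> ?S" by (rule inj_on_image_eqpoll_self) simp
    also have "?S = \<Lambda> <+> \<A>" by (simp add: Plus_def)
    finally have "topspace (Phi_space \<Lambda> \<A>) \<lesssim> \<Lambda> <+> \<A>" by (rule eqpoll_imp_lepoll)
    also have "\<Lambda> <+> \<A> \<lesssim> Pow \<Lambda> <+> Pow \<Lambda>"
      by (rule sum_lepoll_mono[OF lepoll_Pow_self subset_imp_lepoll[OF subPow]])
    also have "\<dots> \<lesssim> (UNIV :: real set)" by (rule Pow_Plus_Pow_lepoll_real[OF countable_ground countable_ground])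
    finally show "topspace (Phi_space \<Lambda> \<A>) \<lesssim> (UNIV :: real set)" .
    have "(UNIV :: real set) \<approx> \<A>" using card by (rule eqpoll_sym)
    also have "\<A> \<lesssim> topspace (Phi_space \<Lambda> \<A>)"
      unfolding lepoll_def by (rule exI[of _ "\<lambda>A. Some (Inr A)"]) (auto simp: topspace_Phi inj_on_def)
    finally show "(UNIV :: real set) \<lesssim> topspace (Phi_space \<Lambda> \<A>)" .
  qed
  let ?j = "\<lambda>a. Some (Inl a) :: ('l + 'l set) option"
  have rho: "rho_space \<rho> (Phi_space \<Lambda> \<A>)"
  proof (rule rho_space_criterion[where j = ?j and R = "insert None (Some ` Inr ` \<A>)" and p = None])
    show "inj_on ?j \<Lambda>" by (simp add: inj_on_def)
    show "topspace (Phi_space \<Lambda> \<A>) = ?j ` \<Lambda> \<union> insert None (Some ` Inr ` \<A>)"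
      unfolding topspace_Phi by blast
    show "from_nat_into \<Lambda> 0 \<in> \<Lambda>" using infinite_ground by (intro from_nat_into) auto
    show "finite (insert None (Some ` Inr ` \<A>) - U)" if U: "openin (Phi_space \<Lambda> \<A>) U" "None \<in> U" for U
    proof -
      obtain F \<B> where F: "finite \<B>"
        "topspace (Phi_space \<Lambda> \<A>) - U \<subseteq> Some ` (Inl ` F \<union> (\<Union>A\<in>\<B>. insert (Inr A) (Inl ` A)))"
        by (rule openin_Phi_None[OF U])
      have "insert None (Some ` Inr ` \<A>) - U \<subseteq> Some ` Inr ` \<B>"
      proof
        fix x assume x: "x \<in> insert None (Some ` Inr ` \<A>) - U"
        then have "x \<in> topspace (Phi_space \<Lambda> \<A>) - U" unfolding topspace_Phi by blast
        then have "x \<in> Some ` (Inl ` F \<union> (\<Union>A\<in>\<B>. insert (Inr A) (Inl ` A)))" using F(2) by blast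
        moreover obtain A where "x = Some (Inr A)" using x U(2) by blast
        ultimately show "x \<in> Some ` Inr ` \<B>" by auto
      qed
      then show ?thesis using F(1) finite_subset by blast
    qed
    fix g assume "g \<in> target \<rho> \<rightarrow> \<Lambda>"
    then have "\<exists>D. infinite D \<and> ((\<exists>c. \<forall>x\<in>val \<rho> D. g x = c) \<or> (\<exists>V\<in>\<V>. fun_conv \<rho> g D V))"
      using funs by (simp add: fun_solved_def)
    then obtain D where D: "infinite D" "(\<exists>c. \<forall>x\<in>val \<rho> D. g x = c) \<or> (\<exists>V\<in>\<V>. fun_conv \<rho> g D V)"
      by (elim exE conjE)
    have "(\<forall>c. \<exists>K. finite K \<and> c \<notin> g ` val \<rho> (D - K)) \<and>
        (\<exists>x\<in>topspace (Phi_space \<Lambda> \<A>). converges_along \<rho> (Phi_space \<Lambda> \<A>) (\<lambda>t. ?j (g t)) D x)"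
      if V: "V \<in> \<V>" and conv: "fun_conv \<rho> g D V" for V
    proof (intro conjI allI)
      have dec: "decseq V" and int: "(\<Inter>n. V n) = {}" and VL: "\<And>n. V n \<subseteq> \<Lambda>"
        using bspec[OF null V] by (simp_all add: null_seq_def)
      have tail: "\<exists>K. finite K \<and> g ` val \<rho> (D - K) \<subseteq> V n" for n using conv by (simp add: fun_conv_def)
      show "\<exists>K. finite K \<and> c \<notin> g ` val \<rho> (D - K)" for c
      proof -
        obtain n where "c \<notin> V n" using int by blast
        then show ?thesis using tail[of n] by blast
      qed
      show "\<exists>x\<in>topspace (Phi_space \<Lambda> \<A>). converges_along \<rho> (Phi_space \<Lambda> \<A>) (\<lambda>t. ?j (g t)) D x"
      proof (cases "\<exists>A\<in>\<A>. V = set_seq A")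
        case True
        then obtain A where A: "A \<in> \<A>" "V = set_seq A" by blast
        have "converges_along \<rho> (Phi_space \<Lambda> \<A>) (\<lambda>t. ?j (g t)) D (Some (Inr A))"
          unfolding converges_along_def
        proof (intro allI impI, elim conjE)
          fix U assume "openin (Phi_space \<Lambda> \<A>) U" "Some (Inr A) \<in> U"
          then obtain F where F: "finite F" "?j ` (A - F) \<subseteq> U" using openin_Phi_Inr by blast
          obtain n where n: "F \<inter> V n = {}" using finite_escapes[OF dec int F(1)] by blast
          have "V n \<subseteq> A" unfolding A(2) set_seq_def by blast
          moreover obtain K where K: "finite K" "g ` val \<rho> (D - K) \<subseteq> V n" using tail by blast
          ultimately have "g ` val \<rho> (D - K) \<subseteq> A - F" using n by blast
          then have "(\<lambda>t. ?j (g t)) ` val \<rho> (D - K) \<subseteq> U" using F(2) by blast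
          then show "\<exists>K. finite K \<and> (\<lambda>t. ?j (g t)) ` val \<rho> (D - K) \<subseteq> U" using K(1) by blast
        qed
        then show ?thesis using A(1) topspace_Phi by blast
      next
        case False
        have "converges_along \<rho> (Phi_space \<Lambda> \<A>) (\<lambda>t. ?j (g t)) D None"
          unfolding converges_along_def
        proof (intro allI impI, elim conjE)
          fix U assume U: "openin (Phi_space \<Lambda> \<A>) U" "None \<in> U"
          obtain F \<B> where F: "finite F" "finite \<B>" "\<B> \<subseteq> \<A>"
            "topspace (Phi_space \<Lambda> \<A>) - U \<subseteq> Some ` (Inl ` F \<union> (\<Union>A\<in>\<B>. insert (Inr A) (Inl ` A)))"
            by (rule openin_Phi_None[OF U])
          \<comment> \<open>In \<open>\<Lambda>\<close> the neighbourhood misses only points of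
            \<open>F\<close> and of the finitely many sets in \<open>\<B>\<close>; one term of
            \<open>V\<close> is disjoint from all of these.\<close>
          have "\<exists>n. \<forall>S\<in>insert F \<B>. S \<inter> V n = {}"
          proof (rule finite_family_escapes[OF dec])
            show "\<exists>n. S \<inter> V n = {}" if "S \<in> insert F \<B>" for S
              using that finite_escapes[OF dec int F(1)] disj[OF _ V, of S] F(3) False by blast
          qed (use F(2) in simp)
          then obtain n where n: "\<And>S. S \<in> insert F \<B> \<Longrightarrow> S \<inter> V n = {}" by blast
          have VU: "?j ` V n \<subseteq> U"
          proof
            fix x assume "x \<in> ?j ` V n"
            then obtain a where a: "a \<in> V n" "x = ?j a" by blast
            have "a \<notin> F" "\<forall>A\<in>\<B>. a \<notin> A" using n a(1) by blast+
            then have "x \<notin> Some ` (Inl ` F \<union> (\<Union>A\<in>\<B>. insert (Inr A) (Inl ` A)))" using a(2) by auto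
            moreover have "x \<in> topspace (Phi_space \<Lambda> \<A>)" unfolding topspace_Phi using VL a by blast
            ultimately show "x \<in> U" using F(4) by blast
          qed
          obtain K where K: "finite K" "g ` val \<rho> (D - K) \<subseteq> V n" using tail by blast
          then have "(\<lambda>t. ?j (g t)) ` val \<rho> (D - K) \<subseteq> U" using VU by blast
          then show "\<exists>K. finite K \<and> (\<lambda>t. ?j (g t)) ` val \<rho> (D - K) \<subseteq> U" using K(1) by blast
        qed
        then show ?thesis using topspace_Phi by blast
      qed
    qed
    then show "\<exists>D. infinite D \<and> ((\<exists>c. \<forall>x\<in>val \<rho> D. g x = c) \<or>
        (\<forall>c. \<exists>K. finite K \<and> c \<notin> g ` val \<rho> (D - K)) \<and>
        (\<exists>x\<in>topspace (Phi_space \<Lambda> \<A>). converges_along \<rho> (Phi_space \<Lambda> \<A>) (\<lambda>t. ?j (g t)) D x))"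
      using D by meson
  qed simp
  have "Phi_space \<Lambda> \<A> \<notin> FinBW \<Lambda> \<I>"
  proof
    assume "Phi_space \<Lambda> \<A> \<in> FinBW \<Lambda> \<I>"
    moreover have "?j \<in> \<Lambda> \<rightarrow> topspace (Phi_space \<Lambda> \<A>)" unfolding topspace_Phi by blast
    ultimately obtain B x where B: "B \<in> positive_sets \<Lambda> \<I>" and x: "x \<in> topspace (Phi_space \<Lambda> \<A>)"
      and conv: "\<And>U. openin (Phi_space \<Lambda> \<A>) U \<Longrightarrow> x \<in> U \<Longrightarrow> finite {a\<in>B. ?j a \<notin> U}"
      by (rule FinBW_D) blast
    consider a where "a \<in> \<Lambda>" "x = ?j a" | A where "A \<in> \<A>" "x = Some (Inr A)" | "x = None"
      using x unfolding topspace_Phi by blast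
    then show False
    proof cases
      case (1 a)
      have "finite {b\<in>B. ?j b \<notin> Some ` {Inl a}}"
        by (rule conv[OF openin_Phi_Some[OF openin_Psi_basic(1)[OF 1(1)]]]) (simp add: 1)
      moreover have "B \<subseteq> insert a {b\<in>B. ?j b \<notin> Some ` {Inl a}}" by auto
      ultimately show False using positive_infinite[OF B] finite_subset by blast
    next
      case (2 A)
      have "finite {b\<in>B. ?j b \<notin> Some ` insert (Inr A) (Inl ` (A - {}))}"
        by (rule conv[OF openin_Phi_Some[OF openin_Psi_basic(2)[OF 2(1)]]]) (simp_all add: 2)
      moreover have "B - A \<subseteq> {b\<in>B. ?j b \<notin> Some ` insert (Inr A) (Inl ` (A - {}))}" by auto
      \<comment> \<open>As \<open>A\<close> is in the ideal, \<open>B - A\<close> is positive and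
        hence infinite, so \<open>B\<close> cannot converge to the point \<open>A\<close>.\<close>
      moreover have "A \<in> \<I>" using 2(1) by (simp add: \<A>_def)
      ultimately show False using positive_infinite[OF positive_Diff[OF B]] finite_subset by blast
    next
      case 3
      obtain A where A: "A \<in> \<A>" "infinite (B \<inter> A)" using meet[OF B] by blast
      have "finite {b\<in>B. ?j b \<notin> topspace (Phi_space \<Lambda> \<A>) - Some ` insert (Inr A) (Inl ` A)}"
        by (rule conv[OF openin_Phi_Diff[OF A(1)]]) (auto simp: 3 topspace_Phi)
      moreover have "B \<inter> A \<subseteq> {b\<in>B. ?j b \<notin> topspace (Phi_space \<Lambda> \<A>) - Some ` insert (Inr A) (Inl ` A)}"
        by auto
      ultimately show False using A(2) finite_subset by blast
    qed
  qed
  then show ?thesis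
    using ad card rho top Hausdorff_Phi compact_Phi separable_Phi[OF countable_ground] by blast
qed

end

text \<open>Existence is claimed in one fixed type of points, whereas the implication from a space
  to the failure of \<open>\<le>\<^sub>K\<close> holds for every type of points; hence the separate
  statement with \<open>'x\<close>.\<close>

lemma (in refinable_set_fun) not_katetov_le_iff_example:
  fixes \<Lambda> :: "'l set" and \<I> :: "'l set set"
  assumes CH: "Continuum_Hypothesis" and ideal: "ideal_on \<Lambda> \<I>"
  shows "(\<not> rho_ideal \<Lambda> \<I> \<le>\<^sub>K \<rho> \<longleftrightarrow>
       (\<exists>X :: ('l + 'l set) option topology. rho_space \<rho> X \<and> X \<notin> FinBW \<Lambda> \<I>))"
    and "(\<exists>X :: 'x topology. rho_space \<rho> X \<and> X \<notin> FinBW \<Lambda> \<I>) \<longrightarrow> \<not> rho_ideal \<Lambda> \<I> \<le>\<^sub>K \<rho>"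
    and "\<not> rho_ideal \<Lambda> \<I> \<le>\<^sub>K \<rho> \<longrightarrow>
       (\<exists>X :: ('l + 'l set) option topology. rho_space \<rho> X \<and> X \<notin> FinBW \<Lambda> \<I> \<and>
          separable_space X \<and> unique_sequential_limits X)"
    and "\<not> rho_ideal \<Lambda> \<I> \<le>\<^sub>K \<rho> \<and> P_minus \<Lambda> \<I> \<longrightarrow>
       (\<exists>\<A>. almost_disjoint_family \<Lambda> \<A> \<and> \<A> \<approx> (UNIV :: real set) \<and>
          rho_space \<rho> (Phi_space \<Lambda> \<A>) \<and> Phi_space \<Lambda> \<A> \<notin> FinBW \<Lambda> \<I> \<and>
          Hausdorff_space (Phi_space \<Lambda> \<A>) \<and> compact_space (Phi_space \<Lambda> \<A>) \<and>
          separable_space (Phi_space \<Lambda> \<A>) \<and> topspace (Phi_space \<Lambda> \<A>) \<approx> (UNIV :: real set))"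
proof -
  have nk: "non_katetov \<rho> le \<Lambda> \<I>" if "\<not> rho_ideal \<Lambda> \<I> \<le>\<^sub>K \<rho>"
    by unfold_locales (rule ideal that)+
  show example: "\<not> rho_ideal \<Lambda> \<I> \<le>\<^sub>K \<rho> \<longrightarrow>
       (\<exists>X :: ('l + 'l set) option topology. rho_space \<rho> X \<and> X \<notin> FinBW \<Lambda> \<I> \<and>
          separable_space X \<and> unique_sequential_limits X)"
    using non_katetov.nbhd_space_example[OF nk CH] by (rule impI)
  show "\<not> rho_ideal \<Lambda> \<I> \<le>\<^sub>K \<rho> \<longleftrightarrow>
       (\<exists>X :: ('l + 'l set) option topology. rho_space \<rho> X \<and> X \<notin> FinBW \<Lambda> \<I>)"
    using example katetov_le_FinBW by blast
  show "(\<exists>X :: 'x topology. rho_space \<rho> X \<and> X \<notin> FinBW \<Lambda> \<I>) \<longrightarrow> \<not> rho_ideal \<Lambda> \<I> \<le>\<^sub>K \<rho>"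
    using katetov_le_FinBW by blast
  show "\<not> rho_ideal \<Lambda> \<I> \<le>\<^sub>K \<rho> \<and> P_minus \<Lambda> \<I> \<longrightarrow>
       (\<exists>\<A>. almost_disjoint_family \<Lambda> \<A> \<and> \<A> \<approx> (UNIV :: real set) \<and>
          rho_space \<rho> (Phi_space \<Lambda> \<A>) \<and> Phi_space \<Lambda> \<A> \<notin> FinBW \<Lambda> \<I> \<and>
          Hausdorff_space (Phi_space \<Lambda> \<A>) \<and> compact_space (Phi_space \<Lambda> \<A>) \<and>
          separable_space (Phi_space \<Lambda> \<A>) \<and> topspace (Phi_space \<Lambda> \<A>) \<approx> (UNIV :: real set))"
    using non_katetov.Phi_space_example[OF nk CH] by (intro impI) (elim conjE)
qed

theorem corollary18p1:
  fixes \<Lambda> :: "'l set" and \<I> :: "'l set set"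
  assumes CH: "Continuum_Hypothesis"
    and ideal: "ideal_on \<Lambda> \<I>"
  shows "
     ((\<not> rho_ideal \<Lambda> \<I> \<le>\<^sub>K FS \<longleftrightarrow>
         (\<exists>X :: ('l + 'l set) option topology. Hindman_space X \<and> X \<notin> FinBW \<Lambda> \<I>)) \<and>
      ((\<exists>X :: 'x topology. Hindman_space X \<and> X \<notin> FinBW \<Lambda> \<I>) \<longrightarrow>
         \<not> rho_ideal \<Lambda> \<I> \<le>\<^sub>K FS) \<and>
      (\<not> rho_ideal \<Lambda> \<I> \<le>\<^sub>K FS \<longrightarrow>
         (\<exists>X :: ('l + 'l set) option topology. Hindman_space X \<and> X \<notin> FinBW \<Lambda> \<I> \<and>
            separable_space X \<and> unique_sequential_limits X)) \<and>
      (\<not> rho_ideal \<Lambda> \<I> \<le>\<^sub>K FS \<and> P_minus \<Lambda> \<I> \<longrightarrow>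
         (\<exists>\<A>. almost_disjoint_family \<Lambda> \<A> \<and> \<A> \<approx> (UNIV :: real set) \<and>
            Hindman_space (Phi_space \<Lambda> \<A>) \<and> Phi_space \<Lambda> \<A> \<notin> FinBW \<Lambda> \<I> \<and>
            Hausdorff_space (Phi_space \<Lambda> \<A>) \<and> compact_space (Phi_space \<Lambda> \<A>) \<and>
            separable_space (Phi_space \<Lambda> \<A>) \<and>
            topspace (Phi_space \<Lambda> \<A>) \<approx> (UNIV :: real set)))) \<and>
     ((\<not> rho_ideal \<Lambda> \<I> \<le>\<^sub>K pairs_fun \<longleftrightarrow>
         (\<exists>X :: ('l + 'l set) option topology. Ramsey_space X \<and> X \<notin> FinBW \<Lambda> \<I>)) \<and>
      ((\<exists>X :: 'x topology. Ramsey_space X \<and> X \<notin> FinBW \<Lambda> \<I>) \<longrightarrow>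
         \<not> rho_ideal \<Lambda> \<I> \<le>\<^sub>K pairs_fun) \<and>
      (\<not> rho_ideal \<Lambda> \<I> \<le>\<^sub>K pairs_fun \<longrightarrow>
         (\<exists>X :: ('l + 'l set) option topology. Ramsey_space X \<and> X \<notin> FinBW \<Lambda> \<I> \<and>
            separable_space X \<and> unique_sequential_limits X)) \<and>
      (\<not> rho_ideal \<Lambda> \<I> \<le>\<^sub>K pairs_fun \<and> P_minus \<Lambda> \<I> \<longrightarrow>
         (\<exists>\<A>. almost_disjoint_family \<Lambda> \<A> \<and> \<A> \<approx> (UNIV :: real set) \<and>
            Ramsey_space (Phi_space \<Lambda> \<A>) \<and> Phi_space \<Lambda> \<A> \<notin> FinBW \<Lambda> \<I> \<and>
            Hausdorff_space (Phi_space \<Lambda> \<A>) \<and> compact_space (Phi_space \<Lambda> \<A>) \<and>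
            separable_space (Phi_space \<Lambda> \<A>) \<and>
            topspace (Phi_space \<Lambda> \<A>) \<approx> (UNIV :: real set)))) \<and>
     ((\<not> rho_ideal \<Lambda> \<I> \<le>\<^sub>K Diff_fun \<longleftrightarrow>
         (\<exists>X :: ('l + 'l set) option topology. differentially_compact_space X \<and> X \<notin> FinBW \<Lambda> \<I>)) \<and>
      ((\<exists>X :: 'x topology. differentially_compact_space X \<and> X \<notin> FinBW \<Lambda> \<I>) \<longrightarrow>
         \<not> rho_ideal \<Lambda> \<I> \<le>\<^sub>K Diff_fun) \<and>
      (\<not> rho_ideal \<Lambda> \<I> \<le>\<^sub>K Diff_fun \<longrightarrow>
         (\<exists>X :: ('l + 'l set) option topology. differentially_compact_space X \<and> X \<notin> FinBW \<Lambda> \<I> \<and>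
            separable_space X \<and> unique_sequential_limits X)) \<and>
      (\<not> rho_ideal \<Lambda> \<I> \<le>\<^sub>K Diff_fun \<and> P_minus \<Lambda> \<I> \<longrightarrow>
         (\<exists>\<A>. almost_disjoint_family \<Lambda> \<A> \<and> \<A> \<approx> (UNIV :: real set) \<and>
            differentially_compact_space (Phi_space \<Lambda> \<A>) \<and> Phi_space \<Lambda> \<A> \<notin> FinBW \<Lambda> \<I> \<and>
            Hausdorff_space (Phi_space \<Lambda> \<A>) \<and> compact_space (Phi_space \<Lambda> \<A>) \<and>
            separable_space (Phi_space \<Lambda> \<A>) \<and>
            topspace (Phi_space \<Lambda> \<A>) \<approx> (UNIV :: real set))))"
  unfolding Hindman_space_def Ramsey_space_def differentially_compact_space_def
  by (intro conjI refinable_set_fun.not_katetov_le_iff_example[OF refinable_FS CH ideal]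
      refinable_set_fun.not_katetov_le_iff_example[OF refinable_pairs_fun CH ideal]
      refinable_set_fun.not_katetov_le_iff_example[OF refinable_Diff_fun CH ideal])

end
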